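(* Let $(A_n)$ be a sequence of real $n\times n$ matrices with $\mathrm{Tr}(A_n^TA_n)=n$, and suppose that \[\lim_{n\to\infty}\frac{1}{n^2}\sum_{i\neq j}(A_n)_{ii}(A_n)_{jj}=c\] for some constant $c$. Let $M$ be an $n\times n$ Haar-distributed random orthogonal matrix and $C_n$ the permutation matrix of the $n$-cycle $(1,2,\dots,n)$. Then \[\mathrm{Tr}(A_nMC_nM^T)\xrightarrow{d}\mathcal{N}(0,1-c)\quad\text{as } n\to\infty.\]
   Context: Haar measure on $O(n)$ is the unique left- and right-invariant probability measure. $C_n$ is the $n\times n$ matrix with $(C_n)_{i,i+1}=1$ for all $i$ (indices mod $n$, so $(C_n)_{n,1}=1$) and all other entries $0$; thus $(MC_nM^T)_{ab}=\sum_{i=1}^n M_{a,i}M_{b,i+1}$ with $M_{b,n+1}:=M_{b,1}$. *)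

theory Defs
  imports "HOL-Probability.Probability"
begin

text \<open>Real n x n matrices, indices 0..n-1, represented as extensional functions
  nat \<Rightarrow> nat \<Rightarrow> real, living in the product measurable space below.\<close>

definition mat_space :: "nat \<Rightarrow> (nat \<Rightarrow> nat \<Rightarrow> real) measure" where
  "mat_space n = PiM {..<n} (\<lambda>_. PiM {..<n} (\<lambda>_. lborel))"

definition mmul :: "nat \<Rightarrow> (nat \<Rightarrow> nat \<Rightarrow> real) \<Rightarrow> (nat \<Rightarrow> nat \<Rightarrow> real) \<Rightarrow> (nat \<Rightarrow> nat \<Rightarrow> real)" where
  "mmul n A B = (\<lambda>i\<in>{..<n}. \<lambda>j\<in>{..<n}. \<Sum>k<n. A i k * B k j)"

definition mtrans :: "nat \<Rightarrow> (nat \<Rightarrow> nat \<Rightarrow> real) \<Rightarrow> (nat \<Rightarrow> nat \<Rightarrow> real)" where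
  "mtrans n A = (\<lambda>i\<in>{..<n}. \<lambda>j\<in>{..<n}. A j i)"

definition mid :: "nat \<Rightarrow> (nat \<Rightarrow> nat \<Rightarrow> real)" where
  "mid n = (\<lambda>i\<in>{..<n}. \<lambda>j\<in>{..<n}. if i = j then 1 else 0)"

definition mtrace :: "nat \<Rightarrow> (nat \<Rightarrow> nat \<Rightarrow> real) \<Rightarrow> real" where
  "mtrace n A = (\<Sum>i<n. A i i)"

definition cycle_mat :: "nat \<Rightarrow> (nat \<Rightarrow> nat \<Rightarrow> real)" where
  "cycle_mat n = (\<lambda>i\<in>{..<n}. \<lambda>j\<in>{..<n}. if j = (i + 1) mod n then 1 else 0)"

definition orth_group :: "nat \<Rightarrow> (nat \<Rightarrow> nat \<Rightarrow> real) set" where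
  "orth_group n = {M \<in> space (mat_space n). mmul n M (mtrans n M) = mid n}"

definition haar_O :: "nat \<Rightarrow> (nat \<Rightarrow> nat \<Rightarrow> real) measure" where
  "haar_O n = (THE \<mu>. prob_space \<mu> \<and> sets \<mu> = sets (mat_space n) \<and>
      emeasure \<mu> (orth_group n) = 1 \<and>
      (\<forall>Q\<in>orth_group n. distr \<mu> (mat_space n) (\<lambda>M. mmul n Q M) = \<mu> \<and>
                         distr \<mu> (mat_space n) (\<lambda>M. mmul n M Q) = \<mu>))"

definition normal_measure :: "real \<Rightarrow> real \<Rightarrow> real measure" where
  "normal_measure m v = (if v = 0 then return borel m
                         else density lborel (normal_density m (sqrt v)))"

end

theory Submission
  imports Defs "HOL-Library.Function_Algebras" "HOL-Real_Asymp.Real_Asymp"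
begin

text \<open>The proof is Stein's method by infinitesimal rotations. Put \<open>D = M C M\<^sup>T\<close>; its law is
  invariant under conjugation, \<open>D\<close> is orthogonal and \<open>tr D = tr D\<^sup>2 = 0\<close>. Subtracting a multiple of
  the identity from \<open>A\<close> does not change \<open>W = tr (D A)\<close>, so \<open>A\<close> may be assumed traceless.
  Differentiating along \<open>D \<mapsto> R\<^sub>t D R\<^sub>t\<^sup>T\<close> for the rotations \<open>R\<^sub>t\<close> in the \<open>(a,b)\<close>-plane and summing over
  \<open>a, b\<close> gives an integration by parts formula in which \<open>W\<close> is almost an eigenfunction of the
  Laplacian: \<open>E [(2(n-1) W + 2 W') \<phi>(W)] = E [\<Gamma> \<phi>'(W)]\<close> with \<open>W' = tr (D A\<^sup>T)\<close> and
  \<open>\<Gamma> = 2 |A|\<^sup>2 - 2 tr (D A D\<^sup>T A\<^sup>T) - 2 tr (D A D A) + 2 tr (D\<^sup>2 A\<^sup>2)\<close>. The same formula applied to each of the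
  three traces bounds its second moment by \<open>O(n)\<close>, using only deterministic Frobenius norm
  estimates; hence \<open>\<Gamma>\<close> concentrates at \<open>2 |A|\<^sup>2\<close>. For \<open>\<phi> = sin (t \<cdot>)\<close> and \<open>\<phi> = cos (t \<cdot>)\<close> this is a perturbed
  differential equation \<open>\<psi>' = - \<sigma> t \<psi> + o(1)\<close> for the characteristic function \<open>\<psi>\<close> of \<open>W\<close>, where
  \<open>\<sigma> = |A|\<^sup>2 / (n-1) \<longlonglongrightarrow> 1 - c\<close>, and Levy's continuity theorem concludes.

  Since \<^const>\<open>haar_O\<close> is a definite description, Haar measure has to be shown to exist and to be unique.
  Existence: Gram-Schmidt applied to the rows of a Gaussian matrix gives a right invariant law on \<open>O(n)\<close>,
  and \<open>M\<^sup>T N\<close> is two-sided invariant for independent \<open>M\<close>, \<open>N\<close> with this law. Uniqueness: Fubini.\<close>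

section \<open>The orthogonal group\<close>

text \<open>Only invariance under conjugation is known for the law of \<open>D\<close>, so the
  available directions are commutators with antisymmetric matrices, spanned by the
  \<open>rot_gen a b\<close>. Taking the gradient \<open>D A - A D\<close> of \<open>W\<close>
  itself as vector field makes its divergence linear in \<open>D\<close> once
  \<open>tr D = 0\<close>; the terms with \<open>a = b\<close> cancel, whence \<open>n - 1\<close>.
  The second moments of \<open>W\<close> and \<open>W'\<close> are then bounded, so
  \<open>2 W'\<close> is negligible against \<open>2 (n - 1) W\<close>. The obstacle is
  \<open>\<Gamma>\<close>: pointwise its three traces are only bounded by \<open>|A|^2\<close>,
  which is of order \<open>n\<close>, and they must be shown to be o(n) on average. For the two
  traces that are quadratic in \<open>D\<close> with separated factors, a second integration by
  parts produces terms with the factor \<open>tr A\<close>; only the reduction to traceless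
  \<open>A\<close> removes them. In \<open>tr (D^2 A^2)\<close> the matrix \<open>A^2\<close> need
  not be traceless; there \<open>D^2\<close> is treated as a new conjugation invariant orthogonal
  matrix of trace zero, and the linear bound applies. The variance arises from
  \<open>|A - (tr A / n) I|^2 = n - (tr A)^2 / n\<close>, where \<open>(tr A)^2 / n^2\<close>
  differs from the given average only by the squared diagonal entries, at most \<open>1 / n\<close>
  in total.\<close>

lemma space_mat_space: "space (mat_space n) = (\<Pi>\<^sub>E i\<in>{..<n}. \<Pi>\<^sub>E j\<in>{..<n}. UNIV)"
  by (simp add: mat_space_def space_PiM)

lemma measurable_entry:
  assumes "f \<in> measurable M (mat_space n)" "i < n" "j < n"
  shows "(\<lambda>x. f x i j) \<in> borel_measurable M"
proof -
  have 1: "(\<lambda>x. f x i) \<in> measurable M (PiM {..<n} (\<lambda>_. lborel))"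
    using assms unfolding mat_space_def
    by (intro measurable_compose[OF _ measurable_component_singleton[of i "{..<n}" "\<lambda>_. PiM {..<n} (\<lambda>_. lborel)"]]) auto
  show ?thesis
    using measurable_compose[OF 1 measurable_component_singleton[of j "{..<n}" "\<lambda>_. lborel"]] assms by simp
qed

lemma measurable_mat_space_restrict:
  assumes "\<And>i j. i < n \<Longrightarrow> j < n \<Longrightarrow> (\<lambda>x. f x i j) \<in> borel_measurable M"
  shows "(\<lambda>x. \<lambda>i\<in>{..<n}. \<lambda>j\<in>{..<n}. f x i j) \<in> measurable M (mat_space n)"
  unfolding mat_space_def using assms by (intro measurable_restrict) auto

lemma measurable_mmul:
  assumes "f \<in> measurable M (mat_space n)" "g \<in> measurable M (mat_space n)"
  shows "(\<lambda>x. mmul n (f x) (g x)) \<in> measurable M (mat_space n)"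
  unfolding mmul_def
  by (intro measurable_mat_space_restrict borel_measurable_sum borel_measurable_times
        measurable_entry[OF assms(1)] measurable_entry[OF assms(2)]) auto

lemma measurable_mtrans:
  assumes "f \<in> measurable M (mat_space n)"
  shows "(\<lambda>x. mtrans n (f x)) \<in> measurable M (mat_space n)"
  unfolding mtrans_def
  by (intro measurable_mat_space_restrict measurable_entry[OF assms(1)]) auto

lemma mat_space_eqI:
  assumes "A \<in> space (mat_space n)" "B \<in> space (mat_space n)"
    "\<And>i j. i < n \<Longrightarrow> j < n \<Longrightarrow> A i j = B i j"
  shows "A = B"
proof (rule PiE_ext)
  show "A \<in> (\<Pi>\<^sub>E i\<in>{..<n}. \<Pi>\<^sub>E j\<in>{..<n}. UNIV)" "B \<in> (\<Pi>\<^sub>E i\<in>{..<n}. \<Pi>\<^sub>E j\<in>{..<n}. UNIV)"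
    using assms by (auto simp: space_mat_space)
  fix i assume "i \<in> {..<n}"
  then show "A i = B i"
    using assms by (intro PiE_ext[of "A i" "{..<n}" "\<lambda>_. UNIV"]) (auto simp: space_mat_space)
qed

lemma mmul_space [simp]: "mmul n A B \<in> space (mat_space n)"
  by (auto simp: mmul_def space_mat_space)

lemma mtrans_space [simp]: "mtrans n A \<in> space (mat_space n)"
  by (auto simp: mtrans_def space_mat_space)

lemma mid_space [simp]: "mid n \<in> space (mat_space n)"
  by (auto simp: mid_def space_mat_space)

lemma mmul_apply: "i < n \<Longrightarrow> j < n \<Longrightarrow> mmul n A B i j = (\<Sum>k<n. A i k * B k j)"
  by (simp add: mmul_def)

lemma mtrans_apply: "i < n \<Longrightarrow> j < n \<Longrightarrow> mtrans n A i j = A j i"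
  by (simp add: mtrans_def)

lemma mid_apply: "i < n \<Longrightarrow> j < n \<Longrightarrow> mid n i j = of_bool (i = j)"
  by (simp add: mid_def)

lemma mmul_assoc: "mmul n (mmul n A B) C = mmul n A (mmul n B C)"
proof (rule mat_space_eqI)
  fix i j assume ij: "i < n" "j < n"
  have "mmul n (mmul n A B) C i j = (\<Sum>k<n. \<Sum>l<n. A i l * B l k * C k j)"
    using ij by (simp add: mmul_apply sum_distrib_right)
  also have "\<dots> = (\<Sum>l<n. \<Sum>k<n. A i l * B l k * C k j)"
    by (rule sum.swap)
  also have "\<dots> = mmul n A (mmul n B C) i j"
    using ij by (simp add: mmul_apply sum_distrib_left mult.assoc)
  finally show "mmul n (mmul n A B) C i j = mmul n A (mmul n B C) i j" .
qed auto

lemma mtrans_mmul: "mtrans n (mmul n A B) = mmul n (mtrans n B) (mtrans n A)"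
  by (rule mat_space_eqI[of _ n]) (auto simp: mmul_apply mtrans_apply mult.commute)

lemma mtrans_mtrans: "A \<in> space (mat_space n) \<Longrightarrow> mtrans n (mtrans n A) = A"
  by (rule mat_space_eqI[of _ n]) (auto simp: mtrans_apply)

lemma mmul_mid_left: "A \<in> space (mat_space n) \<Longrightarrow> mmul n (mid n) A = A"
  by (rule mat_space_eqI[of _ n]) (auto simp: mmul_apply mid_apply if_distrib cong: if_cong)

lemma mmul_mid_right: "A \<in> space (mat_space n) \<Longrightarrow> mmul n A (mid n) = A"
  by (rule mat_space_eqI[of _ n]) (auto simp: mmul_apply mid_apply if_distrib cong: if_cong)

lemma orth_group_iff:
  "M \<in> orth_group n \<longleftrightarrow> M \<in> space (mat_space n) \<and>
     (\<forall>i<n. \<forall>j<n. (\<Sum>k<n. M i k * M j k) = of_bool (i = j))"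
proof -
  have "mmul n M (mtrans n M) = mid n \<longleftrightarrow>
     (\<forall>i<n. \<forall>j<n. mmul n M (mtrans n M) i j = mid n i j)"
    using mat_space_eqI[of "mmul n M (mtrans n M)" n "mid n"] by auto
  then show ?thesis
    by (auto simp: orth_group_def mmul_apply mtrans_apply mid_apply)
qed

text \<open>The matrix \<open>P = M\<^sup>T M\<close> is an orthogonal projection of trace \<open>n\<close>, so
  \<open>I - P\<close> has Frobenius norm \<open>0\<close>.\<close>

lemma orth_group_columns:
  assumes M: "M \<in> orth_group n" and ij: "i < n" "j < n"
  shows "(\<Sum>k<n. M k i * M k j) = of_bool (i = j)"
proof -
  have rows: "(\<Sum>k<n. M i k * M j k) = of_bool (i = j)" if "i < n" "j < n" for i j
    using M that by (auto simp: orth_group_iff)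
  define P where "P i j = (\<Sum>k<n. M k i * M k j)" for i j
  have PP: "(\<Sum>j<n. P i j * P i j) = P i i" for i
  proof -
    have "(\<Sum>j<n. P i j * P i j) = (\<Sum>j<n. \<Sum>k<n. \<Sum>l<n. M k i * M k j * (M l i * M l j))"
      by (simp add: P_def sum_product)
    also have "\<dots> = (\<Sum>k<n. \<Sum>j<n. \<Sum>l<n. M k i * M k j * (M l i * M l j))"
      by (rule sum.swap)
    also have "\<dots> = (\<Sum>k<n. \<Sum>l<n. \<Sum>j<n. M k i * M k j * (M l i * M l j))"
      by (intro sum.cong refl sum.swap)
    also have "\<dots> = (\<Sum>k<n. \<Sum>l<n. M k i * M l i * (\<Sum>j<n. M k j * M l j))"
      by (simp add: sum_distrib_left mult_ac)
    also have "\<dots> = (\<Sum>k<n. \<Sum>l<n. M k i * M l i * of_bool (k = l))"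
      using rows by (intro sum.cong refl) simp
    also have "\<dots> = P i i"
      by (simp add: P_def)
    finally show ?thesis .
  qed
  have "(\<Sum>i<n. P i i) = (\<Sum>k<n. \<Sum>i<n. M k i * M k i)"
    unfolding P_def by (rule sum.swap)
  also have "\<dots> = real n"
    using rows by simp
  finally have trP: "(\<Sum>i<n. P i i) = real n" .
  have "(\<Sum>i<n. \<Sum>j<n. (of_bool (i = j) - P i j)\<^sup>2) = (\<Sum>i<n. \<Sum>j<n. of_bool (i = j) - 2 * (of_bool (i = j) * P i j) + P i j * P i j)"
    by (intro sum.cong refl) (auto simp: power2_eq_square algebra_simps)
  also have "\<dots> = (\<Sum>i<n. 1 - 2 * P i i + P i i)"
    by (intro sum.cong refl)
       (simp add: sum.distrib sum_subtractf PP flip: sum_distrib_left)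
  also have "\<dots> = 0"
    using trP by (simp add: sum_subtractf)
  finally have z: "(\<Sum>i<n. \<Sum>j<n. (of_bool (i = j) - P i j)\<^sup>2) = 0" .
  then have "(\<Sum>j<n. (of_bool (i = j) - P i j)\<^sup>2) = 0"
    using ij by (subst (asm) sum_nonneg_eq_0_iff) (auto intro: sum_nonneg)
  then have "(of_bool (i = j) - P i j)\<^sup>2 = 0"
    using ij by (subst (asm) sum_nonneg_eq_0_iff) auto
  then show ?thesis
    by (simp add: P_def)
qed

lemma orth_group_space: "M \<in> orth_group n \<Longrightarrow> M \<in> space (mat_space n)"
  by (simp add: orth_group_def)

lemma orth_group_mtrans_mult: "M \<in> orth_group n \<Longrightarrow> mmul n (mtrans n M) M = mid n"
  by (rule mat_space_eqI[of _ n]) (auto simp: mmul_apply mtrans_apply mid_apply orth_group_columns)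

lemma orth_group_mult_mtrans: "M \<in> orth_group n \<Longrightarrow> mmul n M (mtrans n M) = mid n"
  by (simp add: orth_group_def)

lemma orth_group_mtrans: "M \<in> orth_group n \<Longrightarrow> mtrans n M \<in> orth_group n"
  by (simp add: orth_group_def mtrans_mtrans orth_group_mtrans_mult)

lemma orth_group_mmul:
  assumes "M \<in> orth_group n" "N \<in> orth_group n"
  shows "mmul n M N \<in> orth_group n"
proof -
  have "mmul n (mmul n M N) (mtrans n (mmul n M N)) = mmul n M (mmul n (mmul n N (mtrans n N)) (mtrans n M))"
    by (simp add: mtrans_mmul mmul_assoc)
  also have "\<dots> = mid n"
    using assms by (simp add: orth_group_mult_mtrans mmul_mid_left)
  finally show ?thesis by (simp add: orth_group_def)
qed

lemma sets_orth_group: "orth_group n \<in> sets (mat_space n)"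
proof -
  have "orth_group n = {M \<in> space (mat_space n). \<forall>i\<in>{..<n}. \<forall>j\<in>{..<n}. (\<Sum>k<n. M i k * M j k) = of_bool (i = j)}"
    by (auto simp: orth_group_iff)
  also have "\<dots> \<in> sets (mat_space n)"
    by (intro sets.sets_Collect_finite_All' borel_measurable_eq borel_measurable_sum
          borel_measurable_times borel_measurable_const measurable_entry[OF measurable_ident_sets[OF refl]] sets.sets_Collect_finite_All) auto
  finally show ?thesis .
qed

section \<open>Gaussian matrices\<close>

definition vec_space :: "nat \<Rightarrow> (nat \<Rightarrow> real) measure" where
  "vec_space n = PiM {..<n} (\<lambda>_. lborel)"

definition vadd :: "nat \<Rightarrow> (nat \<Rightarrow> real) \<Rightarrow> (nat \<Rightarrow> real) \<Rightarrow> (nat \<Rightarrow> real)" where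
  "vadd n x y = (\<lambda>i\<in>{..<n}. x i + y i)"

text \<open>Row vectors act from the left, so multiplying a matrix on the right acts on each row
  separately (\<open>mmul_row\<close>). This is why Gaussian matrices are built row by row.\<close>

definition vmul :: "nat \<Rightarrow> (nat \<Rightarrow> real) \<Rightarrow> (nat \<Rightarrow> nat \<Rightarrow> real) \<Rightarrow> (nat \<Rightarrow> real)" where
  "vmul n x Q = (\<lambda>j\<in>{..<n}. \<Sum>k<n. x k * Q k j)"

definition gauss_density :: "nat \<Rightarrow> (nat \<Rightarrow> real) \<Rightarrow> real" where
  "gauss_density n x = (\<Prod>i<n. std_normal_density (x i))"

lemma mat_space_eq_vec: "mat_space n = PiM {..<n} (\<lambda>_. vec_space n)"
  by (simp add: mat_space_def vec_space_def)

lemma space_vec_space: "space (vec_space n) = (\<Pi>\<^sub>E j\<in>{..<n}. UNIV)"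
  by (simp add: vec_space_def space_PiM)

lemma vadd_space [simp]: "vadd n x y \<in> space (vec_space n)"
  by (auto simp: vadd_def space_vec_space)

lemma vmul_space [simp]: "vmul n x Q \<in> space (vec_space n)"
  by (auto simp: vmul_def space_vec_space)

lemma vec_space_eqI:
  assumes "x \<in> space (vec_space n)" "y \<in> space (vec_space n)" "\<And>i. i < n \<Longrightarrow> x i = y i"
  shows "x = y"
  using assms by (intro PiE_ext[of x "{..<n}" "\<lambda>_. UNIV" y]) (auto simp: space_vec_space)

lemma measurable_vec_entry:
  assumes "f \<in> measurable M (vec_space n)" "i < n"
  shows "(\<lambda>x. f x i) \<in> borel_measurable M"
  using measurable_compose[OF assms(1)[unfolded vec_space_def]
      measurable_component_singleton[of i "{..<n}" "\<lambda>_. lborel"]] assms(2) by simp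

lemma measurable_vec_space_restrict:
  assumes "\<And>i. i < n \<Longrightarrow> (\<lambda>x. f x i) \<in> borel_measurable M"
  shows "(\<lambda>x. \<lambda>i\<in>{..<n}. f x i) \<in> measurable M (vec_space n)"
  unfolding vec_space_def using assms by (intro measurable_restrict) auto

lemma measurable_vadd [measurable (raw)]:
  assumes "f \<in> measurable M (vec_space n)" "g \<in> measurable M (vec_space n)"
  shows "(\<lambda>x. vadd n (f x) (g x)) \<in> measurable M (vec_space n)"
  unfolding vadd_def
  by (intro measurable_vec_space_restrict borel_measurable_add
        measurable_vec_entry[OF assms(1)] measurable_vec_entry[OF assms(2)]) auto

lemma measurable_vmul [measurable (raw)]:
  assumes "f \<in> measurable M (vec_space n)"
  shows "(\<lambda>x. vmul n (f x) Q) \<in> measurable M (vec_space n)"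
  unfolding vmul_def
  by (intro measurable_vec_space_restrict borel_measurable_sum borel_measurable_times
        measurable_vec_entry[OF assms(1)]) auto

lemma measurable_gauss_density [measurable (raw)]:
  assumes "f \<in> measurable M (vec_space n)"
  shows "(\<lambda>x. gauss_density n (f x)) \<in> borel_measurable M"
  unfolding gauss_density_def
  by (intro borel_measurable_prod measurable_compose[OF _ borel_measurable_normal_density]
        measurable_vec_entry[OF assms(1)]) auto

section \<open>Translation and rotation invariance of Lebesgue measure\<close>

interpretation vec: product_sigma_finite "\<lambda>_::nat. lborel :: real measure"
  by standard

lemma sigma_finite_vec_space: "sigma_finite_measure (vec_space n)"
  unfolding vec_space_def by (rule vec.sigma_finite) simp

text \<open>On boxes both sides are products, which reduces the claim to translation invariance of
  \<open>lborel\<close> in each coordinate.\<close>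

lemma vec_space_translate:
  "distr (vec_space n) (vec_space n) (\<lambda>x. vadd n x y) = vec_space n"
  unfolding vec_space_def
proof (rule vec.PiM_eqI)
  show "finite {..<n}" by simp
  show "sets (distr (PiM {..<n} (\<lambda>_. lborel)) (PiM {..<n} (\<lambda>_. lborel)) (\<lambda>x. vadd n x y)) = sets (PiM {..<n} (\<lambda>_. lborel))"
    by simp
  fix A :: "nat \<Rightarrow> real set" assume A: "\<And>i. i \<in> {..<n} \<Longrightarrow> A i \<in> sets lborel"
  have m: "(\<lambda>x. vadd n x y) \<in> measurable (PiM {..<n} (\<lambda>_. lborel)) (PiM {..<n} (\<lambda>_. lborel))"
    unfolding vadd_def by (intro measurable_restrict) measurable
  have s: "(\<lambda>x. x + y i) -` A i \<in> sets lborel" if "i < n" for i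
    using that A[of i] measurable_sets[of "\<lambda>x. x + y i" borel borel "A i"] by simp
  have eq: "(\<lambda>x. vadd n x y) -` (Pi\<^sub>E {..<n} A) \<inter> space (PiM {..<n} (\<lambda>_. lborel)) = (\<Pi>\<^sub>E i\<in>{..<n}. (\<lambda>x. x + y i) -` A i)"
    by (auto simp: vadd_def space_PiM PiE_iff)
  have "emeasure (distr (PiM {..<n} (\<lambda>_. lborel)) (PiM {..<n} (\<lambda>_. lborel)) (\<lambda>x. vadd n x y)) (Pi\<^sub>E {..<n} A) =
     emeasure (PiM {..<n} (\<lambda>_. lborel)) (\<Pi>\<^sub>E i\<in>{..<n}. (\<lambda>x. x + y i) -` A i)"
    using A by (subst emeasure_distr[OF m]) (auto simp: eq intro!: sets_PiM_I_finite)
  also have "\<dots> = (\<Prod>i<n. emeasure lborel ((\<lambda>x. x + y i) -` A i))"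
    using s by (subst vec.emeasure_PiM) auto
  also have "\<dots> = (\<Prod>i<n. emeasure lborel (A i))"
  proof (intro prod.cong refl)
    fix i assume i: "i \<in> {..<n}"
    have "emeasure lborel (A i) = emeasure (distr lborel borel ((+) (y i))) (A i)"
      by (simp add: lborel_distr_plus)
    also have "\<dots> = emeasure lborel ((\<lambda>x. x + y i) -` A i)"
      using A[OF i] by (subst emeasure_distr) (auto simp: vimage_def add.commute)
    finally show "emeasure lborel ((\<lambda>x. x + y i) -` A i) = emeasure lborel (A i)" ..
  qed
  finally show "emeasure (distr (PiM {..<n} (\<lambda>_. lborel)) (PiM {..<n} (\<lambda>_. lborel)) (\<lambda>x. vadd n x y)) (Pi\<^sub>E {..<n} A) = (\<Prod>i<n. emeasure lborel (A i))" .
qed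

lemma nn_integral_vec_translate:
  assumes "f \<in> borel_measurable (vec_space n)" "y \<in> space (vec_space n)"
  shows "(\<integral>\<^sup>+x. f (vadd n x y) \<partial>vec_space n) = (\<integral>\<^sup>+x. f x \<partial>vec_space n)"
proof -
  have "(\<integral>\<^sup>+x. f x \<partial>distr (vec_space n) (vec_space n) (\<lambda>x. vadd n x y)) = (\<integral>\<^sup>+x. f (vadd n x y) \<partial>vec_space n)"
    using assms by (intro nn_integral_distr measurable_vadd) auto
  then show ?thesis
    by (simp add: vec_space_translate)
qed

text \<open>The density is a function of the sum of squares; its invariance under orthogonal maps
  and under negation follows from this form.\<close>

lemma gauss_density_exp:
  "gauss_density n x = (1 / sqrt (2 * pi)) ^ n * exp (- (\<Sum>i<n. (x i)\<^sup>2) / 2)"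
  unfolding gauss_density_def std_normal_density_def
  by (simp add: prod.distrib exp_sum[symmetric] sum_negf sum_divide_distrib prod_dividef power_one_over)

lemma nn_integral_gauss_density: "(\<integral>\<^sup>+x. ennreal (gauss_density n x) \<partial>vec_space n) = 1"
proof -
  have "(\<integral>\<^sup>+x. ennreal (gauss_density n x) \<partial>vec_space n) =
    (\<integral>\<^sup>+x. (\<Prod>i<n. ennreal (std_normal_density (x i))) \<partial>vec_space n)"
    by (simp add: gauss_density_def prod_ennreal)
  also have "\<dots> = (\<Prod>i<n. \<integral>\<^sup>+x. ennreal (std_normal_density x) \<partial>lborel)"
    unfolding vec_space_def by (intro vec.product_nn_integral_prod) auto
  also have "\<dots> = 1"
    by (simp add: nn_integral_eq_integral)
  finally show ?thesis .
qed

lemma sum_squares_vmul: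
  assumes "Q \<in> orth_group n"
  shows "(\<Sum>j<n. (vmul n x Q j)\<^sup>2) = (\<Sum>i<n. (x i)\<^sup>2)"
proof -
  have "(\<Sum>j<n. (vmul n x Q j)\<^sup>2) = (\<Sum>j<n. \<Sum>k<n. \<Sum>l<n. x k * x l * (Q k j * Q l j))"
    by (simp add: vmul_def power2_eq_square sum_product mult_ac)
  also have "\<dots> = (\<Sum>k<n. \<Sum>j<n. \<Sum>l<n. x k * x l * (Q k j * Q l j))"
    by (rule sum.swap)
  also have "\<dots> = (\<Sum>k<n. \<Sum>l<n. \<Sum>j<n. x k * x l * (Q k j * Q l j))"
    by (intro sum.cong refl sum.swap)
  also have "\<dots> = (\<Sum>k<n. \<Sum>l<n. x k * x l * of_bool (k = l))"
    using assms by (intro sum.cong refl) (simp add: orth_group_iff flip: sum_distrib_left)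
  also have "\<dots> = (\<Sum>i<n. (x i)\<^sup>2)"
    by (simp add: power2_eq_square)
  finally show ?thesis .
qed

lemma gauss_density_vmul: "Q \<in> orth_group n \<Longrightarrow> gauss_density n (vmul n x Q) = gauss_density n x"
  by (simp add: gauss_density_exp sum_squares_vmul)

lemma vmul_vadd: "vmul n (vadd n x y) Q = vadd n (vmul n x Q) (vmul n y Q)"
  by (rule vec_space_eqI[of _ n]) (auto simp: space_vec_space vmul_def vadd_def algebra_simps sum.distrib)

lemma vmul_mmul: "vmul n (vmul n x P) Q = vmul n x (mmul n P Q)"
proof (rule vec_space_eqI[of _ n])
  fix j assume j: "j < n"
  have "vmul n (vmul n x P) Q j = (\<Sum>k<n. \<Sum>l<n. x l * P l k * Q k j)"
    using j by (simp add: vmul_def sum_distrib_right)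
  also have "\<dots> = (\<Sum>l<n. \<Sum>k<n. x l * P l k * Q k j)"
    by (rule sum.swap)
  also have "\<dots> = vmul n x (mmul n P Q) j"
    using j by (simp add: vmul_def mmul_apply sum_distrib_left mult.assoc)
  finally show "vmul n (vmul n x P) Q j = vmul n x (mmul n P Q) j" .
qed auto

lemma vmul_mid: "x \<in> space (vec_space n) \<Longrightarrow> vmul n x (mid n) = x"
  by (rule vec_space_eqI[of _ n]) (auto simp: space_vec_space vmul_def mid_apply if_distrib cong: if_cong)

definition vneg :: "nat \<Rightarrow> (nat \<Rightarrow> real) \<Rightarrow> (nat \<Rightarrow> real)" where
  "vneg n x = (\<lambda>i\<in>{..<n}. - x i)"

lemma vneg_space [simp]: "vneg n x \<in> space (vec_space n)"
  by (auto simp: vneg_def space_vec_space)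

lemma measurable_vneg [measurable (raw)]:
  assumes "f \<in> measurable M (vec_space n)"
  shows "(\<lambda>x. vneg n (f x)) \<in> measurable M (vec_space n)"
  unfolding vneg_def
  by (intro measurable_vec_space_restrict borel_measurable_uminus measurable_vec_entry[OF assms(1)]) auto

text \<open>Uniqueness of translation invariant measures, in the Fubini form: both sides
  equal the double integral of \<open>f (x Q + y)\<close> against the Gaussian density in \<open>y\<close>.\<close>

lemma nn_integral_vec_orthogonal:
  assumes Q: "Q \<in> orth_group n" and f [measurable]: "f \<in> borel_measurable (vec_space n)"
  shows "(\<integral>\<^sup>+x. f (vmul n x Q) \<partial>vec_space n) = (\<integral>\<^sup>+x. f x \<partial>vec_space n)"
proof -
  let ?L = "vec_space n" and ?p = "\<lambda>x. ennreal (gauss_density n x)"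
  interpret L: sigma_finite_measure ?L by (rule sigma_finite_vec_space)
  interpret LL: pair_sigma_finite ?L ?L ..
  define Qt where "Qt = mtrans n Q"
  have QtQ: "vmul n (vmul n y Qt) Q = y" if "y \<in> space ?L" for y
    using that Q by (simp add: vmul_mmul Qt_def orth_group_mtrans_mult vmul_mid)
  have [measurable]: "(\<lambda>x. f (vmul n x Q)) \<in> borel_measurable ?L"
    by measurable
  \<comment> \<open>Translating \<open>x\<close> by \<open>y Qt\<close> before applying
    \<open>Q\<close> is the same as translating \<open>x Q\<close> by \<open>y\<close>.\<close>
  have 1: "(\<integral>\<^sup>+x. f (vadd n (vmul n x Q) y) \<partial>?L) = (\<integral>\<^sup>+x. f (vmul n x Q) \<partial>?L)"
    if "y \<in> space ?L" for y
  proof -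
    have "(\<integral>\<^sup>+x. f (vmul n x Q) \<partial>?L) = (\<integral>\<^sup>+x. f (vmul n (vadd n x (vmul n y Qt)) Q) \<partial>?L)"
      by (rule nn_integral_vec_translate[symmetric]) auto
    then show ?thesis using that by (simp add: vmul_vadd QtQ)
  qed
  have 2: "(\<integral>\<^sup>+y. ?p y * f (vadd n (vmul n x Q) y) \<partial>?L) = (\<integral>\<^sup>+y. ?p (vadd n y (vneg n (vmul n x Q))) * f y \<partial>?L)"
    if "x \<in> space ?L" for x
  proof -
    have "(\<integral>\<^sup>+y. ?p y * f (vadd n (vmul n x Q) y) \<partial>?L) =
       (\<integral>\<^sup>+y. ?p (vadd n y (vneg n (vmul n x Q))) * f (vadd n (vmul n x Q) (vadd n y (vneg n (vmul n x Q)))) \<partial>?L)"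
    proof (rule nn_integral_vec_translate[symmetric])
      have "(\<lambda>y. vadd n (vmul n x Q) y) \<in> measurable ?L ?L"
        by (intro measurable_vadd measurable_const measurable_ident_sets) auto
      from measurable_compose[OF this f]
      show "(\<lambda>y. ?p y * f (vadd n (vmul n x Q) y)) \<in> borel_measurable ?L"
        by (intro borel_measurable_times_ennreal) measurable
    qed simp
    also have "\<dots> = (\<integral>\<^sup>+y. ?p (vadd n y (vneg n (vmul n x Q))) * f y \<partial>?L)"
    proof (intro nn_integral_cong)
      fix y assume "y \<in> space ?L"
      then have "vadd n (vmul n x Q) (vadd n y (vneg n (vmul n x Q))) = y"
        by (intro vec_space_eqI[of _ n]) (auto simp: space_vec_space vadd_def vneg_def)
      then show "?p (vadd n y (vneg n (vmul n x Q))) * f (vadd n (vmul n x Q) (vadd n y (vneg n (vmul n x Q)))) = ?p (vadd n y (vneg n (vmul n x Q))) * f y"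
        by simp
    qed
    finally show ?thesis .
  qed
  \<comment> \<open>Invariance of the density under \<open>Q\<close> and under negation turns the
    argument \<open>y - x Q\<close> into \<open>x - y Qt\<close>, a plain translation of
    \<open>x\<close>.\<close>
  have 3: "(\<integral>\<^sup>+x. ?p (vadd n y (vneg n (vmul n x Q))) \<partial>?L) = 1" if y: "y \<in> space ?L" for y
  proof -
    have "?p (vadd n y (vneg n (vmul n x Q))) = ?p (vadd n x (vneg n (vmul n y Qt)))" for x
    proof -
      have "vmul n (vadd n x (vneg n (vmul n y Qt))) Q = vadd n (vmul n x Q) (vneg n (vmul n (vmul n y Qt) Q))"
        by (rule vec_space_eqI[of _ n])
           (auto simp: space_vec_space vmul_def vadd_def vneg_def algebra_simps sum.distrib sum_subtractf)
      also have "\<dots> = vadd n (vmul n x Q) (vneg n y)"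
        using y by (simp add: QtQ)
      finally have "gauss_density n (vadd n x (vneg n (vmul n y Qt))) = gauss_density n (vadd n (vmul n x Q) (vneg n y))"
        using gauss_density_vmul[OF Q, of "vadd n x (vneg n (vmul n y Qt))"] by simp
      also have "\<dots> = gauss_density n (vadd n y (vneg n (vmul n x Q)))"
        by (simp add: gauss_density_exp vadd_def vneg_def power2_commute)
      finally show ?thesis by simp
    qed
    then have "(\<integral>\<^sup>+x. ?p (vadd n y (vneg n (vmul n x Q))) \<partial>?L) = (\<integral>\<^sup>+x. ?p (vadd n x (vneg n (vmul n y Qt))) \<partial>?L)"
      by simp
    also have "\<dots> = (\<integral>\<^sup>+x. ?p x \<partial>?L)"
      by (rule nn_integral_vec_translate) auto
    finally show ?thesis by (simp add: nn_integral_gauss_density)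
  qed
  have pm1: "(\<lambda>(y, x). ?p y * f (vadd n (vmul n x Q) y)) \<in> borel_measurable (?L \<Otimes>\<^sub>M ?L)"
    by measurable
  have pm2: "(\<lambda>(y, x). ?p (vadd n y (vneg n (vmul n x Q))) * f y) \<in> borel_measurable (?L \<Otimes>\<^sub>M ?L)"
    by measurable
  have "(\<integral>\<^sup>+x. f (vmul n x Q) \<partial>?L) = (\<integral>\<^sup>+y. ?p y * (\<integral>\<^sup>+x. f (vmul n x Q) \<partial>?L) \<partial>?L)"
    by (simp add: nn_integral_multc nn_integral_gauss_density)
  also have "\<dots> = (\<integral>\<^sup>+y. ?p y * (\<integral>\<^sup>+x. f (vadd n (vmul n x Q) y) \<partial>?L) \<partial>?L)"
    by (intro nn_integral_cong) (simp add: 1)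
  also have "\<dots> = (\<integral>\<^sup>+y. (\<integral>\<^sup>+x. ?p y * f (vadd n (vmul n x Q) y) \<partial>?L) \<partial>?L)"
    by (intro nn_integral_cong nn_integral_cmult[symmetric]) measurable
  also have "\<dots> = (\<integral>\<^sup>+x. (\<integral>\<^sup>+y. ?p y * f (vadd n (vmul n x Q) y) \<partial>?L) \<partial>?L)"
    by (rule LL.Fubini'[symmetric, OF pm1])
  also have "\<dots> = (\<integral>\<^sup>+x. (\<integral>\<^sup>+y. ?p (vadd n y (vneg n (vmul n x Q))) * f y \<partial>?L) \<partial>?L)"
    by (rule nn_integral_cong) (rule 2)
  also have "\<dots> = (\<integral>\<^sup>+y. (\<integral>\<^sup>+x. ?p (vadd n y (vneg n (vmul n x Q))) * f y \<partial>?L) \<partial>?L)"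
    by (rule LL.Fubini'[OF pm2])
  also have "\<dots> = (\<integral>\<^sup>+y. (\<integral>\<^sup>+x. ?p (vadd n y (vneg n (vmul n x Q))) \<partial>?L) * f y \<partial>?L)"
    by (intro nn_integral_cong nn_integral_multc) measurable
  also have "\<dots> = (\<integral>\<^sup>+y. f y \<partial>?L)"
    by (intro nn_integral_cong) (simp add: 3)
  finally show ?thesis .
qed

section \<open>Gaussian laws and their invariance\<close>

definition gauss_vec :: "nat \<Rightarrow> (nat \<Rightarrow> real) measure" where
  "gauss_vec n = density (vec_space n) (\<lambda>x. ennreal (gauss_density n x))"

definition gauss_mat :: "nat \<Rightarrow> (nat \<Rightarrow> nat \<Rightarrow> real) measure" where
  "gauss_mat n = PiM {..<n} (\<lambda>_. gauss_vec n)"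

lemma sets_gauss_vec [measurable_cong]: "sets (gauss_vec n) = sets (vec_space n)"
  by (simp add: gauss_vec_def)

lemma space_gauss_vec: "space (gauss_vec n) = space (vec_space n)"
  by (simp add: gauss_vec_def)

lemma sets_gauss_mat [measurable_cong]: "sets (gauss_mat n) = sets (mat_space n)"
  unfolding gauss_mat_def mat_space_eq_vec by (intro sets_PiM_cong refl) (simp add: gauss_vec_def)

lemma space_gauss_mat: "space (gauss_mat n) = space (mat_space n)"
  using sets_gauss_mat by (rule sets_eq_imp_space_eq)

lemma prob_space_gauss_vec: "prob_space (gauss_vec n)"
proof
  have "emeasure (gauss_vec n) (space (gauss_vec n)) = (\<integral>\<^sup>+x. ennreal (gauss_density n x) * indicator (space (vec_space n)) x \<partial>vec_space n)"
    unfolding gauss_vec_def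
    by (subst emeasure_density) (auto intro!: measurable_compose[OF _ measurable_ennreal] measurable_gauss_density)
  also have "\<dots> = (\<integral>\<^sup>+x. ennreal (gauss_density n x) \<partial>vec_space n)"
    by (intro nn_integral_cong) auto
  finally show "emeasure (gauss_vec n) (space (gauss_vec n)) = 1"
    by (simp add: nn_integral_gauss_density)
qed

lemma product_prob_space_gauss_vec: "product_prob_space (\<lambda>_::nat. gauss_vec n)"
  by (intro product_prob_spaceI prob_space_gauss_vec)

lemma prob_space_gauss_mat: "prob_space (gauss_mat n)"
  unfolding gauss_mat_def by (intro prob_space_PiM prob_space_gauss_vec)

text \<open>The density is invariant because \<open>Q\<close> preserves sums of squares, the base
  measure by \<open>nn_integral_vec_orthogonal\<close>.\<close>

lemma distr_gauss_vec_vmul: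
  assumes Q: "Q \<in> orth_group n"
  shows "distr (gauss_vec n) (vec_space n) (\<lambda>x. vmul n x Q) = gauss_vec n"
proof (rule measure_eqI)
  fix A assume "A \<in> sets (distr (gauss_vec n) (vec_space n) (\<lambda>x. vmul n x Q))"
  then have A [measurable]: "A \<in> sets (vec_space n)" by simp
  have m: "(\<lambda>x. vmul n x Q) \<in> measurable (gauss_vec n) (vec_space n)"
    by measurable
  have "emeasure (distr (gauss_vec n) (vec_space n) (\<lambda>x. vmul n x Q)) A =
     emeasure (gauss_vec n) ((\<lambda>x. vmul n x Q) -` A \<inter> space (vec_space n))"
    using A by (subst emeasure_distr[OF m]) (auto simp: space_gauss_vec)
  also have "\<dots> = (\<integral>\<^sup>+x. ennreal (gauss_density n x) * indicator ((\<lambda>x. vmul n x Q) -` A \<inter> space (vec_space n)) x \<partial>vec_space n)"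
    unfolding gauss_vec_def
    by (rule emeasure_density)
       (auto intro!: measurable_compose[OF _ measurable_ennreal] measurable_gauss_density
         measurable_sets[OF measurable_vmul] A)
  also have "\<dots> = (\<integral>\<^sup>+x. (\<lambda>x. ennreal (gauss_density n x) * indicator A x) (vmul n x Q) \<partial>vec_space n)"
    by (intro nn_integral_cong) (auto simp: gauss_density_vmul[OF Q] split: split_indicator)
  also have "\<dots> = (\<integral>\<^sup>+x. ennreal (gauss_density n x) * indicator A x \<partial>vec_space n)"
    by (rule nn_integral_vec_orthogonal[OF Q]) measurable
  also have "\<dots> = emeasure (gauss_vec n) A"
    unfolding gauss_vec_def
    by (rule emeasure_density[symmetric])
       (auto intro!: measurable_compose[OF _ measurable_ennreal] measurable_gauss_density A)
  finally show "emeasure (distr (gauss_vec n) (vec_space n) (\<lambda>x. vmul n x Q)) A = emeasure (gauss_vec n) A" .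
qed (simp add: gauss_vec_def)

lemma mmul_row: "i < n \<Longrightarrow> mmul n M Q i = vmul n (M i) Q"
  by (simp add: mmul_def vmul_def)

text \<open>The rows are independent and \<open>Q\<close> acts on each of them, so the preimage of a
  box of row sets is again such a box.\<close>

lemma distr_gauss_mat_mmul:
  assumes Q: "Q \<in> orth_group n"
  shows "distr (gauss_mat n) (mat_space n) (\<lambda>M. mmul n M Q) = gauss_mat n"
proof -
  interpret G: product_prob_space "\<lambda>_::nat. gauss_vec n" by (rule product_prob_space_gauss_vec)
  have QS: "Q \<in> space (mat_space n)" using Q by (rule orth_group_space)
  have m: "(\<lambda>M. mmul n M Q) \<in> measurable (gauss_mat n) (mat_space n)"
    using QS by (intro measurable_mmul) (auto intro!: measurable_ident_sets sets_gauss_mat)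
  show ?thesis
    unfolding gauss_mat_def[of n]
  proof (rule G.PiM_eqI)
    show "finite {..<n}" by simp
    show "sets (distr (Pi\<^sub>M {..<n} (\<lambda>_. gauss_vec n)) (mat_space n) (\<lambda>M. mmul n M Q)) = sets (Pi\<^sub>M {..<n} (\<lambda>_. gauss_vec n))"
      using sets_gauss_mat[of n] by (simp add: gauss_mat_def)
    fix A assume A: "\<And>i. i \<in> {..<n} \<Longrightarrow> A i \<in> sets (gauss_vec n)"
    have A': "Pi\<^sub>E {..<n} A \<in> sets (mat_space n)"
      unfolding mat_space_eq_vec using A by (intro sets_PiM_I_finite) (auto simp: sets_gauss_vec)
    have s: "(\<lambda>x. vmul n x Q) -` A i \<inter> space (vec_space n) \<in> sets (gauss_vec n)" if "i < n" for i
      using that A[of i] by (intro measurable_sets[of _ "vec_space n" "vec_space n", folded sets_gauss_vec]) (auto simp: sets_gauss_vec)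
    have eq: "(\<lambda>M. mmul n M Q) -` Pi\<^sub>E {..<n} A \<inter> space (mat_space n) = (\<Pi>\<^sub>E i\<in>{..<n}. (\<lambda>x. vmul n x Q) -` A i \<inter> space (vec_space n))"
    proof -
      have "mmul n M Q \<in> Pi\<^sub>E {..<n} A \<longleftrightarrow> (\<forall>i<n. vmul n (M i) Q \<in> A i)" for M
        by (auto simp: PiE_iff mmul_row) (auto simp: mmul_def)
      then show ?thesis
        by (auto simp: space_mat_space space_vec_space PiE_iff)
    qed
    have "emeasure (distr (gauss_mat n) (mat_space n) (\<lambda>M. mmul n M Q)) (Pi\<^sub>E {..<n} A) =
      emeasure (gauss_mat n) (\<Pi>\<^sub>E i\<in>{..<n}. (\<lambda>x. vmul n x Q) -` A i \<inter> space (vec_space n))"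
      using A' by (subst emeasure_distr[OF m]) (auto simp: space_gauss_mat eq)
    also have "\<dots> = (\<Prod>i<n. emeasure (gauss_vec n) ((\<lambda>x. vmul n x Q) -` A i \<inter> space (vec_space n)))"
      unfolding gauss_mat_def using s by (subst G.emeasure_PiM) auto
    also have "\<dots> = (\<Prod>i<n. emeasure (gauss_vec n) (A i))"
    proof (intro prod.cong refl)
      fix i assume i: "i \<in> {..<n}"
      have "emeasure (gauss_vec n) (A i) = emeasure (distr (gauss_vec n) (vec_space n) (\<lambda>x. vmul n x Q)) (A i)"
        by (simp add: distr_gauss_vec_vmul[OF Q])
      also have "\<dots> = emeasure (gauss_vec n) ((\<lambda>x. vmul n x Q) -` A i \<inter> space (vec_space n))"
        using A[OF i] by (subst emeasure_distr) (auto simp: sets_gauss_vec space_gauss_vec intro!: measurable_vmul measurable_ident_sets)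
      finally show "emeasure (gauss_vec n) ((\<lambda>x. vmul n x Q) -` A i \<inter> space (vec_space n)) = emeasure (gauss_vec n) (A i)" ..
    qed
    finally show "emeasure (distr (Pi\<^sub>M {..<n} (\<lambda>_. gauss_vec n)) (mat_space n) (\<lambda>M. mmul n M Q)) (Pi\<^sub>E {..<n} A) = (\<Prod>i<n. emeasure (gauss_vec n) (A i))"
      by (simp add: gauss_mat_def)
  qed
qed

section \<open>Gram-Schmidt orthonormalisation\<close>

text \<open>For \<open>e\<close> orthonormal up to \<open>k\<close> this is \<open>x\<close> minus
  its projection onto the span of the first \<open>k\<close> vectors.\<close>

definition orth_residual :: "nat \<Rightarrow> (nat \<Rightarrow> nat \<Rightarrow> real) \<Rightarrow> nat \<Rightarrow> (nat \<Rightarrow> real) \<Rightarrow> nat \<Rightarrow> real" where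
  "orth_residual n e k x j = x j - (\<Sum>l<k. (\<Sum>m<n. x m * e l m) * e l j)"

text \<open>The residual is written out so that the recursive calls sit under a sum over
  \<open>l < k\<close>, which makes termination visible; \<open>gram_schmidt_residual\<close>
  restores the short form. A vanishing residual yields a row of zeros, as division by zero is
  zero.\<close>

function gram_schmidt :: "nat \<Rightarrow> (nat \<Rightarrow> nat \<Rightarrow> real) \<Rightarrow> nat \<Rightarrow> nat \<Rightarrow> real" where
  "gram_schmidt n M k j =
     (M k j - (\<Sum>l<k. (\<Sum>m<n. M k m * gram_schmidt n M l m) * gram_schmidt n M l j)) /
     sqrt (\<Sum>i<n. (M k i - (\<Sum>l<k. (\<Sum>m<n. M k m * gram_schmidt n M l m) * gram_schmidt n M l i))\<^sup>2)"
  by pat_completeness auto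
termination by (relation "Wellfounded.measure (\<lambda>(n, M, k, j). k)") auto

declare gram_schmidt.simps [simp del]

lemma gram_schmidt_residual:
  "gram_schmidt n M k j = orth_residual n (gram_schmidt n M) k (M k) j /
     sqrt (\<Sum>i<n. (orth_residual n (gram_schmidt n M) k (M k) i)\<^sup>2)"
  by (subst gram_schmidt.simps) (simp add: orth_residual_def)

lemma measurable_gram_schmidt:
  "k < n \<Longrightarrow> j < n \<Longrightarrow> (\<lambda>M. gram_schmidt n M k j) \<in> borel_measurable (mat_space n)"
proof (induction k arbitrary: j rule: less_induct)
  case (less k)
  have 1: "(\<lambda>M. M k j) \<in> borel_measurable (mat_space n)" if "j < n" for j
    using less.prems that by (intro measurable_entry measurable_ident_sets) auto
  have 2: "(\<lambda>M. orth_residual n (gram_schmidt n M) k (M k) j) \<in> borel_measurable (mat_space n)" if "j < n" for j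
    unfolding orth_residual_def using less that
    by (intro borel_measurable_diff borel_measurable_sum borel_measurable_times 1 less.IH) auto
  show ?case
    unfolding gram_schmidt_residual[of n _ k]
    using less.prems
    by (intro borel_measurable_divide measurable_compose[OF _ borel_measurable_sqrt] borel_measurable_sum borel_measurable_power 2) auto
qed

text \<open>Gram-Schmidt uses only inner products and linear combinations of rows. Right
  multiplication by \<open>Q\<close> preserves the former and commutes with the latter.\<close>

lemma gram_schmidt_mmul:
  assumes Q: "Q \<in> orth_group n"
  shows "k < n \<Longrightarrow> j < n \<Longrightarrow> gram_schmidt n (mmul n M Q) k j = vmul n (gram_schmidt n M k) Q j"
proof (induction k arbitrary: j rule: less_induct)
  case (less k)
  let ?e = "gram_schmidt n M" and ?e' = "gram_schmidt n (mmul n M Q)"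
  have ip: "(\<Sum>m<n. vmul n x Q m * vmul n y Q m) = (\<Sum>m<n. x m * y m)" for x y
  proof -
    have "(\<Sum>j<n. vmul n x Q j * vmul n y Q j) = (\<Sum>j<n. \<Sum>k<n. \<Sum>l<n. x k * y l * (Q k j * Q l j))"
      by (simp add: vmul_def sum_product mult_ac)
    also have "\<dots> = (\<Sum>k<n. \<Sum>j<n. \<Sum>l<n. x k * y l * (Q k j * Q l j))"
      by (rule sum.swap)
    also have "\<dots> = (\<Sum>k<n. \<Sum>l<n. \<Sum>j<n. x k * y l * (Q k j * Q l j))"
      by (intro sum.cong refl sum.swap)
    also have "\<dots> = (\<Sum>k<n. \<Sum>l<n. x k * y l * of_bool (k = l))"
      using Q by (intro sum.cong refl) (simp add: orth_group_iff flip: sum_distrib_left)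
    finally show ?thesis by simp
  qed
  have r: "orth_residual n ?e' k (mmul n M Q k) j = vmul n (orth_residual n ?e k (M k)) Q j" if j: "j < n" for j
  proof -
    have "orth_residual n ?e' k (mmul n M Q k) j =
      vmul n (M k) Q j - (\<Sum>l<k. (\<Sum>m<n. vmul n (M k) Q m * vmul n (?e l) Q m) * vmul n (?e l) Q j)"
      unfolding orth_residual_def using less j by (simp add: mmul_row)
    also have "\<dots> = vmul n (M k) Q j - (\<Sum>l<k. (\<Sum>m<n. M k m * ?e l m) * vmul n (?e l) Q j)"
      by (simp add: ip)
    also have "(\<Sum>l<k. (\<Sum>m<n. M k m * ?e l m) * vmul n (?e l) Q j) = (\<Sum>l<k. \<Sum>i<n. (\<Sum>m<n. M k m * ?e l m) * ?e l i * Q i j)"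
      using j by (simp add: vmul_def sum_distrib_left mult.assoc)
    also have "\<dots> = (\<Sum>i<n. \<Sum>l<k. (\<Sum>m<n. M k m * ?e l m) * ?e l i * Q i j)"
      by (rule sum.swap)
    also have "vmul n (M k) Q j - \<dots> = vmul n (orth_residual n ?e k (M k)) Q j"
      using j by (simp add: vmul_def orth_residual_def left_diff_distrib sum_subtractf sum_distrib_right)
    finally show ?thesis .
  qed
  have "(\<Sum>i<n. (orth_residual n ?e' k (mmul n M Q k) i)\<^sup>2) = (\<Sum>i<n. (orth_residual n ?e k (M k) i)\<^sup>2)"
    using sum_squares_vmul[OF Q, of "orth_residual n ?e k (M k)"] by (simp add: r)
  then show ?case
    using less.prems unfolding gram_schmidt_residual[of n _ k]
    by (simp add: r vmul_def sum_divide_distrib)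
qed

definition orthonormal_upto :: "nat \<Rightarrow> (nat \<Rightarrow> nat \<Rightarrow> real) \<Rightarrow> nat \<Rightarrow> bool" where
  "orthonormal_upto n e k \<longleftrightarrow> (\<forall>i<k. \<forall>j<k. (\<Sum>m<n. e i m * e j m) = of_bool (i = j))"

lemma orthonormal_residual:
  assumes e: "orthonormal_upto n e k" and l: "l < k"
  shows "(\<Sum>m<n. orth_residual n e k x m * e l m) = 0"
proof -
  have "(\<Sum>m<n. orth_residual n e k x m * e l m) =
     (\<Sum>m<n. x m * e l m) - (\<Sum>m<n. \<Sum>i<k. (\<Sum>j<n. x j * e i j) * (e i m * e l m))"
    by (simp add: orth_residual_def left_diff_distrib sum_subtractf sum_distrib_right mult.assoc)
  also have "(\<Sum>m<n. \<Sum>i<k. (\<Sum>j<n. x j * e i j) * (e i m * e l m)) = (\<Sum>i<k. \<Sum>m<n. (\<Sum>j<n. x j * e i j) * (e i m * e l m))"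
    by (rule sum.swap)
  also have "\<dots> = (\<Sum>i<k. (\<Sum>j<n. x j * e i j) * of_bool (i = l))"
    using e l by (intro sum.cong refl) (simp add: orthonormal_upto_def flip: sum_distrib_left)
  also have "\<dots> = (\<Sum>m<n. x m * e l m)"
    using l by simp
  finally show ?thesis by simp
qed

text \<open>The hypothesis at \<open>l\<close> may presuppose orthonormality of the earlier rows. In
  this conditional form it can be shown almost surely for each \<open>l\<close> separately, and the
  induction here puts the pieces together.\<close>

lemma gram_schmidt_orthonormal:
  assumes nz: "\<And>l. l < k \<Longrightarrow> orthonormal_upto n (gram_schmidt n M) l \<Longrightarrow>
     \<exists>j<n. orth_residual n (gram_schmidt n M) l (M l) j \<noteq> 0"
  shows "orthonormal_upto n (gram_schmidt n M) k"
  using nz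
proof (induction k)
  case 0
  then show ?case by (simp add: orthonormal_upto_def)
next
  case (Suc k)
  let ?e = "gram_schmidt n M" and ?r = "orth_residual n (gram_schmidt n M) k (M k)"
  have on: "orthonormal_upto n ?e k" using Suc by auto
  then obtain j where "j < n" "?r j \<noteq> 0" using Suc.prems[of k] by auto
  then have pos: "(\<Sum>i<n. (?r i)\<^sup>2) > 0"
    by (intro sum_pos2[of _ j]) auto
  have e: "?e k j = ?r j / sqrt (\<Sum>i<n. (?r i)\<^sup>2)" for j
    by (rule gram_schmidt_residual)
  have kk: "(\<Sum>m<n. ?e k m * ?e k m) = 1"
  proof -
    have "(\<Sum>m<n. ?e k m * ?e k m) = (\<Sum>m<n. (?r m)\<^sup>2 / (\<Sum>i<n. (?r i)\<^sup>2))"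
      using pos unfolding e by (intro sum.cong refl) (simp add: power2_eq_square flip: real_sqrt_mult)
    also have "\<dots> = 1"
      using pos by (simp flip: sum_divide_distrib)
    finally show ?thesis .
  qed
  have kl: "(\<Sum>m<n. ?e k m * ?e l m) = 0" if "l < k" for l
  proof -
    have "(\<Sum>m<n. ?e k m * ?e l m) = (\<Sum>m<n. ?r m * ?e l m) / sqrt (\<Sum>i<n. (?r i)\<^sup>2)"
      unfolding e by (simp add: sum_divide_distrib)
    then show ?thesis using orthonormal_residual[OF on that] by simp
  qed
  show ?case
    using on kk kl unfolding orthonormal_upto_def by (auto simp: less_Suc_eq mult.commute)
qed

text \<open>Row \<open>k\<close> of the result does not see the later rows of \<open>M\<close>;
  hence row \<open>k\<close> of a Gaussian matrix can be varied while the first \<open>k\<close>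
  orthonormal vectors stay fixed.\<close>

lemma gram_schmidt_cong:
  "(\<And>l. l \<le> k \<Longrightarrow> M l = M' l) \<Longrightarrow> gram_schmidt n M k j = gram_schmidt n M' k j"
proof (induction k arbitrary: j rule: less_induct)
  case (less k)
  have "gram_schmidt n M l j = gram_schmidt n M' l j" if "l < k" for l j
    using that less.prems by (intro less.IH) auto
  moreover have "M k = M' k" using less.prems by simp
  ultimately show ?case
    unfolding gram_schmidt_residual[of n _ k] by (simp add: orth_residual_def)
qed

text \<open>The squared distances of the unit vectors from the span of \<open>e\<close> add up to \<open>n - k > 0\<close>, so some
  unit vector \<open>i\<close> lies outside the span. On each line in direction \<open>i\<close> the residual vanishes at most once.\<close>

lemma AE_gauss_vec_residual:
  assumes e: "orthonormal_upto n e k" and k: "k < n"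
  shows "AE x in gauss_vec n. \<exists>j<n. orth_residual n e k x j \<noteq> 0"
proof -
  have "(\<Sum>i<n. 1 - (\<Sum>l<k. (e l i)\<^sup>2)) = real n - (\<Sum>l<k. \<Sum>i<n. (e l i)\<^sup>2)"
    by (simp add: sum_subtractf) (rule sum.swap)
  also have "\<dots> = real n - real k"
    using e by (simp add: orthonormal_upto_def power2_eq_square)
  finally have "(\<Sum>i<n. 1 - (\<Sum>l<k. (e l i)\<^sup>2)) > 0" using k by simp
  then obtain i where i: "i < n" and pos: "1 - (\<Sum>l<k. (e l i)\<^sup>2) > 0"
    by (metis (no_types, lifting) lessThan_iff not_le sum_nonpos)
  define \<alpha> where "\<alpha> = 1 - (\<Sum>l<k. (e l i)\<^sup>2)"
  define I where "I = {..<n} - {i}"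
  have ins: "insert i I = {..<n}" "i \<notin> I" "finite I" using i by (auto simp: I_def)
  define \<beta> where "\<beta> x = (\<Sum>l<k. (\<Sum>m\<in>I. x m * e l m) * e l i)" for x :: "nat \<Rightarrow> real"
  \<comment> \<open>Coordinate \<open>i\<close> of the residual is affine in entry \<open>i\<close>
    of the vector. Its slope \<open>\<alpha>\<close> is the squared distance of the unit vector from
    the span, so it has exactly one zero \<open>\<beta> x / \<alpha>\<close>.\<close>
  have res: "orth_residual n e k (x(i := s)) i = \<alpha> * s - \<beta> x" for x s
  proof -
    have "(\<Sum>m<n. (x(i := s)) m * e l m) = s * e l i + (\<Sum>m\<in>I. x m * e l m)" for l
    proof -
      have "(\<Sum>m<n. (x(i := s)) m * e l m) = (\<Sum>m\<in>insert i I. (x(i := s)) m * e l m)" by (simp add: ins)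
      also have "\<dots> = s * e l i + (\<Sum>m\<in>I. (x(i := s)) m * e l m)" unfolding sum.insert[OF ins(3,2)] by simp
      also have "(\<Sum>m\<in>I. (x(i := s)) m * e l m) = (\<Sum>m\<in>I. x m * e l m)"
        using ins by (intro sum.cong) auto
      finally show ?thesis .
    qed
    then show ?thesis
      by (simp add: orth_residual_def \<alpha>_def \<beta>_def algebra_simps sum.distrib power2_eq_square sum_distrib_left)
  qed
  let ?N = "{x \<in> space (vec_space n). orth_residual n e k x i = 0}"
  have Nm: "?N \<in> sets (vec_space n)"
    unfolding orth_residual_def using i
    by (intro borel_measurable_eq borel_measurable_diff borel_measurable_sum borel_measurable_times
        measurable_vec_entry[OF measurable_ident_sets[OF refl]] borel_measurable_const) auto
  have "emeasure (vec_space n) ?N = (\<integral>\<^sup>+x. indicator ?N x \<partial>PiM (insert i I) (\<lambda>_. lborel))"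
    using Nm by (simp add: ins flip: vec_space_def)
  also have "\<dots> = (\<integral>\<^sup>+x. \<integral>\<^sup>+s. indicator ?N (x(i := s)) \<partial>lborel \<partial>PiM I (\<lambda>_. lborel))"
    using Nm ins by (intro vec.product_nn_integral_insert) (auto simp: vec_space_def)
  also have "\<dots> = (\<integral>\<^sup>+x. 0 \<partial>PiM I (\<lambda>_. lborel :: real measure))"
  proof (rule nn_integral_cong)
    fix x :: "nat \<Rightarrow> real"
    have "AE s in lborel. (indicator ?N (x(i := s)) :: ennreal) = 0"
      using AE_lborel_singleton[of "\<beta> x / \<alpha>"]
    proof eventually_elim
      case (elim s)
      then have "\<alpha> * s - \<beta> x \<noteq> 0" using pos by (auto simp: \<alpha>_def field_simps)
      then show ?case by (simp add: res)
    qed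
    then have "(\<integral>\<^sup>+s. indicator ?N (x(i := s)) \<partial>lborel) = (\<integral>\<^sup>+s. 0 \<partial>(lborel :: real measure))"
      by (rule nn_integral_cong_AE)
    then show "(\<integral>\<^sup>+s. indicator ?N (x(i := s)) \<partial>lborel) = 0" by simp
  qed
  finally have "emeasure (vec_space n) ?N = 0" by simp
  then have "AE x in vec_space n. orth_residual n e k x i \<noteq> 0"
    using Nm by (intro AE_I[of _ _ ?N]) auto
  then have "AE x in gauss_vec n. orth_residual n e k x i \<noteq> 0"
    unfolding gauss_vec_def
    by (subst AE_density) (auto intro!: measurable_compose[OF _ measurable_ennreal] measurable_gauss_density)
  then show ?thesis using i by auto
qed

text \<open>Fubini with row \<open>k\<close> integrated first: the other rows are frozen, so the
  earlier orthonormal vectors are constants and \<open>AE_gauss_vec_residual\<close> applies. If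
  they are not orthonormal, the exceptional set is not met at all.\<close>

lemma AE_gauss_mat_residual:
  assumes k: "k < n"
  shows "AE M in gauss_mat n. orthonormal_upto n (gram_schmidt n M) k \<longrightarrow>
     (\<exists>j<n. orth_residual n (gram_schmidt n M) k (M k) j \<noteq> 0)"
proof -
  interpret G: product_prob_space "\<lambda>_::nat. gauss_vec n" by (rule product_prob_space_gauss_vec)
  define I where "I = {..<n} - {k}"
  have ins: "insert k I = {..<n}" "k \<notin> I" "finite I" using k by (auto simp: I_def)
  define N where "N = {M \<in> space (mat_space n). (\<forall>i\<in>{..<k}. \<forall>j\<in>{..<k}. (\<Sum>m<n. gram_schmidt n M i m * gram_schmidt n M j m) = of_bool (i = j)) \<and>
     (\<forall>j\<in>{..<n}. orth_residual n (gram_schmidt n M) k (M k) j = 0)}"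
  have Nm: "N \<in> sets (mat_space n)"
  proof -
    have g: "(\<lambda>M. gram_schmidt n M l m) \<in> borel_measurable (mat_space n)" if "l < k" "m < n" for l m
      using that k by (intro measurable_gram_schmidt) auto
    have e: "(\<lambda>M. M k m) \<in> borel_measurable (mat_space n)" if "m < n" for m
      using that k by (intro measurable_entry measurable_ident_sets) auto
    have 1: "{M \<in> space (mat_space n). \<forall>i\<in>{..<k}. \<forall>j\<in>{..<k}. (\<Sum>m<n. gram_schmidt n M i m * gram_schmidt n M j m) = of_bool (i = j)} \<in> sets (mat_space n)"
      by (intro sets.sets_Collect_finite_All borel_measurable_eq borel_measurable_sum borel_measurable_times
          borel_measurable_const g) auto
    have 2: "{M \<in> space (mat_space n). \<forall>j\<in>{..<n}. orth_residual n (gram_schmidt n M) k (M k) j = 0} \<in> sets (mat_space n)"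
      unfolding orth_residual_def
      by (intro sets.sets_Collect_finite_All borel_measurable_eq borel_measurable_diff borel_measurable_sum borel_measurable_times
          borel_measurable_const g e) auto
    show ?thesis unfolding N_def using sets.Int[OF 1 2] by (rule back_subst[of "\<lambda>A. A \<in> sets (mat_space n)"]) auto
  qed
  have Nm': "N \<in> sets (gauss_mat n)" using Nm unfolding sets_gauss_mat .
  have "emeasure (gauss_mat n) N = (\<integral>\<^sup>+M. indicator N M \<partial>PiM (insert k I) (\<lambda>_. gauss_vec n))"
    using Nm' by (simp add: ins flip: gauss_mat_def)
  also have "\<dots> = (\<integral>\<^sup>+M. \<integral>\<^sup>+x. indicator N (M(k := x)) \<partial>gauss_vec n \<partial>PiM I (\<lambda>_. gauss_vec n))"
    using Nm' ins by (intro G.product_nn_integral_insert) (auto simp: gauss_mat_def)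
  also have "\<dots> = (\<integral>\<^sup>+M. 0 \<partial>PiM I (\<lambda>_. gauss_vec n))"
  proof (rule nn_integral_cong)
    fix M :: "nat \<Rightarrow> nat \<Rightarrow> real"
    have gs: "gram_schmidt n (M(k := x)) l m = gram_schmidt n M l m" if "l < k" for l m x
      using that by (intro gram_schmidt_cong) auto
    have "AE x in gauss_vec n. (indicator N (M(k := x)) :: ennreal) = 0"
    proof (cases "orthonormal_upto n (gram_schmidt n M) k")
      case True
      from AE_gauss_vec_residual[OF this k] show ?thesis
      proof eventually_elim
        case (elim x)
        then obtain j where "j < n" "orth_residual n (gram_schmidt n M) k x j \<noteq> 0" by auto
        moreover have "orth_residual n (gram_schmidt n (M(k := x))) k ((M(k := x)) k) j = orth_residual n (gram_schmidt n M) k x j"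
          by (simp add: orth_residual_def gs)
        ultimately have "M(k := x) \<notin> N" unfolding N_def by auto
        then show ?case by simp
      qed
    next
      case False
      then obtain i j where ij: "i < k" "j < k"
        and ne: "(\<Sum>m<n. gram_schmidt n M i m * gram_schmidt n M j m) \<noteq> of_bool (i = j)"
        by (auto simp: orthonormal_upto_def)
      have "M(k := x) \<notin> N" for x
      proof
        assume "M(k := x) \<in> N"
        then have "(\<Sum>m<n. gram_schmidt n (M(k := x)) i m * gram_schmidt n (M(k := x)) j m) = of_bool (i = j)"
          unfolding N_def using ij by blast
        then show False using ne ij by (simp add: gs)
      qed
      then show ?thesis by simp
    qed
    then have "(\<integral>\<^sup>+x. indicator N (M(k := x)) \<partial>gauss_vec n) = (\<integral>\<^sup>+x. 0 \<partial>gauss_vec n)"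
      by (rule nn_integral_cong_AE)
    then show "(\<integral>\<^sup>+x. indicator N (M(k := x)) \<partial>gauss_vec n) = 0" by simp
  qed
  finally have "N \<in> null_sets (gauss_mat n)" using Nm' by (intro null_setsI) simp_all
  then have "AE M in gauss_mat n. M \<notin> N" by (rule AE_not_in)
  moreover have "AE M in gauss_mat n. M \<in> space (mat_space n)"
    using AE_space[of "gauss_mat n"] by (simp add: space_gauss_mat)
  ultimately show ?thesis
  proof eventually_elim
    case (elim M)
    then show ?case unfolding N_def orthonormal_upto_def by blast
  qed
qed

definition gram_schmidt_mat :: "nat \<Rightarrow> (nat \<Rightarrow> nat \<Rightarrow> real) \<Rightarrow> (nat \<Rightarrow> nat \<Rightarrow> real)" where
  "gram_schmidt_mat n M = (\<lambda>i\<in>{..<n}. \<lambda>j\<in>{..<n}. gram_schmidt n M i j)"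

lemma measurable_gram_schmidt_mat: "gram_schmidt_mat n \<in> measurable (mat_space n) (mat_space n)"
  unfolding gram_schmidt_mat_def
  by (intro measurable_mat_space_restrict measurable_gram_schmidt)

lemma AE_gram_schmidt_mat: "AE M in gauss_mat n. gram_schmidt_mat n M \<in> orth_group n"
proof -
  have "AE M in gauss_mat n. \<forall>k\<in>{..<n}. orthonormal_upto n (gram_schmidt n M) k \<longrightarrow>
     (\<exists>j<n. orth_residual n (gram_schmidt n M) k (M k) j \<noteq> 0)"
    by (intro AE_finite_allI AE_gauss_mat_residual) auto
  then show ?thesis
  proof eventually_elim
    case (elim M)
    then have "orthonormal_upto n (gram_schmidt n M) n"
      by (intro gram_schmidt_orthonormal) auto
    then show ?case
      by (auto simp: orthonormal_upto_def orth_group_iff gram_schmidt_mat_def space_mat_space)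
  qed
qed

lemma gram_schmidt_mat_mmul:
  "Q \<in> orth_group n \<Longrightarrow> gram_schmidt_mat n (mmul n M Q) = mmul n (gram_schmidt_mat n M) Q"
  by (rule mat_space_eqI[of _ n])
     (auto simp: gram_schmidt_mat_def gram_schmidt_mmul mmul_apply vmul_def, auto simp: space_mat_space)

section \<open>Existence and uniqueness of Haar measure\<close>

definition is_haar :: "nat \<Rightarrow> (nat \<Rightarrow> nat \<Rightarrow> real) measure \<Rightarrow> bool" where
  "is_haar n \<mu> \<longleftrightarrow> prob_space \<mu> \<and> sets \<mu> = sets (mat_space n) \<and>
      emeasure \<mu> (orth_group n) = 1 \<and>
      (\<forall>Q\<in>orth_group n. distr \<mu> (mat_space n) (\<lambda>M. mmul n Q M) = \<mu> \<and>
                         distr \<mu> (mat_space n) (\<lambda>M. mmul n M Q) = \<mu>)"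

lemma AE_orth_iff:
  assumes "prob_space \<mu>" "sets \<mu> = sets (mat_space n)"
  shows "emeasure \<mu> (orth_group n) = 1 \<longleftrightarrow> (AE M in \<mu>. M \<in> orth_group n)"
proof -
  interpret prob_space \<mu> by fact
  show ?thesis
    using assms(2) sets_orth_group[of n] by (subst AE_in_set_eq_1) (auto simp: emeasure_eq_measure)
qed

lemma nn_integral_mmul_right:
  assumes "distr \<mu> (mat_space n) (\<lambda>M. mmul n M Q) = \<mu>" "sets \<mu> = sets (mat_space n)"
    "f \<in> borel_measurable (mat_space n)" "Q \<in> space (mat_space n)"
  shows "(\<integral>\<^sup>+M. f (mmul n M Q) \<partial>\<mu>) = (\<integral>\<^sup>+M. f M \<partial>\<mu>)"
proof -
  have "(\<integral>\<^sup>+M. f (mmul n M Q) \<partial>\<mu>) = (\<integral>\<^sup>+M. f M \<partial>distr \<mu> (mat_space n) (\<lambda>M. mmul n M Q))"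
    using assms by (intro nn_integral_distr[symmetric] measurable_mmul) (auto intro: measurable_ident_sets)
  then show ?thesis using assms(1) by simp
qed

lemma nn_integral_mmul_left:
  assumes "distr \<mu> (mat_space n) (\<lambda>M. mmul n Q M) = \<mu>" "sets \<mu> = sets (mat_space n)"
    "f \<in> borel_measurable (mat_space n)" "Q \<in> space (mat_space n)"
  shows "(\<integral>\<^sup>+M. f (mmul n Q M) \<partial>\<mu>) = (\<integral>\<^sup>+M. f M \<partial>\<mu>)"
proof -
  have "(\<integral>\<^sup>+M. f (mmul n Q M) \<partial>\<mu>) = (\<integral>\<^sup>+M. f M \<partial>distr \<mu> (mat_space n) (\<lambda>M. mmul n Q M))"
    using assms by (intro nn_integral_distr[symmetric] measurable_mmul) (auto intro: measurable_ident_sets)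
  then show ?thesis using assms(1) by simp
qed

text \<open>The double integral of \<open>f (M N)\<close> over \<open>\<mu>\<close> and
  \<open>\<nu>\<close> equals the \<open>\<mu>\<close>-integral of \<open>f\<close> by right
  invariance of \<open>\<mu>\<close>, and the \<open>\<nu>\<close>-integral of \<open>f\<close> by
  left invariance of \<open>\<nu>\<close>.\<close>

lemma is_haar_unique:
  assumes \<mu>: "is_haar n \<mu>" and \<nu>: "is_haar n \<nu>"
  shows "\<mu> = \<nu>"
proof (rule measure_eqI)
  have s: "sets \<mu> = sets (mat_space n)" "sets \<nu> = sets (mat_space n)"
    using assms by (auto simp: is_haar_def)
  note [measurable_cong] = s
  interpret \<mu>: prob_space \<mu> using \<mu> by (simp add: is_haar_def)
  interpret \<nu>: prob_space \<nu> using \<nu> by (simp add: is_haar_def)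
  interpret P: pair_sigma_finite \<mu> \<nu> ..
  show "sets \<mu> = sets \<nu>" using s by simp
  fix A assume A: "A \<in> sets \<mu>"
  define f :: "_ \<Rightarrow> ennreal" where "f = indicator A"
  have f: "f \<in> borel_measurable (mat_space n)" using A s by (simp add: f_def)
  have pm: "(\<lambda>(M, N). f (mmul n M N)) \<in> borel_measurable (\<mu> \<Otimes>\<^sub>M \<nu>)"
    unfolding case_prod_beta
    by (intro measurable_compose[OF _ f] measurable_mmul) (auto intro: measurable_ident_sets)
  have AE: "AE M in \<mu>. M \<in> orth_group n" "AE M in \<nu>. M \<in> orth_group n"
    using assms AE_orth_iff[of \<mu> n] AE_orth_iff[of \<nu> n] by (auto simp: is_haar_def)
  have "(\<integral>\<^sup>+M. f M \<partial>\<mu>) = (\<integral>\<^sup>+N. (\<integral>\<^sup>+M. f M \<partial>\<mu>) \<partial>\<nu>)"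
    by (simp add: \<nu>.emeasure_space_1)
  also have "\<dots> = (\<integral>\<^sup>+N. (\<integral>\<^sup>+M. f (mmul n M N) \<partial>\<mu>) \<partial>\<nu>)"
  proof (rule nn_integral_cong_AE, rule eventually_mono[OF AE(2)])
    fix N assume N: "N \<in> orth_group n"
    then have "distr \<mu> (mat_space n) (\<lambda>M. mmul n M N) = \<mu>" using \<mu> by (simp add: is_haar_def)
    from nn_integral_mmul_right[OF this s(1) f orth_group_space[OF N]]
    show "(\<integral>\<^sup>+M. f M \<partial>\<mu>) = (\<integral>\<^sup>+M. f (mmul n M N) \<partial>\<mu>)" by simp
  qed
  also have "\<dots> = (\<integral>\<^sup>+M. (\<integral>\<^sup>+N. f (mmul n M N) \<partial>\<nu>) \<partial>\<mu>)"
    by (rule P.Fubini'[OF pm])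
  also have "\<dots> = (\<integral>\<^sup>+M. (\<integral>\<^sup>+N. f N \<partial>\<nu>) \<partial>\<mu>)"
  proof (rule nn_integral_cong_AE, rule eventually_mono[OF AE(1)])
    fix M assume M: "M \<in> orth_group n"
    then have "distr \<nu> (mat_space n) (\<lambda>N. mmul n M N) = \<nu>" using \<nu> by (simp add: is_haar_def)
    from nn_integral_mmul_left[OF this s(2) f orth_group_space[OF M]]
    show "(\<integral>\<^sup>+N. f (mmul n M N) \<partial>\<nu>) = (\<integral>\<^sup>+N. f N \<partial>\<nu>)" .
  qed
  also have "\<dots> = (\<integral>\<^sup>+N. f N \<partial>\<nu>)"
    by (simp add: \<mu>.emeasure_space_1)
  finally show "emeasure \<mu> A = emeasure \<nu> A"
    using A s by (simp add: f_def)
qed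

text \<open>For the law of \<open>M^T N\<close>, right multiplication by \<open>Q\<close> replaces
  \<open>N\<close> by \<open>N Q\<close>, while left multiplication replaces \<open>M\<close> by
  \<open>M Q^T\<close>, because \<open>Q M^T = (M Q^T)^T\<close>. Right invariance of the one-sided
  law \<open>\<mu>1\<close> thus serves both sides.\<close>

lemma is_haar_exists: "\<exists>\<mu>. is_haar n \<mu>"
proof -
  interpret G: prob_space "gauss_mat n" by (rule prob_space_gauss_mat)
  have gm: "gram_schmidt_mat n \<in> measurable (gauss_mat n) (mat_space n)"
    using measurable_gram_schmidt_mat by (simp add: measurable_cong_sets[OF sets_gauss_mat refl])
  define \<mu>1 where "\<mu>1 = distr (gauss_mat n) (mat_space n) (gram_schmidt_mat n)"
  have s1: "sets \<mu>1 = sets (mat_space n)" by (simp add: \<mu>1_def)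
  note [measurable_cong] = s1
  interpret M1: prob_space \<mu>1 unfolding \<mu>1_def by (rule G.prob_space_distr[OF gm])
  interpret P: pair_prob_space \<mu>1 \<mu>1 ..
  have AE1: "AE M in \<mu>1. M \<in> orth_group n"
    unfolding \<mu>1_def using AE_gram_schmidt_mat[of n] sets_orth_group[of n]
    by (subst AE_distr_iff[OF gm]) (auto simp: orth_group_def)
  have inv1: "distr \<mu>1 (mat_space n) (\<lambda>M. mmul n M Q) = \<mu>1" if Q: "Q \<in> orth_group n" for Q
  proof -
    have mQ: "(\<lambda>M. mmul n M Q) \<in> measurable (mat_space n) (mat_space n)"
      using Q by (intro measurable_mmul) (auto simp: orth_group_space)
    have mQ': "(\<lambda>M. mmul n M Q) \<in> measurable (gauss_mat n) (mat_space n)"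
      using mQ by (simp add: measurable_cong_sets[OF sets_gauss_mat refl])
    have "distr \<mu>1 (mat_space n) (\<lambda>M. mmul n M Q) = distr (gauss_mat n) (mat_space n) (\<lambda>M. gram_schmidt_mat n (mmul n M Q))"
      unfolding \<mu>1_def by (subst distr_distr[OF mQ gm]) (simp add: comp_def gram_schmidt_mat_mmul[OF Q])
    also have "\<dots> = distr (distr (gauss_mat n) (mat_space n) (\<lambda>M. mmul n M Q)) (mat_space n) (gram_schmidt_mat n)"
      by (subst distr_distr[OF measurable_gram_schmidt_mat mQ']) (simp add: comp_def)
    also have "\<dots> = \<mu>1"
      by (simp add: distr_gauss_mat_mmul[OF Q] \<mu>1_def)
    finally show ?thesis .
  qed
  define h where "h = (\<lambda>(M, N). mmul n (mtrans n M) N)"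
  have hm: "h \<in> measurable (\<mu>1 \<Otimes>\<^sub>M \<mu>1) (mat_space n)"
    unfolding h_def case_prod_beta by (intro measurable_mmul measurable_mtrans) measurable
  define \<mu> where "\<mu> = distr (\<mu>1 \<Otimes>\<^sub>M \<mu>1) (mat_space n) h"
  have s: "sets \<mu> = sets (mat_space n)" by (simp add: \<mu>_def)
  have pr: "prob_space \<mu>" unfolding \<mu>_def by (rule P.prob_space_distr[OF hm])
  have int: "(\<integral>\<^sup>+M. f M \<partial>\<mu>) = (\<integral>\<^sup>+M. (\<integral>\<^sup>+N. f (mmul n (mtrans n M) N) \<partial>\<mu>1) \<partial>\<mu>1)"
    if f: "f \<in> borel_measurable (mat_space n)" for f
  proof -
    have "(\<lambda>x. f (h x)) \<in> borel_measurable (\<mu>1 \<Otimes>\<^sub>M \<mu>1)" by (rule measurable_compose[OF hm f])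
    from M1.nn_integral_fst[OF this]
    have "(\<integral>\<^sup>+M. (\<integral>\<^sup>+N. f (mmul n (mtrans n M) N) \<partial>\<mu>1) \<partial>\<mu>1) = (\<integral>\<^sup>+x. f (h x) \<partial>(\<mu>1 \<Otimes>\<^sub>M \<mu>1))"
      by (simp add: h_def)
    also have "\<dots> = (\<integral>\<^sup>+M. f M \<partial>\<mu>)"
      unfolding \<mu>_def using f by (intro nn_integral_distr[symmetric, OF hm]) simp
    finally show ?thesis ..
  qed
  \<comment> \<open>The opposite order of integration: left invariance concerns the variable
    \<open>M\<close> with \<open>N\<close> held fixed.\<close>
  have int': "(\<integral>\<^sup>+M. f M \<partial>\<mu>) = (\<integral>\<^sup>+N. (\<integral>\<^sup>+M. f (mmul n (mtrans n M) N) \<partial>\<mu>1) \<partial>\<mu>1)"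
    if f: "f \<in> borel_measurable (mat_space n)" for f
  proof -
    have "(\<lambda>(M, N). f (mmul n (mtrans n M) N)) \<in> borel_measurable (\<mu>1 \<Otimes>\<^sub>M \<mu>1)"
      using measurable_compose[OF hm f] by (simp add: h_def case_prod_beta)
    from P.Fubini'[OF this] show ?thesis unfolding int[OF f] ..
  qed
  have AE: "AE M in \<mu>. M \<in> orth_group n"
  proof -
    have "AE M in \<mu>1. AE N in \<mu>1. h (M, N) \<in> orth_group n"
      using AE1
    proof eventually_elim
      case (elim M)
      from AE1 show ?case
        by eventually_elim (use elim in \<open>auto simp: h_def intro: orth_group_mmul orth_group_mtrans\<close>)
    qed
    moreover have "Measurable.pred (\<mu>1 \<Otimes>\<^sub>M \<mu>1) (\<lambda>x. h x \<in> orth_group n)"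
      using measurable_sets[OF hm sets_orth_group] by (simp add: pred_def vimage_def Int_def conj_commute)
    ultimately have "AE x in \<mu>1 \<Otimes>\<^sub>M \<mu>1. h x \<in> orth_group n"
      by (intro P.AE_pair_measure) (auto simp: pred_def)
    then show ?thesis
      unfolding \<mu>_def using sets_orth_group[of n] by (subst AE_distr_iff[OF hm]) (auto simp: orth_group_def)
  qed
  have inv: "distr \<mu> (mat_space n) (\<lambda>M. mmul n Q M) = \<mu> \<and> distr \<mu> (mat_space n) (\<lambda>M. mmul n M Q) = \<mu>"
    if Q: "Q \<in> orth_group n" for Q
  proof -
    have QS: "Q \<in> space (mat_space n)" using Q by (rule orth_group_space)
    have mQ: "(\<lambda>M. mmul n M Q) \<in> measurable (mat_space n) (mat_space n)" "(\<lambda>M. mmul n Q M) \<in> measurable (mat_space n) (mat_space n)"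
      using QS by (auto intro!: measurable_mmul)
    have mQ': "(\<lambda>M. mmul n M Q) \<in> measurable \<mu> (mat_space n)" "(\<lambda>M. mmul n Q M) \<in> measurable \<mu> (mat_space n)"
      using mQ by (auto simp: measurable_cong_sets[OF s refl])
    have left: "(\<integral>\<^sup>+M. f (mmul n Q M) \<partial>\<mu>) = (\<integral>\<^sup>+M. f M \<partial>\<mu>)" if f: "f \<in> borel_measurable (mat_space n)" for f :: "_ \<Rightarrow> ennreal"
    proof -
      have "(\<integral>\<^sup>+M. f (mmul n Q M) \<partial>\<mu>) = (\<integral>\<^sup>+N. (\<integral>\<^sup>+M. f (mmul n Q (mmul n (mtrans n M) N)) \<partial>\<mu>1) \<partial>\<mu>1)"
        by (rule int'[OF measurable_compose[OF mQ(2) f]])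
      also have "\<dots> = (\<integral>\<^sup>+N. (\<integral>\<^sup>+M. f (mmul n (mtrans n (mmul n M (mtrans n Q))) N) \<partial>\<mu>1) \<partial>\<mu>1)"
        by (simp add: mtrans_mmul mtrans_mtrans[OF QS] mmul_assoc)
      also have "\<dots> = (\<integral>\<^sup>+N. (\<integral>\<^sup>+M. f (mmul n (mtrans n M) N) \<partial>\<mu>1) \<partial>\<mu>1)"
      proof (rule nn_integral_cong)
        fix N assume "N \<in> space \<mu>1"
        then have "N \<in> space (mat_space n)" by (simp add: \<mu>1_def)
        then show "(\<integral>\<^sup>+M. f (mmul n (mtrans n (mmul n M (mtrans n Q))) N) \<partial>\<mu>1) = (\<integral>\<^sup>+M. f (mmul n (mtrans n M) N) \<partial>\<mu>1)"
          by (intro nn_integral_mmul_right[where f = "\<lambda>M. f (mmul n (mtrans n M) N)"])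
             (intro inv1 orth_group_mtrans mtrans_space Q s1 measurable_compose[OF _ f] measurable_mmul measurable_mtrans; auto)+
      qed
      also have "\<dots> = (\<integral>\<^sup>+M. f M \<partial>\<mu>)" by (rule int'[OF f, symmetric])
      finally show ?thesis .
    qed
    have right: "(\<integral>\<^sup>+M. f (mmul n M Q) \<partial>\<mu>) = (\<integral>\<^sup>+M. f M \<partial>\<mu>)" if f: "f \<in> borel_measurable (mat_space n)" for f :: "_ \<Rightarrow> ennreal"
    proof -
      have "(\<integral>\<^sup>+M. f (mmul n M Q) \<partial>\<mu>) = (\<integral>\<^sup>+M. (\<integral>\<^sup>+N. f (mmul n (mtrans n M) (mmul n N Q)) \<partial>\<mu>1) \<partial>\<mu>1)"
        using int[OF measurable_compose[OF mQ(1) f]] by (simp add: mmul_assoc)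
      also have "\<dots> = (\<integral>\<^sup>+M. (\<integral>\<^sup>+N. f (mmul n (mtrans n M) N) \<partial>\<mu>1) \<partial>\<mu>1)"
        by (rule nn_integral_cong, rule nn_integral_mmul_right[where f = "\<lambda>N. f (mmul n (mtrans n M) N)" for M])
           (intro inv1 Q s1 QS measurable_compose[OF _ f] measurable_mmul; auto)+
      also have "\<dots> = (\<integral>\<^sup>+M. f M \<partial>\<mu>)" by (rule int[OF f, symmetric])
      finally show ?thesis .
    qed
    show ?thesis
    proof (intro conjI measure_eqI)
      fix A assume "A \<in> sets (distr \<mu> (mat_space n) (\<lambda>M. mmul n Q M))"
      then have A: "A \<in> sets (mat_space n)" by simp
      have "emeasure (distr \<mu> (mat_space n) (\<lambda>M. mmul n Q M)) A =
        (\<integral>\<^sup>+M. indicator A M \<partial>distr \<mu> (mat_space n) (\<lambda>M. mmul n Q M))"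
        using A by simp
      also have "\<dots> = (\<integral>\<^sup>+M. indicator A (mmul n Q M) \<partial>\<mu>)"
        using A by (intro nn_integral_distr[OF mQ'(2)]) simp
      also have "\<dots> = (\<integral>\<^sup>+M. indicator A M \<partial>\<mu>)"
        using A by (intro left) simp
      finally show "emeasure (distr \<mu> (mat_space n) (\<lambda>M. mmul n Q M)) A = emeasure \<mu> A"
        using A s by simp
    next
      fix A assume "A \<in> sets (distr \<mu> (mat_space n) (\<lambda>M. mmul n M Q))"
      then have A: "A \<in> sets (mat_space n)" by simp
      have "emeasure (distr \<mu> (mat_space n) (\<lambda>M. mmul n M Q)) A =
        (\<integral>\<^sup>+M. indicator A M \<partial>distr \<mu> (mat_space n) (\<lambda>M. mmul n M Q))"
        using A by simp
      also have "\<dots> = (\<integral>\<^sup>+M. indicator A (mmul n M Q) \<partial>\<mu>)"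
        using A by (intro nn_integral_distr[OF mQ'(1)]) simp
      also have "\<dots> = (\<integral>\<^sup>+M. indicator A M \<partial>\<mu>)"
        using A by (intro right) simp
      finally show "emeasure (distr \<mu> (mat_space n) (\<lambda>M. mmul n M Q)) A = emeasure \<mu> A"
        using A s by simp
    qed (simp_all add: s)
  qed
  show ?thesis
    using pr s AE inv AE_orth_iff[OF pr s] unfolding is_haar_def by blast
qed

lemma is_haar_haar_O: "is_haar n (haar_O n)"
proof -
  have "\<exists>!\<mu>. is_haar n \<mu>" using is_haar_exists is_haar_unique by blast
  from theI'[OF this] show ?thesis
    unfolding haar_O_def is_haar_def .
qed

section \<open>Matrix algebra and the Frobenius norm\<close>

type_synonym rmat = "nat \<Rightarrow> nat \<Rightarrow> real"

definition tp :: "rmat \<Rightarrow> rmat" where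
  "tp A = (\<lambda>i j. A j i)"

text \<open>The generator of the rotations in the \<open>(a,b)\<close>-plane. It vanishes for
  \<open>a = b\<close>, so sums over all pairs need no exception.\<close>

definition rot_gen :: "nat \<Rightarrow> nat \<Rightarrow> rmat" where
  "rot_gen a b = (\<lambda>i j. of_bool (i = a \<and> j = b) - of_bool (i = b \<and> j = a))"

text \<open>In contrast to \<^const>\<open>mmul\<close>, the product below is not restricted to indices below \<open>n\<close>; it is
  therefore associative and bilinear on all functions, and only the unit laws need care.\<close>

locale mat_dim =
  fixes n :: nat
begin

definition mm :: "rmat \<Rightarrow> rmat \<Rightarrow> rmat" (infixl "\<odot>" 70) where
  "A \<odot> B = (\<lambda>i j. \<Sum>k<n. A i k * B k j)"

abbreviation tr :: "rmat \<Rightarrow> real" where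
  "tr \<equiv> mtrace n"

text \<open>The Frobenius norm, phrased as an \<open>L2_set\<close> over index pairs to inherit the
  triangle and Cauchy-Schwarz inequalities.\<close>

definition fro :: "rmat \<Rightarrow> real" where
  "fro A = L2_set (\<lambda>(i, j). A i j) ({..<n} \<times> {..<n})"

text \<open>Rows and columns are both required to be orthonormal and nothing is said outside the
  index range; the notion is therefore stable under \<open>tp\<close>, which does not preserve
  membership in \<open>mat_space\<close>.\<close>

definition orthm :: "rmat \<Rightarrow> bool" where
  "orthm D \<longleftrightarrow> (\<forall>i<n. \<forall>j<n. (\<Sum>k<n. D i k * D j k) = of_bool (i = j) \<and> (\<Sum>k<n. D k i * D k j) = of_bool (i = j))"

lemma mm_assoc: "A \<odot> B \<odot> C = A \<odot> (B \<odot> C)"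
proof (intro ext)
  fix i j
  have "(A \<odot> B \<odot> C) i j = (\<Sum>k<n. \<Sum>l<n. A i l * B l k * C k j)"
    by (simp add: mm_def sum_distrib_right)
  also have "\<dots> = (\<Sum>l<n. \<Sum>k<n. A i l * B l k * C k j)"
    by (rule sum.swap)
  also have "\<dots> = (A \<odot> (B \<odot> C)) i j"
    by (simp add: mm_def sum_distrib_left mult.assoc)
  finally show "(A \<odot> B \<odot> C) i j = (A \<odot> (B \<odot> C)) i j" .
qed

lemma mm_distribs:
  "(A + B) \<odot> C = A \<odot> C + B \<odot> C" "A \<odot> (B + C) = A \<odot> B + A \<odot> C"
  "(A - B) \<odot> C = A \<odot> C - B \<odot> C" "A \<odot> (B - C) = A \<odot> B - A \<odot> C"
  "0 \<odot> C = 0" "A \<odot> 0 = 0"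
  by (auto simp: mm_def fun_eq_iff algebra_simps sum.distrib sum_subtractf)

lemma tp_simps:
  "tp (tp A) = A" "tp (A \<odot> B) = tp B \<odot> tp A" "tp (A + B) = tp A + tp B" "tp (A - B) = tp A - tp B"
  by (auto simp: tp_def mm_def fun_eq_iff mult.commute)

lemma tr_simps:
  "tr (A + B) = tr A + tr B" "tr (A - B) = tr A - tr B" "tr (tp A) = tr A" "tr 0 = 0"
  by (auto simp: mtrace_def tp_def sum.distrib sum_subtractf)

lemma tr_commute: "tr (A \<odot> B) = tr (B \<odot> A)"
proof -
  have "tr (A \<odot> B) = (\<Sum>i<n. \<Sum>k<n. A i k * B k i)" by (simp add: mtrace_def mm_def)
  also have "\<dots> = (\<Sum>k<n. \<Sum>i<n. A i k * B k i)" by (rule sum.swap)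
  also have "\<dots> = tr (B \<odot> A)" by (simp add: mtrace_def mm_def mult.commute)
  finally show ?thesis .
qed

lemma fro_nonneg [simp]: "0 \<le> fro A"
  by (simp add: fro_def)

lemma fro_sq: "(fro A)\<^sup>2 = (\<Sum>i<n. \<Sum>j<n. (A i j)\<^sup>2)"
  by (simp add: fro_def L2_set_def sum.cartesian_product sum_nonneg case_prod_beta)

lemma fro_sq_tr: "(fro A)\<^sup>2 = tr (A \<odot> tp A)"
  unfolding fro_sq by (simp add: mtrace_def mm_def tp_def power2_eq_square)

lemma fro_tp [simp]: "fro (tp A) = fro A"
proof -
  have "(fro (tp A))\<^sup>2 = (fro A)\<^sup>2"
    by (simp add: fro_sq tp_def) (rule sum.swap)
  then show ?thesis by (simp add: power2_eq_iff_nonneg)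
qed

lemma fro_add: "fro (A + B) \<le> fro A + fro B"
proof -
  have "(\<lambda>(i, j). (A + B) i j) = (\<lambda>p. (\<lambda>(i, j). A i j) p + (\<lambda>(i, j). B i j) p)"
    by auto
  then show ?thesis
    unfolding fro_def by (simp only: L2_set_triangle_ineq)
qed

lemma fro_diff: "fro (A - B) \<le> fro A + fro B"
proof -
  have "fro (A - B) \<le> fro A + fro (- B)" using fro_add[of A "- B"] by simp
  also have "fro (- B) = fro B" by (simp add: fro_def L2_set_def case_prod_beta)
  finally show ?thesis .
qed

lemma inner_le_fro: "\<bar>\<Sum>i<n. \<Sum>j<n. A i j * B i j\<bar> \<le> fro A * fro B"
proof -
  have "\<bar>\<Sum>i<n. \<Sum>j<n. A i j * B i j\<bar> = \<bar>\<Sum>(i, j)\<in>{..<n} \<times> {..<n}. A i j * B i j\<bar>"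
    by (simp add: sum.cartesian_product)
  also have "\<dots> \<le> (\<Sum>p\<in>{..<n} \<times> {..<n}. \<bar>(\<lambda>(i, j). A i j) p\<bar> * \<bar>(\<lambda>(i, j). B i j) p\<bar>)"
    by (rule order_trans[OF sum_abs]) (simp add: case_prod_beta abs_mult)
  also have "\<dots> \<le> fro A * fro B"
    unfolding fro_def by (rule L2_set_mult_ineq)
  finally show ?thesis .
qed

lemma abs_tr_mm_le: "\<bar>tr (A \<odot> B)\<bar> \<le> fro A * fro B"
  using inner_le_fro[of A "tp B"] by (simp add: mtrace_def mm_def) (simp add: tp_def)

lemma fro_mm: "fro (A \<odot> B) \<le> fro A * fro B"
proof -
  have "(fro (A \<odot> B))\<^sup>2 = (\<Sum>i<n. \<Sum>j<n. (\<Sum>k<n. A i k * B k j)\<^sup>2)"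
    by (simp add: fro_sq mm_def)
  also have "\<dots> \<le> (\<Sum>i<n. \<Sum>j<n. (\<Sum>k<n. (A i k)\<^sup>2) * (\<Sum>k<n. (B k j)\<^sup>2))"
    by (intro sum_mono Cauchy_Schwarz_ineq_sum)
  also have "\<dots> = (\<Sum>i<n. \<Sum>k<n. (A i k)\<^sup>2) * (\<Sum>j<n. \<Sum>k<n. (B k j)\<^sup>2)"
    by (simp add: sum_product)
  also have "(\<Sum>j<n. \<Sum>k<n. (B k j)\<^sup>2) = (fro B)\<^sup>2"
    unfolding fro_sq by (rule sum.swap)
  finally have "(fro (A \<odot> B))\<^sup>2 \<le> (fro A * fro B)\<^sup>2"
    by (simp add: fro_sq power_mult_distrib)
  then show ?thesis by (rule power2_le_imp_le) simp
qed

lemma orthm_tp [simp]: "orthm (tp D) \<longleftrightarrow> orthm D"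
  by (auto simp: orthm_def tp_def)

lemma fro_orthm_left [simp]:
  assumes "orthm D"
  shows "fro (D \<odot> A) = fro A"
proof -
  have "(fro (D \<odot> A))\<^sup>2 = (\<Sum>j<n. \<Sum>i<n. ((D \<odot> A) i j)\<^sup>2)"
    unfolding fro_sq by (rule sum.swap)
  also have "\<dots> = (\<Sum>j<n. \<Sum>i<n. (A i j)\<^sup>2)"
  proof (rule sum.cong[OF refl])
    fix j
    have "(\<Sum>i<n. ((D \<odot> A) i j)\<^sup>2) = (\<Sum>i<n. \<Sum>k<n. \<Sum>l<n. A k j * A l j * (D i k * D i l))"
      by (simp add: mm_def power2_eq_square sum_product mult_ac)
    also have "\<dots> = (\<Sum>k<n. \<Sum>i<n. \<Sum>l<n. A k j * A l j * (D i k * D i l))"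
      by (rule sum.swap)
    also have "\<dots> = (\<Sum>k<n. \<Sum>l<n. \<Sum>i<n. A k j * A l j * (D i k * D i l))"
      by (intro sum.cong refl sum.swap)
    also have "\<dots> = (\<Sum>k<n. \<Sum>l<n. A k j * A l j * of_bool (k = l))"
      using assms by (intro sum.cong refl) (simp add: orthm_def flip: sum_distrib_left)
    also have "\<dots> = (\<Sum>k<n. (A k j)\<^sup>2)"
      by (simp add: power2_eq_square)
    finally show "(\<Sum>i<n. ((D \<odot> A) i j)\<^sup>2) = (\<Sum>i<n. (A i j)\<^sup>2)" .
  qed
  also have "\<dots> = (fro A)\<^sup>2"
    unfolding fro_sq by (rule sum.swap)
  finally show ?thesis by (simp add: power2_eq_iff_nonneg)
qed

lemma fro_orthm_right [simp]:
  assumes "orthm D"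
  shows "fro (A \<odot> D) = fro A"
proof -
  have "fro (A \<odot> D) = fro (tp D \<odot> tp A)"
    using fro_tp[of "A \<odot> D"] by (simp add: tp_simps)
  also have "\<dots> = fro A" using assms by simp
  finally show ?thesis .
qed

section \<open>Contractions over the rotation generators\<close>

lemma rot_gen_left: "a < n \<Longrightarrow> b < n \<Longrightarrow> (rot_gen a b \<odot> Z) i j = of_bool (i = a) * Z b j - of_bool (i = b) * Z a j"
proof -
  assume ab: "a < n" "b < n"
  have "(rot_gen a b \<odot> Z) i j = (\<Sum>l<n. (if l = b then of_bool (i = a) * Z l j else 0) - (if l = a then of_bool (i = b) * Z l j else 0))"
    unfolding mm_def rot_gen_def by (intro sum.cong refl) auto
  then show ?thesis using ab by (simp add: sum_subtractf)
qed

lemma rot_gen_sandwich: "a < n \<Longrightarrow> b < n \<Longrightarrow> (Y \<odot> rot_gen a b \<odot> Z) i j = Y i a * Z b j - Y i b * Z a j"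
proof -
  assume ab: "a < n" "b < n"
  have "(Y \<odot> rot_gen a b \<odot> Z) i j = (\<Sum>k<n. Y i k * (rot_gen a b \<odot> Z) k j)"
    unfolding mm_assoc by (subst mm_def) simp
  also have "\<dots> = (\<Sum>k<n. (if k = a then Y i k * Z b j else 0) - (if k = b then Y i k * Z a j else 0))"
    using ab by (intro sum.cong refl) (auto simp: rot_gen_left)
  finally show ?thesis using ab by (simp add: sum_subtractf)
qed

lemma rot_gen_right: "a < n \<Longrightarrow> b < n \<Longrightarrow> (Y \<odot> rot_gen a b) i j = Y i a * of_bool (j = b) - Y i b * of_bool (j = a)"
proof -
  assume ab: "a < n" "b < n"
  have "(Y \<odot> rot_gen a b) i j = (\<Sum>l<n. (if l = a then Y i l * of_bool (j = b) else 0) - (if l = b then Y i l * of_bool (j = a) else 0))"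
    unfolding mm_def rot_gen_def by (intro sum.cong refl) auto
  then show ?thesis using ab by (simp add: sum_subtractf)
qed

text \<open>Together with the next two lemmas this evaluates every divergence below: a derivative is
  a sum of products with one factor \<open>rot_gen a b\<close>, and contracting with the same
  \<open>a\<close>, \<open>b\<close> leaves traces only.\<close>

lemma sum_rot_gen_sandwich:
  "(\<Sum>a<n. \<Sum>b<n. (Y \<odot> rot_gen a b \<odot> Z) a b) = tr Y * tr Z - tr (Y \<odot> tp Z)"
proof -
  have "(\<Sum>a<n. \<Sum>b<n. (Y \<odot> rot_gen a b \<odot> Z) a b) = (\<Sum>a<n. \<Sum>b<n. Y a a * Z b b - Y a b * Z a b)"
    by (intro sum.cong refl) (simp add: rot_gen_sandwich)
  then show ?thesis by (simp add: sum_subtractf mtrace_def sum_product mm_def tp_def)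
qed

text \<open>The free index contributes a factor \<open>n\<close>, and the diagonal
  \<open>a = b\<close> takes one trace away. This is the origin of the \<open>n - 1\<close> in the
  variance \<open>|A|^2 / (n - 1)\<close>.\<close>

lemma sum_rot_gen_left: "(\<Sum>a<n. \<Sum>b<n. (rot_gen a b \<odot> Z) a b) = (real n - 1) * tr Z"
proof -
  have "(\<Sum>a<n. \<Sum>b<n. (rot_gen a b \<odot> Z) a b) = (\<Sum>a<n. \<Sum>b<n. Z b b - of_bool (a = b) * Z a b)"
    by (intro sum.cong refl) (simp add: rot_gen_left)
  then show ?thesis by (simp add: sum_subtractf mtrace_def left_diff_distrib flip: sum_distrib_left)
qed

lemma sum_rot_gen_right: "(\<Sum>a<n. \<Sum>b<n. (Y \<odot> rot_gen a b) a b) = (real n - 1) * tr Y"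
proof -
  have "(\<Sum>a<n. \<Sum>b<n. (Y \<odot> rot_gen a b) a b) = (\<Sum>a<n. \<Sum>b<n. Y a a - Y a b * of_bool (a = b))"
    by (intro sum.cong refl) (auto simp: rot_gen_right)
  then show ?thesis by (simp add: sum_subtractf mtrace_def left_diff_distrib flip: sum_distrib_left)
qed

lemma tr_rot_gen: "a < n \<Longrightarrow> b < n \<Longrightarrow> tr (rot_gen a b \<odot> H) = H b a - H a b"
  by (simp add: mtrace_def rot_gen_left sum_subtractf)

lemma tp_rot_gen: "tp (rot_gen a b) = 0 - rot_gen a b"
proof (intro ext)
  fix i j
  show "tp (rot_gen a b) i j = (0 - rot_gen a b) i j"
    by (cases "i = a"; cases "j = b"; cases "i = b"; cases "j = a") (simp_all add: tp_def rot_gen_def)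
qed

text \<open>\<open>tr (rot_gen a b H)\<close> sees only the antisymmetric part of \<open>H\<close>,
  hence the difference of two traces.\<close>

lemma sum_mult_tr_rot_gen:
  "(\<Sum>a<n. \<Sum>b<n. K a b * tr (rot_gen a b \<odot> H)) = tr (K \<odot> H) - tr (K \<odot> tp H)"
proof -
  have "(\<Sum>a<n. \<Sum>b<n. K a b * tr (rot_gen a b \<odot> H)) = (\<Sum>a<n. \<Sum>b<n. K a b * H b a - K a b * H a b)"
    by (intro sum.cong refl) (simp add: tr_rot_gen right_diff_distrib)
  then show ?thesis by (simp add: sum_subtractf mtrace_def mm_def tp_def)
qed

lemma abs_sum_mult_tr_rot_gen:
  "\<bar>\<Sum>a<n. \<Sum>b<n. K a b * tr (rot_gen a b \<odot> H)\<bar> \<le> 2 * (fro K * fro H)"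
  unfolding sum_mult_tr_rot_gen using abs_tr_mm_le[of K H] abs_tr_mm_le[of K "tp H"] by simp

end

section \<open>Integration by parts\<close>

text \<open>Differentiation under the integral sign. The limit is taken along sequences because
  dominated convergence is stated for them; the bound \<open>K\<close> on the derivative dominates
  the difference quotients.\<close>

lemma (in prob_space) has_real_derivative_integral:
  fixes f f' :: "real \<Rightarrow> 'a \<Rightarrow> real"
  assumes int: "\<And>t. integrable M (f t)"
    and meas: "f' t0 \<in> borel_measurable M"
    and der: "AE x in M. \<forall>t. ((\<lambda>t. f t x) has_real_derivative f' t x) (at t)"
    and bnd: "AE x in M. \<forall>t. \<bar>f' t x\<bar> \<le> K"
  shows "((\<lambda>t. \<integral>x. f t x \<partial>M) has_real_derivative (\<integral>x. f' t0 x \<partial>M)) (at t0)"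
  unfolding DERIV_def tendsto_at_iff_sequentially
proof (intro allI impI)
  fix h :: "nat \<Rightarrow> real" assume h0: "\<forall>i. h i \<in> UNIV - {0}" and h: "h \<longlonglongrightarrow> 0"
  have "(\<lambda>i. \<integral>x. (f (t0 + h i) x - f t0 x) / h i \<partial>M) \<longlonglongrightarrow> (\<integral>x. f' t0 x \<partial>M)"
  proof (rule integral_dominated_convergence[where w = "\<lambda>_. K"])
    show "f' t0 \<in> borel_measurable M" by fact
    show "(\<lambda>x. (f (t0 + h i) x - f t0 x) / h i) \<in> borel_measurable M" for i
      using int by (intro borel_measurable_divide borel_measurable_diff) auto
    show "integrable M (\<lambda>_. K)" by simp
    show "AE x in M. (\<lambda>i. (f (t0 + h i) x - f t0 x) / h i) \<longlonglongrightarrow> f' t0 x"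
      using der
    proof eventually_elim
      case (elim x)
      then have "((\<lambda>d. (f (t0 + d) x - f t0 x) / d) \<longlongrightarrow> f' t0 x) (at 0)"
        by (auto simp: DERIV_def)
      then show ?case
        using h0 h unfolding tendsto_at_iff_sequentially comp_def by blast
    qed
    show "AE x in M. norm ((f (t0 + h i) x - f t0 x) / h i) \<le> K" for i
      using der bnd
    proof eventually_elim
      case (elim x)
      \<comment> \<open>The mean value inequality along the whole line.\<close>
      have "norm (f (t0 + h i) x - f t0 x) \<le> K * norm ((t0 + h i) - t0)"
        using elim by (intro field_differentiable_bound[of UNIV "\<lambda>t. f t x" "\<lambda>t. f' t x" K]) auto
      then show ?case using h0 by (simp add: field_simps)
    qed
  qed
  moreover have "(\<integral>x. (f (t0 + h i) x - f t0 x) / h i \<partial>M) = ((\<integral>x. f (t0 + h i) x \<partial>M) - (\<integral>x. f t0 x \<partial>M)) / h i" for i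
    using int by simp
  ultimately show "((\<lambda>d. ((\<integral>x. f (t0 + d) x \<partial>M) - (\<integral>x. f t0 x \<partial>M)) / d) \<circ> h) \<longlonglongrightarrow> (\<integral>x. f' t0 x \<partial>M)"
    unfolding comp_def by (simp only:)
qed

text \<open>On indices below \<open>n\<close> this is the exponential of \<open>t\<close> times
  \<open>rot_gen a b\<close> for \<open>a \<noteq> b\<close>: the signs are chosen so that
  \<open>R' = rot_gen a b R\<close>, as \<open>rotation_mat_deriv\<close> confirms.\<close>

definition rotation_mat :: "nat \<Rightarrow> nat \<Rightarrow> nat \<Rightarrow> real \<Rightarrow> rmat" where
  "rotation_mat n a b t = (\<lambda>i\<in>{..<n}. \<lambda>k\<in>{..<n}.
     if i = a then cos t * of_bool (k = a) + sin t * of_bool (k = b)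
     else if i = b then cos t * of_bool (k = b) - sin t * of_bool (k = a)
     else of_bool (k = i))"

lemma rotation_mat_orth:
  assumes ab: "a < n" "b < n" "a \<noteq> b"
  shows "rotation_mat n a b t \<in> orth_group n"
proof -
  have sc: "sin t * sin t + cos t * cos t = 1" "cos t * cos t + sin t * sin t = 1"
    using sin_cos_squared_add[of t] by (auto simp: power2_eq_square)
  have d: "(\<Sum>k<n. (x * of_bool (k = p) + y * of_bool (k = q)) * (z * of_bool (k = r) + w * of_bool (k = s))) =
     x * z * of_bool (p = r) + x * w * of_bool (p = s) + y * z * of_bool (q = r) + y * w * of_bool (q = s)"
    if "p < n" "q < n" "r < n" "s < n" for x y z w :: real and p q r s
  proof -
    have e: "(\<Sum>k<n. (u * of_bool (k = p)) * (v * of_bool (k = r))) = u * v * of_bool (p = r)"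
      if "p < n" for u v :: real and p r
    proof -
      have "(\<Sum>k<n. (u * of_bool (k = p)) * (v * of_bool (k = r))) = (\<Sum>k<n. if k = p then u * v * of_bool (p = r) else 0)"
        by (intro sum.cong refl) auto
      then show ?thesis using that by simp
    qed
    show ?thesis
      using that by (simp only: distrib_left distrib_right sum.distrib e add.assoc)
  qed
  \<comment> \<open>Every row is written as \<open>\<alpha> i\<close> times the unit vector
    \<open>p i\<close> plus \<open>\<beta> i\<close> times the unit vector \<open>b\<close>, so that
    the product formula \<open>d\<close> covers all pairs of rows at once.\<close>
  define \<alpha> where "\<alpha> i = (if i = a then cos t else if i = b then - sin t else 1)" for i
  define \<beta> where "\<beta> i = (if i = a then sin t else if i = b then cos t else 0)" for i
  define p where "p i = (if i = a \<or> i = b then a else i)" for i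
  have R: "rotation_mat n a b t i k = \<alpha> i * of_bool (k = p i) + \<beta> i * of_bool (k = b)" if "i < n" "k < n" for i k
    using that ab by (auto simp: rotation_mat_def \<alpha>_def \<beta>_def p_def)
  have pn: "p i < n" if "i < n" for i using that ab by (auto simp: p_def)
  have "(\<Sum>k<n. rotation_mat n a b t i k * rotation_mat n a b t j k) = of_bool (i = j)" if "i < n" "j < n" for i j
  proof -
    have "(\<Sum>k<n. rotation_mat n a b t i k * rotation_mat n a b t j k) =
      (\<Sum>k<n. (\<alpha> i * of_bool (k = p i) + \<beta> i * of_bool (k = b)) * (\<alpha> j * of_bool (k = p j) + \<beta> j * of_bool (k = b)))"
      using that by (intro sum.cong refl) (simp add: R)
    also have "\<dots> = \<alpha> i * \<alpha> j * of_bool (p i = p j) + \<alpha> i * \<beta> j * of_bool (p i = b) + \<beta> i * \<alpha> j * of_bool (b = p j) + \<beta> i * \<beta> j * of_bool (b = b)"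
      by (rule d) (use that ab pn in auto)
    also have "\<dots> = of_bool (i = j)"
      using ab(3)
      by (cases "i = a"; cases "i = b"; cases "j = a"; cases "j = b") (simp_all add: \<alpha>_def \<beta>_def p_def sc)
    finally show ?thesis .
  qed
  then show ?thesis
    by (simp add: orth_group_iff) (simp add: rotation_mat_def space_mat_space)
qed

lemma rotation_mat_0: "rotation_mat n a b 0 = mid n"
  by (rule mat_space_eqI[of _ n]) (auto simp: rotation_mat_def mid_def space_mat_space)

lemma rotation_mat_deriv:
  assumes "a < n" "b < n" "a \<noteq> b" "i < n" "k < n"
  shows "((\<lambda>t. rotation_mat n a b t i k) has_real_derivative
     (of_bool (i = a) * rotation_mat n a b t b k - of_bool (i = b) * rotation_mat n a b t a k)) (at t)"
proof -
  consider "i = a" | "i = b" | "i \<noteq> a" "i \<noteq> b" by blast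
  then show ?thesis
  proof cases
    case 1
    have "((\<lambda>t. cos t * of_bool (k = a) + sin t * of_bool (k = b)) has_real_derivative
       (cos t * of_bool (k = b) - sin t * of_bool (k = a))) (at t)"
      by (auto intro!: derivative_eq_intros)
    then show ?thesis using assms 1 by (simp add: rotation_mat_def)
  next
    case 2
    have "((\<lambda>t. cos t * of_bool (k = b) - sin t * of_bool (k = a)) has_real_derivative
       (- (cos t * of_bool (k = a) + sin t * of_bool (k = b)))) (at t)"
      by (auto intro!: derivative_eq_intros)
    then show ?thesis using assms 2 by (simp add: rotation_mat_def)
  next
    case 3
    then show ?thesis using assms by (simp add: rotation_mat_def)
  qed
qed

section \<open>Bounded functions on the orthogonal group and their derivatives along flows\<close>

context mat_dim
begin

lemma orthm_orth_group: "D \<in> orth_group n \<Longrightarrow> orthm D"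
  using orth_group_columns[of D n] by (auto simp: orthm_def orth_group_iff)

text \<open>Boundedness is asked only on the orthogonal group, where \<open>D\<close> lies almost
  surely. All polynomials in the entries qualify, so integrability becomes a matter of closure
  rules.\<close>

definition nice :: "(rmat \<Rightarrow> real) \<Rightarrow> bool" where
  "nice g \<longleftrightarrow> g \<in> borel_measurable (mat_space n) \<and> (\<exists>K. \<forall>D\<in>orth_group n. \<bar>g D\<bar> \<le> K)"

definition mnice :: "(rmat \<Rightarrow> rmat) \<Rightarrow> bool" where
  "mnice F \<longleftrightarrow> (\<forall>i<n. \<forall>j<n. nice (\<lambda>D. F D i j))"

lemma niceI: "g \<in> borel_measurable (mat_space n) \<Longrightarrow> (\<And>D. D \<in> orth_group n \<Longrightarrow> \<bar>g D\<bar> \<le> K) \<Longrightarrow> nice g"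
  by (auto simp: nice_def)

lemma niceE:
  assumes "nice g"
  obtains K where "g \<in> borel_measurable (mat_space n)" "\<And>D. D \<in> orth_group n \<Longrightarrow> \<bar>g D\<bar> \<le> K"
  using assms by (auto simp: nice_def)

lemma nice_const [simp, intro]: "nice (\<lambda>_. c)"
  by (rule niceI[of _ "\<bar>c\<bar>"]) auto

lemma nice_add [intro]: "nice f \<Longrightarrow> nice g \<Longrightarrow> nice (\<lambda>D. f D + g D)"
proof (elim niceE)
  fix K L assume "f \<in> borel_measurable (mat_space n)" "g \<in> borel_measurable (mat_space n)"
    and b: "\<And>D. D \<in> orth_group n \<Longrightarrow> \<bar>f D\<bar> \<le> K" "\<And>D. D \<in> orth_group n \<Longrightarrow> \<bar>g D\<bar> \<le> L"
  then show ?thesis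
    by (intro niceI[of _ "K + L"] borel_measurable_add order_trans[OF abs_triangle_ineq] add_mono)
qed

lemma nice_mult [intro]: "nice f \<Longrightarrow> nice g \<Longrightarrow> nice (\<lambda>D. f D * g D)"
proof (elim niceE)
  fix K L assume "f \<in> borel_measurable (mat_space n)" "g \<in> borel_measurable (mat_space n)"
    and b: "\<And>D. D \<in> orth_group n \<Longrightarrow> \<bar>f D\<bar> \<le> K" "\<And>D. D \<in> orth_group n \<Longrightarrow> \<bar>g D\<bar> \<le> L"
  then show ?thesis
    by (intro niceI[of _ "K * L"] borel_measurable_times)
       (auto simp: abs_mult intro!: mult_mono order_trans[OF abs_ge_zero b(1)])
qed

lemma nice_diff [intro]: "nice f \<Longrightarrow> nice g \<Longrightarrow> nice (\<lambda>D. f D - g D)"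
  using nice_add[of f "\<lambda>D. (-1) * g D"] nice_mult[of "\<lambda>_. -1" g] by simp

lemma nice_sum [intro]: "(\<And>i. i \<in> I \<Longrightarrow> nice (f i)) \<Longrightarrow> nice (\<lambda>D. \<Sum>i\<in>I. f i D)"
  by (induction I rule: infinite_finite_induct) (auto intro!: nice_add)

lemma nice_compose:
  fixes \<phi> :: "real \<Rightarrow> real"
  assumes "continuous_on UNIV \<phi>" "nice f"
  shows "nice (\<lambda>D. \<phi> (f D))"
proof -
  obtain K where f: "f \<in> borel_measurable (mat_space n)" "\<And>D. D \<in> orth_group n \<Longrightarrow> \<bar>f D\<bar> \<le> K"
    using assms(2) by (rule niceE) (erule that)
  have "compact (\<phi> ` {-K..K})"
    using assms(1) by (intro compact_continuous_image) (auto intro: continuous_on_subset)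
  then have "bounded (\<phi> ` {-K..K})" by (rule compact_imp_bounded)
  then obtain L where L: "\<And>x. -K \<le> x \<and> x \<le> K \<Longrightarrow> \<bar>\<phi> x\<bar> \<le> L" unfolding bounded_iff by force
  show ?thesis
  proof (rule niceI)
    show "(\<lambda>D. \<phi> (f D)) \<in> borel_measurable (mat_space n)"
      using assms(1) f(1) by (intro measurable_compose[OF f(1)] borel_measurable_continuous_onI)
    show "\<bar>\<phi> (f D)\<bar> \<le> L" if "D \<in> orth_group n" for D
      using f(2)[OF that] by (intro L) auto
  qed
qed

lemma mnice_entry: "mnice F \<Longrightarrow> i < n \<Longrightarrow> j < n \<Longrightarrow> nice (\<lambda>D. F D i j)"
  by (simp add: mnice_def)

lemma mnice_const [simp, intro]: "mnice (\<lambda>_. A)"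
  by (simp add: mnice_def)

lemma mnice_id [simp, intro]: "mnice (\<lambda>D. D)"
  unfolding mnice_def
proof (intro allI impI)
  fix i j assume ij: "i < n" "j < n"
  show "nice (\<lambda>D. D i j)"
  proof (rule niceI[where K = 1])
    show "(\<lambda>D. D i j) \<in> borel_measurable (mat_space n)"
      using ij by (intro measurable_entry measurable_ident_sets) auto
    fix D assume "D \<in> orth_group n"
    then have "(\<Sum>k<n. D i k * D i k) = 1" using ij by (auto simp: orth_group_iff)
    moreover have "D i j * D i j \<le> (\<Sum>k<n. D i k * D i k)"
      using ij by (intro member_le_sum[where f = "\<lambda>k. D i k * D i k"]) auto
    ultimately have "(D i j)\<^sup>2 \<le> 1\<^sup>2" by (simp add: power2_eq_square)
    then show "\<bar>D i j\<bar> \<le> 1" using abs_le_square_iff[of "D i j" 1] by simp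
  qed
qed

lemma mnice_tp [intro]: "mnice F \<Longrightarrow> mnice (\<lambda>D. tp (F D))"
  by (simp add: mnice_def tp_def)

lemma mnice_add [intro]: "mnice F \<Longrightarrow> mnice G \<Longrightarrow> mnice (\<lambda>D. F D + G D)"
  by (auto simp: mnice_def)

lemma mnice_diff [intro]: "mnice F \<Longrightarrow> mnice G \<Longrightarrow> mnice (\<lambda>D. F D - G D)"
  by (auto simp: mnice_def)

lemma mnice_mm [intro]: "mnice F \<Longrightarrow> mnice G \<Longrightarrow> mnice (\<lambda>D. F D \<odot> G D)"
  unfolding mnice_def mm_def by (auto intro!: nice_sum nice_mult)

lemma nice_tr [intro]: "mnice F \<Longrightarrow> nice (\<lambda>D. tr (F D))"
  unfolding mnice_def mtrace_def by (auto intro!: nice_sum)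

text \<open>A flow is a solution of \<open>D' = X D - D X\<close> with \<open>X = rot_gen a b\<close>; \<open>sder\<close> and \<open>mder\<close> are derivatives of
  scalar and matrix valued functions of \<open>D\<close> along all such curves.\<close>

definition flow :: "nat \<Rightarrow> nat \<Rightarrow> (real \<Rightarrow> rmat) \<Rightarrow> bool" where
  "flow a b \<gamma> \<longleftrightarrow> (\<forall>t. \<gamma> t \<in> orth_group n) \<and>
     (\<forall>t. \<forall>i<n. \<forall>j<n. ((\<lambda>t. \<gamma> t i j) has_real_derivative
        (rot_gen a b \<odot> \<gamma> t - \<gamma> t \<odot> rot_gen a b) i j) (at t))"

definition sder :: "nat \<Rightarrow> nat \<Rightarrow> (rmat \<Rightarrow> real) \<Rightarrow> (rmat \<Rightarrow> real) \<Rightarrow> bool" where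
  "sder a b g g' \<longleftrightarrow> (\<forall>\<gamma>. flow a b \<gamma> \<longrightarrow> (\<forall>t. ((\<lambda>t. g (\<gamma> t)) has_real_derivative g' (\<gamma> t)) (at t)))"

definition mder :: "nat \<Rightarrow> nat \<Rightarrow> (rmat \<Rightarrow> rmat) \<Rightarrow> (rmat \<Rightarrow> rmat) \<Rightarrow> bool" where
  "mder a b F F' \<longleftrightarrow> (\<forall>i<n. \<forall>j<n. sder a b (\<lambda>D. F D i j) (\<lambda>D. F' D i j))"

lemma sder_sum: "(\<And>i. i \<in> I \<Longrightarrow> sder a b (f i) (f' i)) \<Longrightarrow> sder a b (\<lambda>D. \<Sum>i\<in>I. f i D) (\<lambda>D. \<Sum>i\<in>I. f' i D)"
  unfolding sder_def by (auto intro!: DERIV_sum)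

lemma sder_mult: "sder a b f f' \<Longrightarrow> sder a b g g' \<Longrightarrow> sder a b (\<lambda>D. f D * g D) (\<lambda>D. f' D * g D + f D * g' D)"
  unfolding sder_def by (auto intro!: derivative_eq_intros)

lemma sder_compose:
  assumes "\<And>x. (\<phi> has_real_derivative \<phi>' x) (at x)" "sder a b f f'"
  shows "sder a b (\<lambda>D. \<phi> (f D)) (\<lambda>D. \<phi>' (f D) * f' D)"
  unfolding sder_def
proof (intro allI impI)
  fix \<gamma> t assume "flow a b \<gamma>"
  then have "((\<lambda>t. f (\<gamma> t)) has_real_derivative f' (\<gamma> t)) (at t)"
    using assms(2) by (auto simp: sder_def)
  from DERIV_chain2[OF assms(1) this]
  show "((\<lambda>t. \<phi> (f (\<gamma> t))) has_real_derivative \<phi>' (f (\<gamma> t)) * f' (\<gamma> t)) (at t)" .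
qed

lemma mder_const: "mder a b (\<lambda>_. A) (\<lambda>_. 0)"
  by (auto simp: mder_def sder_def)

lemma mder_id: "mder a b (\<lambda>D. D) (\<lambda>D. rot_gen a b \<odot> D - D \<odot> rot_gen a b)"
  by (auto simp: mder_def sder_def flow_def)

lemma mder_tp: "mder a b F F' \<Longrightarrow> mder a b (\<lambda>D. tp (F D)) (\<lambda>D. tp (F' D))"
  by (auto simp: mder_def tp_def)

lemma mder_diff: "mder a b F F' \<Longrightarrow> mder a b G G' \<Longrightarrow> mder a b (\<lambda>D. F D - G D) (\<lambda>D. F' D - G' D)"
  unfolding mder_def sder_def by (auto intro!: derivative_eq_intros)

lemma mder_mm: "mder a b F F' \<Longrightarrow> mder a b G G' \<Longrightarrow> mder a b (\<lambda>D. F D \<odot> G D) (\<lambda>D. F' D \<odot> G D + F D \<odot> G' D)"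
  unfolding mder_def
proof (intro allI impI)
  fix i j assume F: "\<forall>i<n. \<forall>j<n. sder a b (\<lambda>D. F D i j) (\<lambda>D. F' D i j)"
    and G: "\<forall>i<n. \<forall>j<n. sder a b (\<lambda>D. G D i j) (\<lambda>D. G' D i j)" and ij: "i < n" "j < n"
  have "sder a b (\<lambda>D. \<Sum>k<n. F D i k * G D k j) (\<lambda>D. \<Sum>k<n. F' D i k * G D k j + F D i k * G' D k j)"
    using F G ij by (intro sder_sum sder_mult) auto
  then show "sder a b (\<lambda>D. (F D \<odot> G D) i j) (\<lambda>D. (F' D \<odot> G D + F D \<odot> G' D) i j)"
    by (simp add: mm_def sum.distrib)
qed

lemma sder_tr: "mder a b F F' \<Longrightarrow> sder a b (\<lambda>D. tr (F D)) (\<lambda>D. tr (F' D))"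
  unfolding mtrace_def mder_def by (intro sder_sum) auto

text \<open>Generators are antisymmetric, so \<open>D^T\<close> moves by the same equation as
  \<open>D\<close>. This lets \<open>quadratic_second_moment\<close> treat \<open>E = D\<close> and
  \<open>E = D^T\<close> together.\<close>

lemma mder_tp_id: "mder a b (\<lambda>D. tp D) (\<lambda>D. rot_gen a b \<odot> tp D - tp D \<odot> rot_gen a b)"
proof -
  have "tp (rot_gen a b \<odot> D - D \<odot> rot_gen a b) = rot_gen a b \<odot> tp D - tp D \<odot> rot_gen a b" for D
    unfolding tp_simps tp_rot_gen mm_distribs by simp
  then show ?thesis using mder_tp[OF mder_id[of a b]] by simp
qed

definition conj_rotation :: "nat \<Rightarrow> nat \<Rightarrow> rmat \<Rightarrow> real \<Rightarrow> rmat" where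
  "conj_rotation a b D t = mmul n (rotation_mat n a b t) (mmul n D (mtrans n (rotation_mat n a b t)))"

text \<open>With \<open>R' = X R\<close> the product rule gives
  \<open>X (R D R^T) + (R D R^T) X^T\<close>, and \<open>X^T = - X\<close>.\<close>

lemma flow_conj_rotation:
  assumes ab: "a < n" "b < n" "a \<noteq> b" and D: "D \<in> orth_group n"
  shows "flow a b (conj_rotation a b D)"
  unfolding flow_def
proof (intro conjI allI impI)
  fix t
  show "conj_rotation a b D t \<in> orth_group n"
    unfolding conj_rotation_def using ab D
    by (intro orth_group_mmul orth_group_mtrans rotation_mat_orth)
  fix i j assume ij: "i < n" "j < n"
  define R where "R t = rotation_mat n a b t" for t
  define R' where "R' t i k = of_bool (i = a) * R t b k - of_bool (i = b) * R t a k" for t i k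
  have c: "conj_rotation a b D t i j = (\<Sum>k<n. R t i k * (\<Sum>l<n. D k l * R t j l))" if "i < n" "j < n" for t i j
    using that by (simp add: conj_rotation_def mmul_apply mtrans_apply R_def)
  have R: "((\<lambda>t. R t i k) has_real_derivative R' t i k) (at t)" if "i < n" "k < n" for t i k
    using rotation_mat_deriv[OF ab that] by (simp add: R_def R'_def)
  have "((\<lambda>t. \<Sum>k<n. R t i k * (\<Sum>l<n. D k l * R t j l)) has_real_derivative
     (\<Sum>k<n. R' t i k * (\<Sum>l<n. D k l * R t j l) + (\<Sum>l<n. D k l * R' t j l) * R t i k)) (at t)"
    using ij by (intro DERIV_sum DERIV_mult DERIV_cmult R) auto
  also have "(\<Sum>k<n. R' t i k * (\<Sum>l<n. D k l * R t j l) + (\<Sum>l<n. D k l * R' t j l) * R t i k) =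
    (rot_gen a b \<odot> conj_rotation a b D t - conj_rotation a b D t \<odot> rot_gen a b) i j"
  proof -
    have 1: "(\<Sum>k<n. R' t i k * (\<Sum>l<n. D k l * R t j l)) =
      of_bool (i = a) * conj_rotation a b D t b j - of_bool (i = b) * conj_rotation a b D t a j"
      using ij ab by (simp add: c R'_def left_diff_distrib sum_subtractf sum_distrib_left mult.assoc)
    have 2: "(\<Sum>k<n. (\<Sum>l<n. D k l * R' t j l) * R t i k) =
      of_bool (j = a) * conj_rotation a b D t i b - of_bool (j = b) * conj_rotation a b D t i a"
      using ij ab by (simp add: c R'_def left_diff_distrib right_diff_distrib sum_subtractf sum_distrib_left sum_distrib_right mult_ac)
    show ?thesis
      unfolding sum.distrib 1 2 minus_apply rot_gen_left[OF ab(1,2)] rot_gen_right[OF ab(1,2)] by algebra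
  qed
  finally show "((\<lambda>t. conj_rotation a b D t i j) has_real_derivative
    (rot_gen a b \<odot> conj_rotation a b D t - conj_rotation a b D t \<odot> rot_gen a b) i j) (at t)"
    using ij by (simp add: c)
qed

lemma conj_rotation_0: "D \<in> space (mat_space n) \<Longrightarrow> conj_rotation a b D 0 = D"
  by (simp add: conj_rotation_def rotation_mat_0 mmul_mid_left)
     (rule mat_space_eqI[of _ n], auto simp: mmul_apply mtrans_apply mid_apply if_distrib cong: if_cong)

end

text \<open>Instantiated twice: by the law of \<open>M C M^T\<close> and by that of its square.
  Therefore \<open>tr D^2 = 0\<close> is a hypothesis of single lemmas instead of an assumption
  here; for the square it would read \<open>tr D^4 = 0\<close>, which is false for the cycle with
  \<open>n = 4\<close>.\<close>

locale conj_inv = mat_dim n + prob_space \<rho> for n :: nat and \<rho> :: "rmat measure" +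
  assumes sets_rho: "sets \<rho> = sets (mat_space n)"
    and AE_orth: "AE D in \<rho>. D \<in> orth_group n"
    and conj_invariant: "\<And>Q. Q \<in> orth_group n \<Longrightarrow>
      distr \<rho> (mat_space n) (\<lambda>D. mmul n Q (mmul n D (mtrans n Q))) = \<rho>"
    and AE_trace: "AE D in \<rho>. mtrace n D = 0"
begin

lemma nice_measurable: "nice g \<Longrightarrow> g \<in> borel_measurable \<rho>"
  by (simp add: nice_def measurable_cong_sets[OF sets_rho refl])

lemma nice_integrable: "nice g \<Longrightarrow> integrable \<rho> g"
proof -
  assume g: "nice g"
  then obtain K where K: "\<And>D. D \<in> orth_group n \<Longrightarrow> \<bar>g D\<bar> \<le> K" by (auto simp: nice_def)
  show ?thesis
    using AE_orth K by (intro integrable_const_bound[where B = K] nice_measurable g) (auto elim!: eventually_mono)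
qed

text \<open>By invariance the mean of \<open>g\<close> along the rotated matrices is constant in
  \<open>t\<close>; its derivative at \<open>t = 0\<close> is the mean of \<open>g'\<close>.\<close>

lemma integration_by_parts:
  assumes g: "nice g" and g': "nice g'" and der: "sder a b g g'" and ab: "a < n" "b < n"
  shows "(\<integral>D. g' D \<partial>\<rho>) = 0"
proof (cases "a = b")
  case True
  \<comment> \<open>For \<open>a = b\<close> the generator is zero and the constant curve is a
    flow.\<close>
  have "g' D = 0" if D: "D \<in> orth_group n" for D
  proof -
    have "flow a b (\<lambda>_. D)"
      using True D ab by (auto simp: flow_def rot_gen_left rot_gen_right)
    then have "((\<lambda>t::real. g D) has_real_derivative g' D) (at 0)"
      using der by (auto simp: sder_def)
    then show ?thesis using DERIV_unique[OF _ DERIV_const] by blast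
  qed
  then have "AE D in \<rho>. g' D = 0" using AE_orth by (auto elim!: eventually_mono)
  then show ?thesis by (simp add: integral_eq_zero_AE)
next
  case False
  let ?f = "\<lambda>t D. g (conj_rotation a b D t)" and ?f' = "\<lambda>t D. g' (conj_rotation a b D t)"
  obtain K where K: "\<And>D. D \<in> orth_group n \<Longrightarrow> \<bar>g' D\<bar> \<le> K" using g' by (auto simp: nice_def)
  have m: "(\<lambda>D. conj_rotation a b D t) \<in> measurable \<rho> (mat_space n)" for t
  proof -
    have R: "rotation_mat n a b t \<in> space (mat_space n)"
      using rotation_mat_orth[OF ab False] by (rule orth_group_space)
    show ?thesis
      unfolding conj_rotation_def
      by (intro measurable_mmul measurable_mtrans measurable_const R measurable_ident_sets sets_rho)
  qed
  have d: "distr \<rho> (mat_space n) (\<lambda>D. conj_rotation a b D t) = \<rho>" for t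
    unfolding conj_rotation_def by (intro conj_invariant rotation_mat_orth ab False)
  have int: "integrable \<rho> (?f t) \<and> (\<integral>D. ?f t D \<partial>\<rho>) = (\<integral>D. g D \<partial>\<rho>)" for t
  proof -
    have gm: "g \<in> borel_measurable (mat_space n)" using g by (simp add: nice_def)
    have "integrable (distr \<rho> (mat_space n) (\<lambda>D. conj_rotation a b D t)) g"
      unfolding d by (rule nice_integrable[OF g])
    then have "integrable \<rho> (?f t)" unfolding integrable_distr_eq[OF m gm] .
    then show ?thesis
      using integral_distr[OF m gm, of t] by (simp add: d)
  qed
  have "((\<lambda>t. \<integral>D. ?f t D \<partial>\<rho>) has_real_derivative (\<integral>D. ?f' 0 D \<partial>\<rho>)) (at 0)"
  proof (rule has_real_derivative_integral[where K = K])
    show "integrable \<rho> (?f t)" for t using int by blast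
    show "?f' 0 \<in> borel_measurable \<rho>"
      using g' by (intro measurable_compose[OF m]) (simp add: nice_def)
    show "AE D in \<rho>. \<forall>t. ((\<lambda>t. ?f t D) has_real_derivative ?f' t D) (at t)"
      using AE_orth
    proof eventually_elim
      case (elim D)
      from flow_conj_rotation[OF ab False this] show ?case using der by (auto simp: sder_def)
    qed
    show "AE D in \<rho>. \<forall>t. \<bar>?f' t D\<bar> \<le> K"
      using AE_orth
    proof eventually_elim
      case (elim D)
      from flow_conj_rotation[OF ab False this] show ?case using K by (auto simp: flow_def)
    qed
  qed
  moreover have "(\<lambda>t. \<integral>D. ?f t D \<partial>\<rho>) = (\<lambda>t. \<integral>D. g D \<partial>\<rho>)" using int by auto
  ultimately have "(\<integral>D. ?f' 0 D \<partial>\<rho>) = 0"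
    using DERIV_unique[OF _ DERIV_const] by metis
  moreover have "(\<integral>D. ?f' 0 D \<partial>\<rho>) = (\<integral>D. g' D \<partial>\<rho>)"
    using sets_eq_imp_space_eq[OF sets_rho]
    by (intro Bochner_Integration.integral_cong refl) (simp add: conj_rotation_0)
  ultimately show ?thesis by simp
qed

text \<open>A divergence theorem: entry \<open>(a,b)\<close> of the matrix field \<open>K\<close> is
  differentiated in direction \<open>(a,b)\<close>. It is the sum of the scalar formula applied to
  the products \<open>K D a b * g D\<close>.\<close>

lemma integration_by_parts_matrix:
  assumes K: "mnice K" and g: "nice g"
    and K': "\<And>a b. a < n \<Longrightarrow> b < n \<Longrightarrow> mnice (K' a b) \<and> mder a b K (K' a b)"
    and g': "\<And>a b. a < n \<Longrightarrow> b < n \<Longrightarrow> nice (g' a b) \<and> sder a b g (g' a b)"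
  shows "(\<integral>D. (\<Sum>a<n. \<Sum>b<n. K' a b D a b) * g D \<partial>\<rho>) = - (\<integral>D. (\<Sum>a<n. \<Sum>b<n. K D a b * g' a b D) \<partial>\<rho>)"
proof -
  have n1: "nice (\<lambda>D. K' a b D a b * g D)" and n2: "nice (\<lambda>D. K D a b * g' a b D)"
    and z: "(\<integral>D. K' a b D a b * g D + K D a b * g' a b D \<partial>\<rho>) = 0" if "a < n" "b < n" for a b
  proof -
    have "sder a b (\<lambda>D. K D a b) (\<lambda>D. K' a b D a b)" using K'[OF that] that by (auto simp: mder_def)
    then have "sder a b (\<lambda>D. K D a b * g D) (\<lambda>D. K' a b D a b * g D + K D a b * g' a b D)"
      using g'[OF that] by (intro sder_mult) auto
    moreover show "nice (\<lambda>D. K' a b D a b * g D)" "nice (\<lambda>D. K D a b * g' a b D)"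
      using g K'[OF that] g'[OF that] that
      by (auto intro!: nice_mult mnice_entry[OF K] mnice_entry[of "K' a b"])
    ultimately show "(\<integral>D. K' a b D a b * g D + K D a b * g' a b D \<partial>\<rho>) = 0"
      using g that by (intro integration_by_parts[of "\<lambda>D. K D a b * g D" _ a b]) (auto intro!: nice_mult mnice_entry[OF K])
  qed
  have "(\<integral>D. (\<Sum>a<n. \<Sum>b<n. K' a b D a b) * g D \<partial>\<rho>) = (\<Sum>a<n. \<Sum>b<n. \<integral>D. K' a b D a b * g D \<partial>\<rho>)"
    unfolding sum_distrib_right using n1
    by (subst Bochner_Integration.integral_sum, force intro!: nice_integrable,
        intro sum.cong refl Bochner_Integration.integral_sum nice_integrable) auto
  moreover have "(\<integral>D. (\<Sum>a<n. \<Sum>b<n. K D a b * g' a b D) \<partial>\<rho>) = (\<Sum>a<n. \<Sum>b<n. \<integral>D. K D a b * g' a b D \<partial>\<rho>)"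
    using n2
    by (subst Bochner_Integration.integral_sum, force intro!: nice_integrable,
        intro sum.cong refl Bochner_Integration.integral_sum nice_integrable) auto
  moreover have "(\<integral>D. K' a b D a b * g D \<partial>\<rho>) = - (\<integral>D. K D a b * g' a b D \<partial>\<rho>)" if "a < n" "b < n" for a b
    using z[OF that] Bochner_Integration.integral_add[OF nice_integrable[OF n1[OF that]] nice_integrable[OF n2[OF that]]] by simp
  ultimately show ?thesis by (simp add: sum_negf)
qed

end

section \<open>Moment bounds\<close>

context conj_inv
begin

text \<open>The gradient of \<open>tr (D A)\<close> under conjugation: in direction \<open>X\<close>
  the derivative is \<open>tr ((X D - D X) A) = tr (X (D A - A D))\<close>.\<close>

definition comm :: "rmat \<Rightarrow> rmat \<Rightarrow> rmat" where
  "comm A D = D \<odot> A - A \<odot> D"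

lemma mnice_comm [intro]: "mnice F \<Longrightarrow> mnice (\<lambda>D. comm (F D) D)"
  unfolding comm_def by (intro mnice_diff mnice_mm mnice_id)

lemma nice_fro_sq: "mnice F \<Longrightarrow> nice (\<lambda>D. (fro (F D))\<^sup>2)"
  unfolding fro_sq_tr by (intro nice_tr mnice_mm mnice_tp)

text \<open>The matrix field is the gradient \<open>comm A\<close> of \<open>W\<close>. Its
  divergence is, up to a constant factor, the Laplacian of \<open>W\<close>; pairing it with the
  gradient of \<open>\<phi>(W)\<close> gives \<open>\<phi>'(W)\<close> times a multiple of the
  squared gradient norm.\<close>

lemma first_order_identity:
  assumes d: "\<And>x. (\<phi> has_real_derivative \<phi>' x) (at x)" and c: "continuous_on UNIV \<phi>'"
  shows "(\<integral>D. (2 * (real n - 1) * tr (D \<odot> A) + 2 * tr (D \<odot> tp A)) * \<phi> (tr (D \<odot> A)) \<partial>\<rho>) =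
    (\<integral>D. ((fro (comm A D))\<^sup>2 - tr (comm A D \<odot> comm A D)) * \<phi>' (tr (D \<odot> A)) \<partial>\<rho>)"
proof -
  let ?K' = "\<lambda>a b D. (rot_gen a b \<odot> D - D \<odot> rot_gen a b) \<odot> A - A \<odot> (rot_gen a b \<odot> D - D \<odot> rot_gen a b)"
  let ?g = "\<lambda>D. \<phi> (tr (D \<odot> A))"
  let ?g' = "\<lambda>a b D. \<phi>' (tr (D \<odot> A)) * tr (rot_gen a b \<odot> comm A D)"
  have c': "continuous_on UNIV \<phi>"
    using d by (intro DERIV_continuous_on[of _ _ \<phi>']) (auto intro: has_field_derivative_at_within)
  have nW: "nice (\<lambda>D. tr (D \<odot> A))" by (intro nice_tr mnice_mm mnice_id mnice_const)
  have ng: "nice ?g" by (rule nice_compose[OF c' nW])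
  have mK: "mder a b (comm A) (?K' a b)" for a b
    unfolding comm_def
    using mder_diff[OF mder_mm[OF mder_id mder_const] mder_mm[OF mder_const mder_id], of a b A A]
    by (simp add: mm_distribs)
  have trX: "tr ((rot_gen a b \<odot> D - D \<odot> rot_gen a b) \<odot> A) = tr (rot_gen a b \<odot> comm A D)" for a b D
    using tr_commute[of D "rot_gen a b \<odot> A"] by (simp add: comm_def mm_distribs mm_assoc tr_simps)
  have sg: "sder a b ?g (?g' a b)" for a b
    using sder_compose[OF d sder_tr[OF mder_mm[OF mder_id mder_const]], of a b A]
    by (simp add: mm_distribs(6) trX)
  \<comment> \<open>The only term that is not of the shape \<open>tr (D A)\<close> or
    \<open>tr (D A^T)\<close> is \<open>tr D * tr A\<close>, which vanishes almost surely.\<close>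
  have S: "(\<Sum>a<n. \<Sum>b<n. ?K' a b D a b) = 2 * (real n - 1) * tr (D \<odot> A) + 2 * tr (D \<odot> tp A) - 2 * (tr D * tr A)" for D
  proof -
    have "?K' a b D = rot_gen a b \<odot> (D \<odot> A) - D \<odot> rot_gen a b \<odot> A - (A \<odot> rot_gen a b \<odot> D - A \<odot> D \<odot> rot_gen a b)" for a b
      by (simp add: mm_distribs mm_assoc)
    then have "(\<Sum>a<n. \<Sum>b<n. ?K' a b D a b) = (real n - 1) * tr (D \<odot> A) - (tr D * tr A - tr (D \<odot> tp A))
        - ((tr A * tr D - tr (A \<odot> tp D)) - (real n - 1) * tr (A \<odot> D))"
      by (simp only: minus_apply sum_subtractf sum_rot_gen_left sum_rot_gen_sandwich sum_rot_gen_right)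
    moreover have "tr (A \<odot> tp D) = tr (D \<odot> tp A)"
      using tr_simps(3)[of "A \<odot> tp D"] by (simp add: tp_simps)
    ultimately show ?thesis using tr_commute[of A D] by (simp add: algebra_simps)
  qed
  have "(\<integral>D. (\<Sum>a<n. \<Sum>b<n. ?K' a b D a b) * ?g D \<partial>\<rho>) = - (\<integral>D. (\<Sum>a<n. \<Sum>b<n. comm A D a b * ?g' a b D) \<partial>\<rho>)"
  proof (rule integration_by_parts_matrix[where K = "comm A" and K' = ?K' and g = ?g and g' = ?g'])
    show "mnice (comm A)" using mnice_comm[of "\<lambda>_. A"] by simp
    show "nice ?g" by (rule ng)
    show "mnice (?K' a b) \<and> mder a b (comm A) (?K' a b)" for a b
      by (intro conjI mK mnice_diff mnice_mm mnice_id mnice_const)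
    show "nice (?g' a b) \<and> sder a b ?g (?g' a b)" for a b
      by (intro conjI sg nice_mult nice_compose[OF c nW] nice_tr mnice_mm mnice_const mnice_comm)
  qed
  moreover have "(\<Sum>a<n. \<Sum>b<n. comm A D a b * ?g' a b D) =
     - (((fro (comm A D))\<^sup>2 - tr (comm A D \<odot> comm A D)) * \<phi>' (tr (D \<odot> A)))" for D
  proof -
    have "(\<Sum>a<n. \<Sum>b<n. comm A D a b * ?g' a b D) = \<phi>' (tr (D \<odot> A)) * (\<Sum>a<n. \<Sum>b<n. comm A D a b * tr (rot_gen a b \<odot> comm A D))"
      by (simp add: sum_distrib_left mult_ac)
    then show ?thesis
      unfolding sum_mult_tr_rot_gen fro_sq_tr by (simp add: algebra_simps)
  qed
  moreover have "(\<integral>D. (\<Sum>a<n. \<Sum>b<n. ?K' a b D a b) * ?g D \<partial>\<rho>) =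
    (\<integral>D. (2 * (real n - 1) * tr (D \<odot> A) + 2 * tr (D \<odot> tp A)) * ?g D \<partial>\<rho>)"
  proof (rule integral_cong_AE)
    have "nice (\<lambda>D. (2 * (real n - 1) * tr (D \<odot> A) + 2 * tr (D \<odot> tp A)) * ?g D)"
      by (intro nice_mult nice_add ng nice_const nice_tr mnice_mm mnice_id mnice_const)
    then show "(\<lambda>D. (2 * (real n - 1) * tr (D \<odot> A) + 2 * tr (D \<odot> tp A)) * ?g D) \<in> borel_measurable \<rho>"
      by (rule nice_measurable)
    have "nice (\<lambda>D. (\<Sum>a<n. \<Sum>b<n. ?K' a b D a b) * ?g D)"
      unfolding S by (intro nice_mult nice_add nice_diff ng nice_const nice_tr mnice_mm mnice_id mnice_const)
    then show "(\<lambda>D. (\<Sum>a<n. \<Sum>b<n. ?K' a b D a b) * ?g D) \<in> borel_measurable \<rho>"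
      by (rule nice_measurable)
    show "AE D in \<rho>. (\<Sum>a<n. \<Sum>b<n. ?K' a b D a b) * ?g D = (2 * (real n - 1) * tr (D \<odot> A) + 2 * tr (D \<odot> tp A)) * ?g D"
      using AE_trace by eventually_elim (simp only: S, simp)
  qed
  ultimately show ?thesis by simp
qed

lemma fro_comm_le: "D \<in> orth_group n \<Longrightarrow> fro (comm A D) \<le> 2 * fro A"
  using fro_diff[of "D \<odot> A" "A \<odot> D"] orthm_orth_group[of D] by (simp add: comm_def)

text \<open>In the constant 8, a factor 2 comes from \<open>|tr (K K)| <= |K|^2\<close> and a factor
  4 from \<open>|K| <= 2 |A|\<close> for the commutator \<open>K\<close>.\<close>

lemma grad_le:
  assumes "D \<in> orth_group n"
  shows "(fro (comm A D))\<^sup>2 - tr (comm A D \<odot> comm A D) \<le> 8 * (fro A)\<^sup>2"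
proof -
  have "(fro (comm A D))\<^sup>2 - tr (comm A D \<odot> comm A D) \<le> 2 * (fro (comm A D))\<^sup>2"
    using abs_tr_mm_le[of "comm A D" "comm A D"] by (simp add: power2_eq_square abs_le_iff)
  also have "(fro (comm A D))\<^sup>2 \<le> (2 * fro A)\<^sup>2"
    using fro_comm_le[OF assms, of A] by (intro power_mono) auto
  finally show ?thesis by (simp add: power_mult_distrib)
qed

text \<open>With \<open>\<phi>\<close> the identity, \<open>first_order_identity\<close> couples
  \<open>W\<close> to \<open>W' = tr (D A^T)\<close>. Adding the instances for \<open>A\<close> and
  \<open>A^T\<close> gives a quadratic form in \<open>W\<close>, \<open>W'\<close> that is bounded
  below by \<open>2 (n - 2)\<close> times the sum of squares.\<close>

lemma second_moment:
  assumes n: "3 \<le> n"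
  shows "(\<integral>D. (tr (D \<odot> A))\<^sup>2 \<partial>\<rho>) + (\<integral>D. (tr (D \<odot> tp A))\<^sup>2 \<partial>\<rho>) \<le> 8 * (fro A)\<^sup>2 / (real n - 2)"
proof -
  have nW [intro]: "nice (\<lambda>D. tr (D \<odot> A))" for A by (intro nice_tr mnice_mm mnice_id mnice_const)
  have nW2 [intro]: "nice (\<lambda>D. (tr (D \<odot> A))\<^sup>2)" for A unfolding power2_eq_square by (intro nice_mult nW)
  have 1: "(\<integral>D. (2 * (real n - 1) * tr (D \<odot> A) + 2 * tr (D \<odot> tp A)) * tr (D \<odot> A) \<partial>\<rho>) \<le> 8 * (fro A)\<^sup>2" for A
  proof -
    have "(\<integral>D. (2 * (real n - 1) * tr (D \<odot> A) + 2 * tr (D \<odot> tp A)) * tr (D \<odot> A) \<partial>\<rho>) =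
      (\<integral>D. ((fro (comm A D))\<^sup>2 - tr (comm A D \<odot> comm A D)) * 1 \<partial>\<rho>)"
      by (rule first_order_identity[where \<phi> = "\<lambda>x. x" and \<phi>' = "\<lambda>_. 1"]) auto
    also have "\<dots> \<le> (\<integral>D. 8 * (fro A)\<^sup>2 \<partial>\<rho>)"
    proof (rule integral_mono_AE)
      have "nice (\<lambda>D. (fro (comm A D))\<^sup>2 - tr (comm A D \<odot> comm A D))"
        by (intro nice_diff nice_fro_sq nice_tr mnice_mm mnice_comm mnice_const)
      then show "integrable \<rho> (\<lambda>D. ((fro (comm A D))\<^sup>2 - tr (comm A D \<odot> comm A D)) * 1)"
        by (simp add: nice_integrable)
      show "AE D in \<rho>. ((fro (comm A D))\<^sup>2 - tr (comm A D \<odot> comm A D)) * 1 \<le> 8 * (fro A)\<^sup>2"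
        using AE_orth by eventually_elim (simp add: grad_le)
    qed simp
    also have "\<dots> = 8 * (fro A)\<^sup>2" by (simp add: prob_space)
    finally show ?thesis .
  qed
  let ?f = "\<lambda>A D. (2 * (real n - 1) * tr (D \<odot> A) + 2 * tr (D \<odot> tp A)) * tr (D \<odot> A)"
  let ?S = "\<lambda>D. (tr (D \<odot> A))\<^sup>2 + (tr (D \<odot> tp A))\<^sup>2"
  have nf: "nice (?f A)" for A by (intro nice_mult nice_add nW nice_const)
  have "2 * (real n - 2) * (\<integral>D. ?S D \<partial>\<rho>) = (\<integral>D. 2 * (real n - 2) * ?S D \<partial>\<rho>)"
    by simp
  also have "\<dots> \<le> (\<integral>D. ?f A D + ?f (tp A) D \<partial>\<rho>)"
  proof (rule integral_mono)
    show "integrable \<rho> (\<lambda>D. 2 * (real n - 2) * ?S D)" "integrable \<rho> (\<lambda>D. ?f A D + ?f (tp A) D)"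
      by (intro nice_integrable nice_mult nice_add nW2 nf nice_const)+
    fix D
    \<comment> \<open>The right-hand side exceeds the left-hand side by exactly twice this
      square.\<close>
    have "0 \<le> (tr (D \<odot> A) + tr (D \<odot> tp A))\<^sup>2" by simp
    then show "2 * (real n - 2) * ?S D \<le> ?f A D + ?f (tp A) D"
      by (simp add: tp_simps power2_eq_square algebra_simps)
  qed
  also have "\<dots> = (\<integral>D. ?f A D \<partial>\<rho>) + (\<integral>D. ?f (tp A) D \<partial>\<rho>)"
    by (intro Bochner_Integration.integral_add nice_integrable nf)
  also have "\<dots> \<le> 16 * (fro A)\<^sup>2"
    using 1[of A] 1[of "tp A"] by simp
  finally have "(real n - 2) * (\<integral>D. ?S D \<partial>\<rho>) \<le> 8 * (fro A)\<^sup>2" by argo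
  moreover have "(\<integral>D. ?S D \<partial>\<rho>) = (\<integral>D. (tr (D \<odot> A))\<^sup>2 \<partial>\<rho>) + (\<integral>D. (tr (D \<odot> tp A))\<^sup>2 \<partial>\<rho>)"
    by (intro Bochner_Integration.integral_add nice_integrable nW2)
  ultimately show ?thesis using n by (simp add: field_simps)
qed

lemma second_moment_single:
  assumes n: "3 \<le> n"
  shows "(\<integral>D. (tr (D \<odot> A))\<^sup>2 \<partial>\<rho>) \<le> 8 * (fro A)\<^sup>2 / (real n - 2)"
    and "(\<integral>D. (tr (tp D \<odot> A))\<^sup>2 \<partial>\<rho>) \<le> 8 * (fro A)\<^sup>2 / (real n - 2)"
proof -
  have p: "0 \<le> (\<integral>D. (tr (D \<odot> A))\<^sup>2 \<partial>\<rho>)" "0 \<le> (\<integral>D. (tr (D \<odot> tp A))\<^sup>2 \<partial>\<rho>)" by simp_all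
  then show "(\<integral>D. (tr (D \<odot> A))\<^sup>2 \<partial>\<rho>) \<le> 8 * (fro A)\<^sup>2 / (real n - 2)"
    using second_moment[OF n, of A] by linarith
  have "tr (tp D \<odot> A) = tr (D \<odot> tp A)" for D
    using tr_simps(3)[of "tp D \<odot> A"] tr_commute[of "tp A" D] by (simp add: tp_simps)
  then show "(\<integral>D. (tr (tp D \<odot> A))\<^sup>2 \<partial>\<rho>) \<le> 8 * (fro A)\<^sup>2 / (real n - 2)"
    using second_moment[OF n, of A] p by (simp only:)
qed

text \<open>Integration by parts against \<open>F = tr (D P E Q)\<close> itself, differentiating only the first factor: all
  remaining terms are \<open>O(r\<^sup>4)\<close> pointwise, except products of linear traces, which are controlled by the
  second moment bound above. Tracelessness of \<open>P\<close> and \<open>Q\<close> removes the terms of higher order. The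
  lemma is needed for \<open>E = D\<close> and \<open>E = D\<^sup>T\<close>.\<close>

lemma quadratic_second_moment:
  fixes E :: "rmat \<Rightarrow> rmat"
  assumes n: "3 \<le> n"
    and E: "mnice E" "\<And>a b. mder a b E (\<lambda>D. rot_gen a b \<odot> E D - E D \<odot> rot_gen a b)"
      "\<And>D. D \<in> orth_group n \<Longrightarrow> orthm (E D)"
    and mom: "\<And>Q. (\<integral>D. (tr (E D \<odot> Q))\<^sup>2 \<partial>\<rho>) \<le> 8 * (fro Q)\<^sup>2 / (real n - 2)"
    and P: "tr P = 0" "fro P \<le> r" and Q: "tr Q = 0" "fro Q \<le> r"
  shows "(\<integral>D. (tr (D \<odot> P \<odot> E D \<odot> Q))\<^sup>2 \<partial>\<rho>) \<le> 19 * r ^ 4 / (real n - 1)"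
proof -
  have r: "0 \<le> r" using fro_nonneg[of P] P(2) by linarith
  define B where "B D = P \<odot> E D \<odot> Q" for D
  define F where "F D = tr (D \<odot> B D)" for D
  \<comment> \<open>The full gradient of \<open>F\<close>: the first commutator comes from the
    explicit factor \<open>D\<close>, the second from the motion of \<open>E D\<close> inside
    \<open>B D\<close>.\<close>
  define H where "H D = D \<odot> B D - B D \<odot> D + (E D \<odot> Q \<odot> D \<odot> P - Q \<odot> D \<odot> P \<odot> E D)" for D
  \<comment> \<open>What the divergence of \<open>comm (B D) D\<close> leaves besides
    \<open>2 (n - 1) F\<close>, apart from terms with a factor \<open>tr P\<close>,
    \<open>tr Q\<close> or \<open>tr D\<close>.\<close>
  define R where "R D = 2 * tr (D \<odot> tp (B D)) + tr (D \<odot> P) * tr (E D \<odot> Q) - tr (D \<odot> P \<odot> tp (E D \<odot> Q))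
     + tr (D \<odot> P \<odot> E D \<odot> tp Q) + tr (P \<odot> tp (E D \<odot> Q \<odot> D))
     + tr (P \<odot> E D) * tr (Q \<odot> D) - tr (P \<odot> E D \<odot> tp (Q \<odot> D))" for D
  define G where "G D = (\<Sum>a<n. \<Sum>b<n. comm (B D) D a b * tr (rot_gen a b \<odot> H D))" for D
  define B' where "B' a b D = P \<odot> (rot_gen a b \<odot> E D - E D \<odot> rot_gen a b) \<odot> Q" for a b D
  define K' where "K' a b D = (rot_gen a b \<odot> D - D \<odot> rot_gen a b) \<odot> B D + D \<odot> B' a b D -
      (B' a b D \<odot> D + B D \<odot> (rot_gen a b \<odot> D - D \<odot> rot_gen a b))" for a b D
  note nices = nice_mult nice_add nice_diff nice_const nice_tr mnice_mm mnice_id mnice_const mnice_tp mnice_diff mnice_add E(1)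
  have nB: "mnice B" unfolding B_def by (intro nices)
  have nB': "mnice (B' a b)" for a b unfolding B'_def by (intro nices)
  have nK': "mnice (K' a b)" for a b unfolding K'_def by (intro nices nB nB')
  have nF: "nice F" unfolding F_def by (intro nices nB)
  have nH: "mnice H" unfolding H_def by (intro nices nB)
  have nR: "nice R" unfolding R_def by (intro nices nB)
  have nG: "nice G" unfolding G_def
    by (intro nice_sum nice_mult mnice_entry[OF mnice_comm[OF nB]] nice_tr mnice_mm mnice_const nH) auto
  have dB: "mder a b B (B' a b)" for a b
    unfolding B_def B'_def
    using mder_mm[OF mder_mm[OF mder_const E(2)] mder_const, of a b P Q] by (simp add: mm_distribs(5,6))
  have dK: "mder a b (\<lambda>D. comm (B D) D) (K' a b)" for a b
    unfolding comm_def K'_def by (intro mder_diff mder_mm mder_id dB)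
  have dF: "sder a b F (\<lambda>D. tr (rot_gen a b \<odot> H D))" for a b
  proof -
    have "tr ((rot_gen a b \<odot> D - D \<odot> rot_gen a b) \<odot> B D + D \<odot> B' a b D) = tr (rot_gen a b \<odot> H D)" for D
      using tr_commute[of D "rot_gen a b \<odot> B D"] tr_commute[of "D \<odot> P" "rot_gen a b \<odot> E D \<odot> Q"]
        tr_commute[of "D \<odot> P \<odot> E D" "rot_gen a b \<odot> Q"]
      by (simp add: B'_def H_def mm_distribs mm_assoc tr_simps)
    then show ?thesis
      unfolding F_def using sder_tr[OF mder_mm[OF mder_id dB], of a b] by simp
  qed
  \<comment> \<open>Each summand of \<open>K'\<close> contains one generator and is contracted by
    the rules above. The terms with \<open>tr P\<close> and \<open>tr Q\<close> drop out here;
    \<open>tr D\<close> stays until \<open>AE_trace\<close> can be used.\<close>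
  have S: "(\<Sum>a<n. \<Sum>b<n. K' a b D a b) = 2 * (real n - 1) * F D + R D - 2 * (tr D * tr (B D))" for D
  proof -
    have "K' a b D = rot_gen a b \<odot> (D \<odot> B D) - D \<odot> rot_gen a b \<odot> B D
        + (D \<odot> P \<odot> rot_gen a b \<odot> (E D \<odot> Q) - D \<odot> P \<odot> E D \<odot> rot_gen a b \<odot> Q)
        - (P \<odot> rot_gen a b \<odot> (E D \<odot> Q \<odot> D) - P \<odot> E D \<odot> rot_gen a b \<odot> (Q \<odot> D))
        - (B D \<odot> rot_gen a b \<odot> D - B D \<odot> D \<odot> rot_gen a b)" for a b
      by (simp add: K'_def B'_def B_def mm_distribs mm_assoc algebra_simps)
    then have "(\<Sum>a<n. \<Sum>b<n. K' a b D a b) = (real n - 1) * tr (D \<odot> B D) - (tr D * tr (B D) - tr (D \<odot> tp (B D)))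
        + ((tr (D \<odot> P) * tr (E D \<odot> Q) - tr (D \<odot> P \<odot> tp (E D \<odot> Q))) - (tr (D \<odot> P \<odot> E D) * tr Q - tr (D \<odot> P \<odot> E D \<odot> tp Q)))
        - ((tr P * tr (E D \<odot> Q \<odot> D) - tr (P \<odot> tp (E D \<odot> Q \<odot> D))) - (tr (P \<odot> E D) * tr (Q \<odot> D) - tr (P \<odot> E D \<odot> tp (Q \<odot> D))))
        - ((tr (B D) * tr D - tr (B D \<odot> tp D)) - (real n - 1) * tr (B D \<odot> D))"
      by (simp only: minus_apply plus_fun_apply sum_subtractf sum.distrib sum_rot_gen_left sum_rot_gen_sandwich sum_rot_gen_right)
    moreover have "tr (B D \<odot> tp D) = tr (D \<odot> tp (B D))"
      using tr_simps(3)[of "B D \<odot> tp D"] by (simp add: tp_simps)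
    ultimately show ?thesis using tr_commute[of "B D" D] by (simp add: F_def R_def P(1) Q(1) algebra_simps)
  qed
  have ibp: "(\<integral>D. (2 * (real n - 1) * F D + R D) * F D + G D \<partial>\<rho>) = 0"
  proof -
    have nS: "nice (\<lambda>D. (\<Sum>a<n. \<Sum>b<n. K' a b D a b) * F D)"
      unfolding S by (intro nices nF nR nB)
    have nT: "nice (\<lambda>D. (2 * (real n - 1) * F D + R D) * F D)"
      by (intro nices nF nR)
    have "(\<integral>D. (\<Sum>a<n. \<Sum>b<n. K' a b D a b) * F D \<partial>\<rho>) = - (\<integral>D. G D \<partial>\<rho>)"
      unfolding G_def
      by (rule integration_by_parts_matrix) (intro conjI mnice_comm nB nF nK' dK dF nice_tr mnice_mm mnice_const nH)+
    moreover have "(\<integral>D. (\<Sum>a<n. \<Sum>b<n. K' a b D a b) * F D \<partial>\<rho>) = (\<integral>D. (2 * (real n - 1) * F D + R D) * F D \<partial>\<rho>)"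
    proof (rule integral_cong_AE)
      show "AE D in \<rho>. (\<Sum>a<n. \<Sum>b<n. K' a b D a b) * F D = (2 * (real n - 1) * F D + R D) * F D"
        using AE_trace by eventually_elim (simp only: S, simp)
    qed (intro nice_measurable nS nT)+
    ultimately show ?thesis
      using Bochner_Integration.integral_add[OF nice_integrable[OF nT] nice_integrable[OF nG]] by linarith
  qed
  let ?q = "\<lambda>D. (tr (D \<odot> P))\<^sup>2 + (tr (E D \<odot> Q))\<^sup>2 + (tr (E D \<odot> P))\<^sup>2 + (tr (D \<odot> Q))\<^sup>2"
  have nq: "nice (\<lambda>D. (tr (D \<odot> P))\<^sup>2)" "nice (\<lambda>D. (tr (D \<odot> Q))\<^sup>2)" "nice (\<lambda>D. (tr (E D \<odot> P))\<^sup>2)" "nice (\<lambda>D. (tr (E D \<odot> Q))\<^sup>2)"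
    unfolding power2_eq_square by (intro nices)+
  have "(\<integral>D. ?q D \<partial>\<rho>) \<le> 4 * (8 * r\<^sup>2)"
  proof -
    have le: "8 * (fro A)\<^sup>2 / (real n - 2) \<le> 8 * r\<^sup>2" if "fro A \<le> r" for A
    proof -
      have "8 * (fro A)\<^sup>2 / (real n - 2) \<le> 8 * (fro A)\<^sup>2 / 1"
        using n by (intro divide_left_mono) auto
      also have "\<dots> \<le> 8 * r\<^sup>2" using that by (simp add: power_mono)
      finally show ?thesis .
    qed
    have "(\<integral>D. ?q D \<partial>\<rho>) = (\<integral>D. (tr (D \<odot> P))\<^sup>2 \<partial>\<rho>) + (\<integral>D. (tr (E D \<odot> Q))\<^sup>2 \<partial>\<rho>) + (\<integral>D. (tr (E D \<odot> P))\<^sup>2 \<partial>\<rho>) + (\<integral>D. (tr (D \<odot> Q))\<^sup>2 \<partial>\<rho>)"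
      using nq by (simp add: nice_integrable)
    also have "\<dots> \<le> 8 * r\<^sup>2 + 8 * r\<^sup>2 + 8 * r\<^sup>2 + 8 * r\<^sup>2"
      by (intro add_mono order_trans[OF second_moment_single(1)[OF n] le] order_trans[OF mom le] P Q)
    finally show ?thesis by simp
  qed
  \<comment> \<open>The constant is 22 = 6 + 16: six traces in \<open>R\<close> of size
    \<open>r^2\<close> (the first has coefficient 2) times \<open>|F| <= r^2\<close>, and
    \<open>|G| <= 2 (2 r^2) (4 r^2)\<close>. The products of linear traces go into \<open>?q\<close>
    by the inequality of arithmetic and geometric means. Since \<open>?q\<close> has mean at most
    \<open>32 r^2\<close>, the total becomes 22 + 16 = 38, twice 19.\<close>
  have ptw: "2 * (real n - 1) * (F D)\<^sup>2 - 22 * r ^ 4 - r\<^sup>2 / 2 * ?q D \<le> (2 * (real n - 1) * F D + R D) * F D + G D"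
    if D: "D \<in> orth_group n" for D
  proof -
    have o [simp]: "orthm D" "orthm (E D)" using D E(3) orthm_orth_group by auto
    have b: "\<bar>tr (Y \<odot> Z)\<bar> \<le> r\<^sup>2" if "fro Y \<le> r" "fro Z \<le> r" for Y Z
    proof -
      have "\<bar>tr (Y \<odot> Z)\<bar> \<le> fro Y * fro Z" by (rule abs_tr_mm_le)
      also have "\<dots> \<le> r * r" using that r by (intro mult_mono) auto
      finally show ?thesis by (simp add: power2_eq_square)
    qed
    have b2: "fro (Y \<odot> Z) \<le> r\<^sup>2" if "fro Y \<le> r" "fro Z \<le> r" for Y Z
    proof -
      have "fro (Y \<odot> Z) \<le> fro Y * fro Z" by (rule fro_mm)
      also have "\<dots> \<le> r * r" using that r by (intro mult_mono) auto
      finally show ?thesis by (simp add: power2_eq_square)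
    qed
    have Fb: "\<bar>F D\<bar> \<le> r\<^sup>2"
      using b[of "D \<odot> P" "E D \<odot> Q"] P Q by (simp add: F_def B_def mm_assoc)
    have t1: "\<bar>tr (D \<odot> tp (B D))\<bar> \<le> r\<^sup>2"
      using b[of "D \<odot> tp Q" "tp (E D) \<odot> tp P"] P Q by (simp add: B_def tp_simps mm_assoc)
    have t2: "\<bar>tr (D \<odot> P \<odot> tp (E D \<odot> Q))\<bar> \<le> r\<^sup>2"
      using P Q by (intro b) simp_all
    have t3: "\<bar>tr (D \<odot> P \<odot> E D \<odot> tp Q)\<bar> \<le> r\<^sup>2"
      using P Q by (intro b) simp_all
    have t4: "\<bar>tr (P \<odot> tp (E D \<odot> Q \<odot> D))\<bar> \<le> r\<^sup>2"
      using P Q by (intro b) simp_all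
    have t5: "\<bar>tr (P \<odot> E D \<odot> tp (Q \<odot> D))\<bar> \<le> r\<^sup>2"
      using P Q by (intro b) simp_all
    have xy: "\<bar>x * y\<bar> \<le> (x\<^sup>2 + y\<^sup>2) / 2" for x y :: real
    proof -
      have "0 \<le> (\<bar>x\<bar> - \<bar>y\<bar>)\<^sup>2" by simp
      then show ?thesis by (simp add: power2_diff abs_mult)
    qed
    have "\<bar>R D\<bar> \<le> 6 * r\<^sup>2 + ?q D / 2"
    proof -
      have "tr (P \<odot> E D) = tr (E D \<odot> P)" "tr (Q \<odot> D) = tr (D \<odot> Q)" by (rule tr_commute)+
      then show ?thesis
        using t1 t2 t3 t4 t5 xy[of "tr (D \<odot> P)" "tr (E D \<odot> Q)"] xy[of "tr (E D \<odot> P)" "tr (D \<odot> Q)"]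
        unfolding R_def by (simp only: abs_le_iff) argo
    qed
    then have RF: "\<bar>R D * F D\<bar> \<le> (6 * r\<^sup>2 + ?q D / 2) * r\<^sup>2"
      unfolding abs_mult using Fb by (intro mult_mono) auto
    have Gb: "\<bar>G D\<bar> \<le> 16 * r ^ 4"
    proof -
      have fB: "fro (B D) \<le> r\<^sup>2"
        unfolding B_def using P Q by (intro b2) simp_all
      have "fro (comm (B D) D) \<le> 2 * r\<^sup>2"
        using fro_comm_le[OF D, of "B D"] fB by simp
      moreover have "fro (H D) \<le> 4 * r\<^sup>2"
      proof -
        have "fro (E D \<odot> Q \<odot> D \<odot> P) \<le> r\<^sup>2" using P Q by (intro b2) simp_all
        moreover have "fro (Q \<odot> D \<odot> P \<odot> E D) \<le> r\<^sup>2" using b2[of "Q \<odot> D" P] P Q by simp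
        moreover have "fro (D \<odot> B D) \<le> r\<^sup>2" "fro (B D \<odot> D) \<le> r\<^sup>2" using fB by simp_all
        ultimately show ?thesis
          unfolding H_def
          using fro_add[of "D \<odot> B D - B D \<odot> D" "E D \<odot> Q \<odot> D \<odot> P - Q \<odot> D \<odot> P \<odot> E D"]
            fro_diff[of "D \<odot> B D" "B D \<odot> D"] fro_diff[of "E D \<odot> Q \<odot> D \<odot> P" "Q \<odot> D \<odot> P \<odot> E D"]
          by linarith
      qed
      ultimately have "fro (comm (B D) D) * fro (H D) \<le> (2 * r\<^sup>2) * (4 * r\<^sup>2)"
        by (intro mult_mono) auto
      then show ?thesis
        using abs_sum_mult_tr_rot_gen[of "comm (B D) D" "H D"] unfolding G_def
        by (simp add: power4_eq_xxxx power2_eq_square mult_ac)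
    qed
    have "(6 * r\<^sup>2 + ?q D / 2) * r\<^sup>2 = 6 * r ^ 4 + r\<^sup>2 / 2 * ?q D"
      by (simp add: power4_eq_xxxx power2_eq_square algebra_simps add_divide_distrib)
    moreover have "(2 * (real n - 1) * F D + R D) * F D + G D = 2 * (real n - 1) * (F D)\<^sup>2 + R D * F D + G D"
      by (simp add: power2_eq_square algebra_simps)
    ultimately show ?thesis using RF Gb by linarith
  qed
  have nF2: "nice (\<lambda>D. (F D)\<^sup>2)" unfolding power2_eq_square by (intro nices nF)
  have nq': "nice ?q" by (intro nice_add nq)
  have "2 * (real n - 1) * (\<integral>D. (F D)\<^sup>2 \<partial>\<rho>) - 22 * r ^ 4 - r\<^sup>2 / 2 * (\<integral>D. ?q D \<partial>\<rho>) =
    (\<integral>D. 2 * (real n - 1) * (F D)\<^sup>2 - 22 * r ^ 4 - r\<^sup>2 / 2 * ?q D \<partial>\<rho>)"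
    using nice_integrable[OF nF2] nice_integrable[OF nq'] by (simp add: prob_space)
  also have "\<dots> \<le> (\<integral>D. (2 * (real n - 1) * F D + R D) * F D + G D \<partial>\<rho>)"
  proof (rule integral_mono_AE)
    show "AE D in \<rho>. 2 * (real n - 1) * (F D)\<^sup>2 - 22 * r ^ 4 - r\<^sup>2 / 2 * ?q D \<le> (2 * (real n - 1) * F D + R D) * F D + G D"
      using AE_orth by eventually_elim (rule ptw)
  qed (intro nice_integrable nices nF nF2 nR nG nq')+
  also have "\<dots> = 0" by (rule ibp)
  finally have "2 * (real n - 1) * (\<integral>D. (F D)\<^sup>2 \<partial>\<rho>) \<le> 22 * r ^ 4 + r\<^sup>2 / 2 * (\<integral>D. ?q D \<partial>\<rho>)" by simp
  also have "\<dots> \<le> 22 * r ^ 4 + r\<^sup>2 / 2 * (4 * (8 * r\<^sup>2))"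
    using \<open>(\<integral>D. ?q D \<partial>\<rho>) \<le> 4 * (8 * r\<^sup>2)\<close> by (intro add_mono mult_left_mono) auto
  also have "\<dots> = 38 * r ^ 4" by (simp add: power4_eq_xxxx power2_eq_square)
  finally have "(\<integral>D. (F D)\<^sup>2 \<partial>\<rho>) \<le> 19 * r ^ 4 / (real n - 1)"
    using n by (simp add: field_simps)
  then show ?thesis by (simp add: F_def B_def mm_assoc)
qed

end

section \<open>The characteristic function\<close>

text \<open>The integrating factor \<open>exp (\<sigma> u^2 / 2)\<close> turns the defect of the
  equation into the derivative of \<open>z\<close>. It is largest at the end \<open>t\<close> of the
  interval, where it cancels when the factor is removed again.\<close>

lemma damped_ode_bound:
  fixes y y' :: "real \<Rightarrow> real"
  assumes \<sigma>: "0 \<le> \<sigma>" and der: "\<And>u. (y has_real_derivative y' u) (at u)"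
    and bnd: "\<And>u. \<bar>u\<bar> \<le> \<bar>t\<bar> \<Longrightarrow> \<bar>y' u + \<sigma> * u * y u\<bar> \<le> \<delta>"
  shows "\<bar>y t - y 0 * exp (- \<sigma> * t\<^sup>2 / 2)\<bar> \<le> \<bar>t\<bar> * \<delta>"
proof -
  define z where "z u = y u * exp (\<sigma> * u\<^sup>2 / 2)" for u
  define z' where "z' u = (y' u + \<sigma> * u * y u) * exp (\<sigma> * u\<^sup>2 / 2)" for u
  have dz: "(z has_real_derivative z' u) (at u)" for u
    unfolding z_def z'_def by (auto intro!: derivative_eq_intros der simp: algebra_simps)
  have \<delta>: "0 \<le> \<delta>" using bnd[of 0] by auto
  let ?S = "{-\<bar>t\<bar>..\<bar>t\<bar>}"
  have "norm (z t - z 0) \<le> (\<delta> * exp (\<sigma> * t\<^sup>2 / 2)) * norm (t - 0)"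
  proof (rule field_differentiable_bound[of ?S z z'])
    show "(z has_field_derivative z' u) (at u within ?S)" for u
      using dz by (rule has_field_derivative_at_within)
    show "norm (z' u) \<le> \<delta> * exp (\<sigma> * t\<^sup>2 / 2)" if "u \<in> ?S" for u
    proof -
      have u: "\<bar>u\<bar> \<le> \<bar>t\<bar>" using that by auto
      then have "u\<^sup>2 \<le> t\<^sup>2" by (simp add: abs_le_square_iff)
      then have "\<sigma> * u\<^sup>2 / 2 \<le> \<sigma> * t\<^sup>2 / 2" using \<sigma> by (simp add: mult_left_mono)
      then show ?thesis
        using bnd[OF u] \<delta> unfolding z'_def norm_mult by (intro mult_mono) auto
    qed
  qed auto
  then have le: "\<bar>z t - z 0\<bar> * exp (- \<sigma> * t\<^sup>2 / 2) \<le> (\<delta> * exp (\<sigma> * t\<^sup>2 / 2) * \<bar>t\<bar>) * exp (- \<sigma> * t\<^sup>2 / 2)"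
    by (intro mult_right_mono) auto
  have one: "exp (\<sigma> * t\<^sup>2 / 2) * exp (- \<sigma> * t\<^sup>2 / 2) = 1"
    by (simp flip: exp_add)
  have "(\<delta> * exp (\<sigma> * t\<^sup>2 / 2) * \<bar>t\<bar>) * exp (- \<sigma> * t\<^sup>2 / 2) = \<bar>t\<bar> * \<delta> * (exp (\<sigma> * t\<^sup>2 / 2) * exp (- \<sigma> * t\<^sup>2 / 2))"
    by (simp only: mult_ac)
  moreover have "(z t - z 0) * exp (- \<sigma> * t\<^sup>2 / 2) = y t * (exp (\<sigma> * t\<^sup>2 / 2) * exp (- \<sigma> * t\<^sup>2 / 2)) - y 0 * exp (- \<sigma> * t\<^sup>2 / 2)"
    by (simp add: z_def left_diff_distrib mult.assoc)
  ultimately show ?thesis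
    using le abs_mult[of "z t - z 0" "exp (- \<sigma> * t\<^sup>2 / 2)"] by (simp only: one abs_exp_cancel mult_1_right)
qed

text \<open>A linearised Cauchy-Schwarz inequality, from expanding the square of
  \<open>|f x| - c\<close>; it is sharp when \<open>c\<close> is the actual size of
  \<open>f\<close>.\<close>

lemma (in prob_space) expectation_abs_le:
  fixes f :: "'a \<Rightarrow> real"
  assumes "integrable M f" "integrable M (\<lambda>x. (f x)\<^sup>2)" "0 < c"
  shows "expectation (\<lambda>x. \<bar>f x\<bar>) \<le> (expectation (\<lambda>x. (f x)\<^sup>2) / c + c) / 2"
proof -
  have "expectation (\<lambda>x. \<bar>f x\<bar>) \<le> expectation (\<lambda>x. ((f x)\<^sup>2 / c + c) / 2)"
  proof (rule integral_mono)
    fix x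
    have "0 \<le> (\<bar>f x\<bar> - c)\<^sup>2" by simp
    then show "\<bar>f x\<bar> \<le> ((f x)\<^sup>2 / c + c) / 2"
      using assms(3) by (simp add: power2_diff field_simps power2_eq_square)
  qed (use assms in auto)
  also have "\<dots> = (expectation (\<lambda>x. (f x)\<^sup>2) / c + c) / 2"
    using assms by (simp add: prob_space)
  finally show ?thesis .
qed

lemma (in mat_dim) mtrace_mmul: "mtrace n (mmul n A B) = tr (A \<odot> B)"
  by (simp add: mtrace_def mmul_apply mm_def)

section \<open>Concentration of the squared gradient and the approximate Stein identity\<close>

context conj_inv
begin

text \<open>Squaring commutes with conjugation by \<open>Q\<close>, and the trace condition for the
  new law is the hypothesis.\<close>

lemma conj_inv_square:
  assumes "AE D in \<rho>. tr (D \<odot> D) = 0"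
  shows "conj_inv n (distr \<rho> (mat_space n) (\<lambda>D. mmul n D D))"
proof -
  have m: "(\<lambda>D. mmul n D D) \<in> measurable \<rho> (mat_space n)"
    by (intro measurable_mmul measurable_ident_sets sets_rho)
  interpret S: prob_space "distr \<rho> (mat_space n) (\<lambda>D. mmul n D D)"
    by (rule prob_space_distr[OF m])
  show ?thesis
  proof
    show "sets (distr \<rho> (mat_space n) (\<lambda>D. mmul n D D)) = sets (mat_space n)" by simp
    have "{x \<in> space (mat_space n). x \<in> orth_group n} = orth_group n" by (auto simp: orth_group_def)
    then show "AE D in distr \<rho> (mat_space n) (\<lambda>D. mmul n D D). D \<in> orth_group n"
      using AE_orth sets_orth_group[of n]
      by (subst AE_distr_iff[OF m]) (auto elim!: eventually_mono intro: orth_group_mmul)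
    have "nice (\<lambda>D. tr D)" by (intro nice_tr mnice_id)
    then have "mtrace n \<in> borel_measurable (mat_space n)" by (simp add: nice_def)
    then have "{x \<in> space (mat_space n). mtrace n x = 0} \<in> sets (mat_space n)"
      by (intro borel_measurable_eq) auto
    then show "AE D in distr \<rho> (mat_space n) (\<lambda>D. mmul n D D). mtrace n D = 0"
      using assms by (subst AE_distr_iff[OF m]) (auto simp: mtrace_mmul)
    fix Q assume Q: "Q \<in> orth_group n"
    have mQ: "(\<lambda>D. mmul n Q (mmul n D (mtrans n Q))) \<in> measurable (mat_space n) (mat_space n)"
      using Q by (intro measurable_mmul measurable_mtrans measurable_const measurable_ident_sets) (auto intro: orth_group_space)
    have mQ': "(\<lambda>D. mmul n Q (mmul n D (mtrans n Q))) \<in> measurable \<rho> (mat_space n)"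
      using mQ by (simp add: measurable_cong_sets[OF sets_rho refl])
    have m': "(\<lambda>D. mmul n D D) \<in> measurable (mat_space n) (mat_space n)"
      by (intro measurable_mmul measurable_ident_sets) auto
    have eq: "mmul n Q (mmul n (mmul n D D) (mtrans n Q)) =
      mmul n (mmul n Q (mmul n D (mtrans n Q))) (mmul n Q (mmul n D (mtrans n Q)))" for D
    proof -
      have "mmul n (mmul n Q (mmul n D (mtrans n Q))) (mmul n Q (mmul n D (mtrans n Q))) =
        mmul n Q (mmul n D (mmul n (mmul n (mtrans n Q) Q) (mmul n D (mtrans n Q))))"
        by (simp add: mmul_assoc)
      also have "\<dots> = mmul n Q (mmul n (mmul n D D) (mtrans n Q))"
        using Q by (simp add: orth_group_mtrans_mult mmul_mid_left mmul_assoc)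
      finally show ?thesis by simp
    qed
    have "distr (distr \<rho> (mat_space n) (\<lambda>D. mmul n D D)) (mat_space n) (\<lambda>D. mmul n Q (mmul n D (mtrans n Q))) =
      distr (distr \<rho> (mat_space n) (\<lambda>D. mmul n Q (mmul n D (mtrans n Q)))) (mat_space n) (\<lambda>D. mmul n D D)"
      by (simp add: distr_distr[OF mQ m] distr_distr[OF m' mQ'] comp_def eq)
    then show "distr (distr \<rho> (mat_space n) (\<lambda>D. mmul n D D)) (mat_space n) (\<lambda>D. mmul n Q (mmul n D (mtrans n Q))) =
       distr \<rho> (mat_space n) (\<lambda>D. mmul n D D)"
      by (simp add: conj_invariant[OF Q])
  qed
qed

text \<open>The linear bound in the locale of the squared matrix. It puts no trace condition on
  \<open>B\<close>, so \<open>B = A A\<close> is admissible for the last trace of the squared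
  gradient.\<close>

lemma square_second_moment:
  assumes n: "3 \<le> n" and "AE D in \<rho>. tr (D \<odot> D) = 0"
  shows "(\<integral>D. (tr (D \<odot> D \<odot> B))\<^sup>2 \<partial>\<rho>) \<le> 8 * (fro B)\<^sup>2 / (real n - 2)"
proof -
  interpret S: conj_inv n "distr \<rho> (mat_space n) (\<lambda>D. mmul n D D)"
    by (rule conj_inv_square) fact
  have m: "(\<lambda>D. mmul n D D) \<in> measurable \<rho> (mat_space n)"
    by (intro measurable_mmul measurable_ident_sets sets_rho)
  have "nice (\<lambda>D. (tr (D \<odot> B))\<^sup>2)" unfolding power2_eq_square by (intro nice_mult nice_tr mnice_mm mnice_id mnice_const)
  then have "(\<lambda>D. (tr (D \<odot> B))\<^sup>2) \<in> borel_measurable (mat_space n)" by (simp add: nice_def)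
  then have "(\<integral>D. (tr (D \<odot> B))\<^sup>2 \<partial>distr \<rho> (mat_space n) (\<lambda>D. mmul n D D)) = (\<integral>D. (tr (mmul n D D \<odot> B))\<^sup>2 \<partial>\<rho>)"
    by (rule integral_distr[OF m])
  also have "(\<lambda>D. tr (mmul n D D \<odot> B)) = (\<lambda>D. tr (D \<odot> D \<odot> B))"
    by (simp add: mtrace_def mm_def mmul_apply fun_eq_iff)
  finally show ?thesis using S.second_moment_single(1)[OF n, of B] by simp
qed

text \<open>\<open>D A\<close> and \<open>A D\<close> both have the norm of \<open>A\<close>, which
  isolates the deterministic part; the cyclic rule brings the remaining products to the three
  traces.\<close>

lemma grad_expand:
  assumes "D \<in> orth_group n"
  shows "(fro (comm A D))\<^sup>2 - tr (comm A D \<odot> comm A D) =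
    2 * (fro A)\<^sup>2 - 2 * tr (D \<odot> A \<odot> tp D \<odot> tp A) - 2 * tr (D \<odot> A \<odot> D \<odot> A) + 2 * tr (D \<odot> D \<odot> (A \<odot> A))"
proof -
  have o: "orthm D" by (rule orthm_orth_group) fact
  have 1: "tr (D \<odot> A \<odot> tp (D \<odot> A)) = (fro A)\<^sup>2" "tr (A \<odot> D \<odot> tp (A \<odot> D)) = (fro A)\<^sup>2"
    using o by (simp_all flip: fro_sq_tr)
  have 2: "tr (D \<odot> A \<odot> tp (A \<odot> D)) = tr (D \<odot> A \<odot> tp D \<odot> tp A)"
    by (simp add: tp_simps mm_assoc)
  have 3: "tr (A \<odot> D \<odot> tp (D \<odot> A)) = tr (D \<odot> A \<odot> tp D \<odot> tp A)"
    using tr_simps(3)[of "A \<odot> D \<odot> tp (D \<odot> A)"] by (simp add: tp_simps mm_assoc)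
  have 4: "tr (D \<odot> A \<odot> (A \<odot> D)) = tr (D \<odot> D \<odot> (A \<odot> A))"
    using tr_commute[of "D \<odot> A \<odot> A" D] by (simp add: mm_assoc)
  have 5: "tr (A \<odot> D \<odot> (D \<odot> A)) = tr (D \<odot> D \<odot> (A \<odot> A))"
    using tr_commute[of A "D \<odot> D \<odot> A"] by (simp add: mm_assoc)
  have 6: "tr (A \<odot> D \<odot> (A \<odot> D)) = tr (D \<odot> A \<odot> D \<odot> A)"
    using tr_commute[of A "D \<odot> A \<odot> D"] by (simp add: mm_assoc)
  have 7: "tr (D \<odot> A \<odot> (D \<odot> A)) = tr (D \<odot> A \<odot> D \<odot> A)"
    by (simp add: mm_assoc)
  show ?thesis
    unfolding fro_sq_tr comm_def tp_simps(4) mm_distribs tr_simps 1 2 3 4 5 6 7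
    using 1 by (simp add: fro_sq_tr)
qed

text \<open>Each trace has mean square O(n), so its mean absolute value is of order
  \<open>sqrt n\<close>, small against the \<open>n - 1\<close> by which it is divided
  later.\<close>

lemma grad_concentration:
  assumes n: "3 \<le> n" and AE2: "AE D in \<rho>. tr (D \<odot> D) = 0"
    and A: "tr A = 0" "(fro A)\<^sup>2 \<le> real n"
  shows "(\<integral>D. \<bar>(fro (comm A D))\<^sup>2 - tr (comm A D \<odot> comm A D) - 2 * (fro A)\<^sup>2\<bar> \<partial>\<rho>) \<le> 120 * sqrt (real n)"
proof -
  let ?F1 = "\<lambda>D. tr (D \<odot> A \<odot> tp D \<odot> tp A)" and ?F2 = "\<lambda>D. tr (D \<odot> A \<odot> D \<odot> A)"
    and ?F3 = "\<lambda>D. tr (D \<odot> D \<odot> (A \<odot> A))"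
  have s: "0 < sqrt (real n)" "sqrt (real n) * sqrt (real n) = real n" using n by auto
  have fA: "fro A \<le> sqrt (real n)" using A(2) by (simp add: real_le_rsqrt)
  have nF: "nice ?F1" "nice ?F2" "nice ?F3"
    by (intro nice_tr mnice_mm mnice_id mnice_const mnice_tp)+
  have sq: "nice (\<lambda>D. (f D)\<^sup>2)" if "nice f" for f
    unfolding power2_eq_square using that by (intro nice_mult)
  have abs: "nice (\<lambda>D. \<bar>f D\<bar>)" if "nice f" for f
    by (rule nice_compose[OF _ that]) (intro continuous_intros)
  have n2: "real n / (real n - 1) \<le> 2" "real n / (real n - 2) \<le> 3" using n by (auto simp: field_simps)
  \<comment> \<open>The true value is 38 \<open>n\<close>, as \<open>n / (n - 1) <= 2\<close>; 39 is
    chosen because 39 + 1 is even in the next estimate of the absolute value.\<close>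
  have q: "19 * sqrt (real n) ^ 4 / (real n - 1) \<le> 39 * real n"
  proof -
    have "sqrt (real n) ^ 4 = real n * real n" using s by (simp add: power4_eq_xxxx mult.assoc)
    then have "19 * sqrt (real n) ^ 4 / (real n - 1) = 19 * real n * (real n / (real n - 1))" by simp
    also have "\<dots> \<le> 19 * real n * 2" using n2 by (intro mult_left_mono) auto
    finally show ?thesis by simp
  qed
  have m1: "(\<integral>D. (?F1 D)\<^sup>2 \<partial>\<rho>) \<le> 39 * real n"
    by (rule order_trans[OF quadratic_second_moment[where E = tp, OF n _ mder_tp_id _ second_moment_single(2)[OF n]] q])
       (use A fA in \<open>auto simp: tr_simps orthm_orth_group\<close>)
  have m2: "(\<integral>D. (?F2 D)\<^sup>2 \<partial>\<rho>) \<le> 39 * real n"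
    by (rule order_trans[OF quadratic_second_moment[where E = "\<lambda>D. D", OF n _ mder_id _ second_moment_single(1)[OF n]] q])
       (use A fA in \<open>auto simp: orthm_orth_group\<close>)
  have m3: "(\<integral>D. (?F3 D)\<^sup>2 \<partial>\<rho>) \<le> 39 * real n"
  proof -
    have "fro (A \<odot> A) \<le> fro A * fro A" by (rule fro_mm)
    also have "\<dots> \<le> real n" using A(2) by (simp add: power2_eq_square)
    finally have "(fro (A \<odot> A))\<^sup>2 \<le> (real n)\<^sup>2" by (intro power_mono) auto
    then have "8 * (fro (A \<odot> A))\<^sup>2 / (real n - 2) \<le> 8 * (real n)\<^sup>2 / (real n - 2)"
      using n by (intro divide_right_mono) auto
    also have "\<dots> = 8 * real n * (real n / (real n - 2))" by (simp add: power2_eq_square)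
    also have "\<dots> \<le> 8 * real n * 3" using n2 by (intro mult_left_mono) auto
    also have "\<dots> \<le> 39 * real n" by simp
    finally show ?thesis using square_second_moment[OF n AE2, of "A \<odot> A"] by linarith
  qed
  \<comment> \<open>With \<open>c = sqrt n\<close> the bound is \<open>(39 + 1) / 2 = 20\<close>
    times \<open>sqrt n\<close>. Three traces with coefficient 2 then give 120.\<close>
  have e: "(\<integral>D. \<bar>f D\<bar> \<partial>\<rho>) \<le> 20 * sqrt (real n)" if "nice f" "(\<integral>D. (f D)\<^sup>2 \<partial>\<rho>) \<le> 39 * real n" for f
  proof -
    have "(\<integral>D. \<bar>f D\<bar> \<partial>\<rho>) \<le> ((\<integral>D. (f D)\<^sup>2 \<partial>\<rho>) / sqrt (real n) + sqrt (real n)) / 2"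
      using that s by (intro expectation_abs_le nice_integrable sq)
    also have "\<dots> \<le> (39 * real n / sqrt (real n) + sqrt (real n)) / 2"
      using that s by (intro divide_right_mono add_right_mono) auto
    also have "39 * real n / sqrt (real n) = 39 * sqrt (real n)"
      using s by (simp add: field_simps)
    finally show ?thesis by simp
  qed
  have "(\<integral>D. \<bar>(fro (comm A D))\<^sup>2 - tr (comm A D \<odot> comm A D) - 2 * (fro A)\<^sup>2\<bar> \<partial>\<rho>) \<le>
    (\<integral>D. 2 * \<bar>?F1 D\<bar> + 2 * \<bar>?F2 D\<bar> + 2 * \<bar>?F3 D\<bar> \<partial>\<rho>)"
  proof (rule integral_mono_AE)
    show "AE D in \<rho>. \<bar>(fro (comm A D))\<^sup>2 - tr (comm A D \<odot> comm A D) - 2 * (fro A)\<^sup>2\<bar> \<le> 2 * \<bar>?F1 D\<bar> + 2 * \<bar>?F2 D\<bar> + 2 * \<bar>?F3 D\<bar>"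
      using AE_orth by eventually_elim (simp add: grad_expand)
  qed (intro nice_integrable abs nice_add nice_mult nice_diff nice_const nice_fro_sq nice_tr mnice_mm mnice_id mnice_comm mnice_const mnice_tp)+
  also have "\<dots> = 2 * (\<integral>D. \<bar>?F1 D\<bar> \<partial>\<rho>) + 2 * (\<integral>D. \<bar>?F2 D\<bar> \<partial>\<rho>) + 2 * (\<integral>D. \<bar>?F3 D\<bar> \<partial>\<rho>)"
    using nF by (simp add: nice_integrable)
  also have "\<dots> \<le> 120 * sqrt (real n)"
    using e[OF nF(1) m1] e[OF nF(2) m2] e[OF nF(3) m3] by linarith
  finally show ?thesis .
qed

text \<open>\<open>first_order_identity\<close> divided by \<open>2 (n - 1)\<close>. Replacing the
  squared gradient by \<open>2 |A|^2\<close> costs \<open>120 T sqrt n\<close>, and discarding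
  \<open>2 W'\<close> costs 26, both before the division.\<close>

lemma approx_stein_identity:
  assumes n: "3 \<le> n" and AE2: "AE D in \<rho>. tr (D \<odot> D) = 0"
    and A: "tr A = 0" "(fro A)\<^sup>2 \<le> real n"
    and d: "\<And>x. (\<phi> has_real_derivative \<phi>' x) (at x)" and c: "continuous_on UNIV \<phi>'"
    and b: "\<And>x. \<bar>\<phi> x\<bar> \<le> 1" "\<And>x. \<bar>\<phi>' x\<bar> \<le> T"
  shows "\<bar>(\<integral>D. tr (D \<odot> A) * \<phi> (tr (D \<odot> A)) \<partial>\<rho>) - (fro A)\<^sup>2 / (real n - 1) * (\<integral>D. \<phi>' (tr (D \<odot> A)) \<partial>\<rho>)\<bar>
    \<le> (60 * T * sqrt (real n) + 13) / (real n - 1)"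
proof -
  let ?W = "\<lambda>D. tr (D \<odot> A)" and ?W' = "\<lambda>D. tr (D \<odot> tp A)"
    and ?\<Gamma> = "\<lambda>D. (fro (comm A D))\<^sup>2 - tr (comm A D \<odot> comm A D)"
  have c': "continuous_on UNIV \<phi>"
    using d by (intro DERIV_continuous_on[of _ _ \<phi>']) (auto intro: has_field_derivative_at_within)
  have nW: "nice ?W" and nW': "nice ?W'" by (intro nice_tr mnice_mm mnice_id mnice_const)+
  have n\<phi>: "nice (\<lambda>D. \<phi> (?W D))" and n\<phi>': "nice (\<lambda>D. \<phi>' (?W D))"
    by (rule nice_compose[OF c' nW], rule nice_compose[OF c nW])
  have n\<Gamma>: "nice ?\<Gamma>" by (intro nice_diff nice_fro_sq nice_tr mnice_mm mnice_comm mnice_const)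
  have abs: "nice (\<lambda>D. \<bar>f D\<bar>)" if "nice f" for f
    by (rule nice_compose[OF _ that]) (intro continuous_intros)
  have T: "0 \<le> T" using b(2)[of 0] by linarith
  \<comment> \<open>The second moment is at most 24, since \<open>n / (n - 2) <= 3\<close>; hence
    \<open>(24 + 1) / 2\<close>, rounded up to 13.\<close>
  have W': "(\<integral>D. \<bar>?W' D\<bar> \<partial>\<rho>) \<le> 13"
  proof -
    have "(\<integral>D. (?W' D)\<^sup>2 \<partial>\<rho>) \<le> 8 * (fro (tp A))\<^sup>2 / (real n - 2)" by (rule second_moment_single(1)[OF n])
    also have "\<dots> \<le> 8 * real n / (real n - 2)" using A n by (intro divide_right_mono) auto
    also have "\<dots> \<le> 24" using n by (simp add: field_simps)
    finally have "(\<integral>D. (?W' D)\<^sup>2 \<partial>\<rho>) \<le> 24" .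
    moreover have "(\<integral>D. \<bar>?W' D\<bar> \<partial>\<rho>) \<le> ((\<integral>D. (?W' D)\<^sup>2 \<partial>\<rho>) / 1 + 1) / 2"
      using nW' nice_mult[OF nW' nW'] by (intro expectation_abs_le nice_integrable) (auto simp: power2_eq_square)
    ultimately show ?thesis by simp
  qed
  have "2 * (real n - 1) * (\<integral>D. ?W D * \<phi> (?W D) \<partial>\<rho>) + 2 * (\<integral>D. ?W' D * \<phi> (?W D) \<partial>\<rho>) =
    (\<integral>D. (2 * (real n - 1)) * (?W D * \<phi> (?W D)) + 2 * (?W' D * \<phi> (?W D)) \<partial>\<rho>)"
    using nice_mult[OF nW n\<phi>] nice_mult[OF nW' n\<phi>]
    by (subst Bochner_Integration.integral_add) (auto intro!: nice_integrable nice_mult nW nW' n\<phi>)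
  also have "\<dots> = (\<integral>D. (2 * (real n - 1) * ?W D + 2 * ?W' D) * \<phi> (?W D) \<partial>\<rho>)"
    by (intro Bochner_Integration.integral_cong refl) (simp add: algebra_simps)
  also have "\<dots> = (\<integral>D. ?\<Gamma> D * \<phi>' (?W D) \<partial>\<rho>)"
    by (rule first_order_identity[OF d c])
  also have "\<dots> = (\<integral>D. (?\<Gamma> D - 2 * (fro A)\<^sup>2) * \<phi>' (?W D) + 2 * (fro A)\<^sup>2 * \<phi>' (?W D) \<partial>\<rho>)"
    by (intro Bochner_Integration.integral_cong refl) (simp add: algebra_simps)
  also have "\<dots> = (\<integral>D. (?\<Gamma> D - 2 * (fro A)\<^sup>2) * \<phi>' (?W D) \<partial>\<rho>) + 2 * (fro A)\<^sup>2 * (\<integral>D. \<phi>' (?W D) \<partial>\<rho>)"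
    by (subst Bochner_Integration.integral_add) (auto intro!: nice_integrable nice_mult nice_diff n\<Gamma> n\<phi>')
  finally have eq: "2 * (real n - 1) * (\<integral>D. ?W D * \<phi> (?W D) \<partial>\<rho>) - 2 * (fro A)\<^sup>2 * (\<integral>D. \<phi>' (?W D) \<partial>\<rho>) =
     (\<integral>D. (?\<Gamma> D - 2 * (fro A)\<^sup>2) * \<phi>' (?W D) \<partial>\<rho>) - 2 * (\<integral>D. ?W' D * \<phi> (?W D) \<partial>\<rho>)" by linarith
  have "\<bar>\<integral>D. (?\<Gamma> D - 2 * (fro A)\<^sup>2) * \<phi>' (?W D) \<partial>\<rho>\<bar> \<le> (\<integral>D. \<bar>?\<Gamma> D - 2 * (fro A)\<^sup>2\<bar> * T \<partial>\<rho>)"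
  proof (rule order_trans[OF integral_abs_bound integral_mono])
    fix D show "\<bar>(?\<Gamma> D - 2 * (fro A)\<^sup>2) * \<phi>' (?W D)\<bar> \<le> \<bar>?\<Gamma> D - 2 * (fro A)\<^sup>2\<bar> * T"
      unfolding abs_mult using b(2) by (intro mult_left_mono) auto
  qed (intro nice_integrable abs nice_mult nice_diff n\<Gamma> n\<phi>' nice_const)+
  also have "\<dots> = (\<integral>D. \<bar>?\<Gamma> D - 2 * (fro A)\<^sup>2\<bar> \<partial>\<rho>) * T" by simp
  also have "\<dots> \<le> 120 * sqrt (real n) * T"
    using grad_concentration[OF n AE2 A] T by (intro mult_right_mono)
  finally have 1: "\<bar>\<integral>D. (?\<Gamma> D - 2 * (fro A)\<^sup>2) * \<phi>' (?W D) \<partial>\<rho>\<bar> \<le> 120 * sqrt (real n) * T" .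
  have "\<bar>\<integral>D. ?W' D * \<phi> (?W D) \<partial>\<rho>\<bar> \<le> (\<integral>D. \<bar>?W' D\<bar> \<partial>\<rho>)"
  proof (rule order_trans[OF integral_abs_bound integral_mono])
    fix D show "\<bar>?W' D * \<phi> (?W D)\<bar> \<le> \<bar>?W' D\<bar>"
      unfolding abs_mult using b(1) by (intro mult_left_le) auto
  qed (intro nice_integrable abs nice_mult nW' n\<phi>)+
  with W' have 2: "\<bar>\<integral>D. ?W' D * \<phi> (?W D) \<partial>\<rho>\<bar> \<le> 13" by linarith
  have "(\<integral>D. ?W D * \<phi> (?W D) \<partial>\<rho>) - (fro A)\<^sup>2 / (real n - 1) * (\<integral>D. \<phi>' (?W D) \<partial>\<rho>) =
    (2 * (real n - 1) * (\<integral>D. ?W D * \<phi> (?W D) \<partial>\<rho>) - 2 * (fro A)\<^sup>2 * (\<integral>D. \<phi>' (?W D) \<partial>\<rho>)) / (2 * (real n - 1))"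
    using n by (simp add: field_simps)
  also have "\<bar>\<dots>\<bar> \<le> (120 * sqrt (real n) * T + 26) / (2 * (real n - 1))"
    unfolding eq abs_divide using 1 2 n by (intro frac_le) auto
  also have "\<dots> = (60 * T * sqrt (real n) + 13) / (real n - 1)"
    using n by (simp add: field_simps)
  finally show ?thesis .
qed

text \<open>Real and imaginary part of the characteristic function solve the same perturbed
  equation; only their values 1 and 0 at the origin differ. The derivative of the cosine mean calls
  for the Stein identity with the sine, and conversely.\<close>

lemma cos_sin_bounds:
  assumes n: "3 \<le> n" and AE2: "AE D in \<rho>. tr (D \<odot> D) = 0"
    and A: "tr A = 0" "(fro A)\<^sup>2 \<le> real n"
  defines "\<sigma> \<equiv> (fro A)\<^sup>2 / (real n - 1)"
  defines "\<delta> \<equiv> \<lambda>t. (60 * \<bar>t\<bar> * sqrt (real n) + 13) / (real n - 1)"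
  shows "\<bar>(\<integral>D. cos (t * tr (D \<odot> A)) \<partial>\<rho>) - exp (- \<sigma> * t\<^sup>2 / 2)\<bar> \<le> \<bar>t\<bar> * \<delta> t"
    and "\<bar>\<integral>D. sin (t * tr (D \<odot> A)) \<partial>\<rho>\<bar> \<le> \<bar>t\<bar> * \<delta> t"
proof -
  let ?W = "\<lambda>D. tr (D \<odot> A)"
  have nW: "nice ?W" by (intro nice_tr mnice_mm mnice_id mnice_const)
  then obtain K where K: "\<And>D. D \<in> orth_group n \<Longrightarrow> \<bar>?W D\<bar> \<le> K" by (auto simp: nice_def)
  have \<sigma>: "0 \<le> \<sigma>" using n by (simp add: \<sigma>_def)
  \<comment> \<open>The error grows with \<open>|u|\<close>, so its value at \<open>t\<close> serves
    on the whole interval that \<open>damped_ode_bound\<close> looks at.\<close>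
  have \<delta>: "\<delta> u \<le> \<delta> t" if "\<bar>u\<bar> \<le> \<bar>t\<bar>" for u
    unfolding \<delta>_def using that n by (intro divide_right_mono add_right_mono mult_right_mono mult_left_mono) auto
  have nc: "nice (\<lambda>D. cos (u * ?W D))" and ns: "nice (\<lambda>D. sin (u * ?W D))" for u
    by (intro nice_compose[OF _ nW, of "\<lambda>x. cos (u * x)"] nice_compose[OF _ nW, of "\<lambda>x. sin (u * x)"] continuous_intros)+
  have bW: "AE D in \<rho>. \<bar>?W D\<bar> \<le> K" using AE_orth K by (auto elim!: eventually_mono)
  have dc: "((\<lambda>u. \<integral>D. cos (u * ?W D) \<partial>\<rho>) has_real_derivative (\<integral>D. - (?W D * sin (u * ?W D)) \<partial>\<rho>)) (at u)" for u
  proof (rule has_real_derivative_integral[where K = K and f' = "\<lambda>u D. - (?W D * sin (u * ?W D))"])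
    show "(\<lambda>D. - (?W D * sin (u * ?W D))) \<in> borel_measurable \<rho>"
      using nice_measurable[OF nice_mult[OF nW ns]] by simp
    show "AE D in \<rho>. \<forall>u. ((\<lambda>u. cos (u * ?W D)) has_real_derivative - (?W D * sin (u * ?W D))) (at u)"
      by (intro AE_I2 allI) (auto intro!: derivative_eq_intros)
    show "AE D in \<rho>. \<forall>u. \<bar>- (?W D * sin (u * ?W D))\<bar> \<le> K"
      using bW
    proof eventually_elim
      case (elim D)
      then show ?case by (auto simp: abs_mult intro!: order_trans[OF mult_left_le])
    qed
  qed (rule nice_integrable[OF nc])
  have ds: "((\<lambda>u. \<integral>D. sin (u * ?W D) \<partial>\<rho>) has_real_derivative (\<integral>D. ?W D * cos (u * ?W D) \<partial>\<rho>)) (at u)" for u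
  proof (rule has_real_derivative_integral[where K = K and f' = "\<lambda>u D. ?W D * cos (u * ?W D)"])
    show "(\<lambda>D. ?W D * cos (u * ?W D)) \<in> borel_measurable \<rho>"
      using nice_measurable[OF nice_mult[OF nW nc]] by simp
    show "AE D in \<rho>. \<forall>u. ((\<lambda>u. sin (u * ?W D)) has_real_derivative ?W D * cos (u * ?W D)) (at u)"
      by (intro AE_I2 allI) (auto intro!: derivative_eq_intros)
    show "AE D in \<rho>. \<forall>u. \<bar>?W D * cos (u * ?W D)\<bar> \<le> K"
      using bW
    proof eventually_elim
      case (elim D)
      then show ?case by (auto simp: abs_mult intro!: order_trans[OF mult_left_le])
    qed
  qed (rule nice_integrable[OF ns])
  have "\<bar>(\<integral>D. cos (t * ?W D) \<partial>\<rho>) - (\<integral>D. cos (0 * ?W D) \<partial>\<rho>) * exp (- \<sigma> * t\<^sup>2 / 2)\<bar> \<le> \<bar>t\<bar> * \<delta> t"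
  proof (rule damped_ode_bound[OF \<sigma> dc])
    fix u assume u: "\<bar>u\<bar> \<le> \<bar>t\<bar>"
    have "\<bar>(\<integral>D. ?W D * sin (u * ?W D) \<partial>\<rho>) - \<sigma> * (\<integral>D. u * cos (u * ?W D) \<partial>\<rho>)\<bar> \<le> \<delta> u"
      unfolding \<sigma>_def \<delta>_def
    proof (rule approx_stein_identity[OF n AE2 A, where \<phi> = "\<lambda>x. sin (u * x)" and \<phi>' = "\<lambda>x. u * cos (u * x)"])
      show "((\<lambda>x. sin (u * x)) has_real_derivative u * cos (u * x)) (at x)" for x
        by (auto intro!: derivative_eq_intros)
      show "\<bar>u * cos (u * x)\<bar> \<le> \<bar>u\<bar>" for x
        unfolding abs_mult by (intro mult_left_le) auto
    qed (auto intro!: continuous_intros)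
    also note \<delta>[OF u]
    finally show "\<bar>(\<integral>D. - (?W D * sin (u * ?W D)) \<partial>\<rho>) + \<sigma> * u * (\<integral>D. cos (u * ?W D) \<partial>\<rho>)\<bar> \<le> \<delta> t"
      by (simp add: abs_minus_commute algebra_simps)
  qed
  then show "\<bar>(\<integral>D. cos (t * ?W D) \<partial>\<rho>) - exp (- \<sigma> * t\<^sup>2 / 2)\<bar> \<le> \<bar>t\<bar> * \<delta> t"
    by (simp add: prob_space)
  have "\<bar>(\<integral>D. sin (t * ?W D) \<partial>\<rho>) - (\<integral>D. sin (0 * ?W D) \<partial>\<rho>) * exp (- \<sigma> * t\<^sup>2 / 2)\<bar> \<le> \<bar>t\<bar> * \<delta> t"
  proof (rule damped_ode_bound[OF \<sigma> ds])
    fix u assume u: "\<bar>u\<bar> \<le> \<bar>t\<bar>"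
    have "\<bar>(\<integral>D. ?W D * cos (u * ?W D) \<partial>\<rho>) - \<sigma> * (\<integral>D. - (u * sin (u * ?W D)) \<partial>\<rho>)\<bar> \<le> \<delta> u"
      unfolding \<sigma>_def \<delta>_def
    proof (rule approx_stein_identity[OF n AE2 A, where \<phi> = "\<lambda>x. cos (u * x)" and \<phi>' = "\<lambda>x. - (u * sin (u * x))"])
      show "((\<lambda>x. cos (u * x)) has_real_derivative - (u * sin (u * x))) (at x)" for x
        by (auto intro!: derivative_eq_intros)
      show "\<bar>- (u * sin (u * x))\<bar> \<le> \<bar>u\<bar>" for x
        unfolding abs_mult abs_minus_cancel by (intro mult_left_le) auto
    qed (auto intro!: continuous_intros)
    also note \<delta>[OF u]
    finally show "\<bar>(\<integral>D. ?W D * cos (u * ?W D) \<partial>\<rho>) + \<sigma> * u * (\<integral>D. sin (u * ?W D) \<partial>\<rho>)\<bar> \<le> \<delta> t"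
      by (simp add: algebra_simps)
  qed
  then show "\<bar>\<integral>D. sin (t * ?W D) \<partial>\<rho>\<bar> \<le> \<bar>t\<bar> * \<delta> t" by simp
qed

end

section \<open>Conjugates of the cycle\<close>

lemma cycle_mat_orth: "cycle_mat n \<in> orth_group n"
proof -
  have inj: "(i + 1) mod n = (j + 1) mod n \<longleftrightarrow> i = j" if "i < n" "j < n" for i j
    using that by (auto simp: mod_Suc split: if_splits)
  have "(\<Sum>k<n. cycle_mat n i k * cycle_mat n j k) = of_bool (i = j)" if "i < n" "j < n" for i j
  proof -
    have "(\<Sum>k<n. cycle_mat n i k * cycle_mat n j k) =
      (\<Sum>k<n. if k = (i + 1) mod n then of_bool ((i + 1) mod n = (j + 1) mod n) else 0)"
      using that by (intro sum.cong refl) (auto simp: cycle_mat_def)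
    also have "\<dots> = of_bool ((i + 1) mod n = (j + 1) mod n)"
      using that by (subst sum.delta) auto
    finally show ?thesis by (simp only: inj[OF that])
  qed
  then show ?thesis
    by (simp add: orth_group_iff) (simp add: cycle_mat_def space_mat_space)
qed

lemma mtrace_cycle_mat:
  assumes "2 \<le> n" shows "mtrace n (cycle_mat n) = 0"
  unfolding mtrace_def using assms
  by (intro sum.neutral) (auto simp: cycle_mat_def mod_Suc)

text \<open>A nonzero product would need \<open>k = i + 1\<close> and \<open>i = k + 1\<close>
  modulo \<open>n\<close>, so that \<open>n\<close> divides 2.\<close>

lemma mtrace_cycle_mat_square:
  assumes "3 \<le> n" shows "mtrace n (mmul n (cycle_mat n) (cycle_mat n)) = 0"
proof -
  have "cycle_mat n i k * cycle_mat n k i = 0" if "i < n" "k < n" for i k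
    using that assms by (auto simp: cycle_mat_def mod_Suc split: if_splits)
  then have "mmul n (cycle_mat n) (cycle_mat n) i i = 0" if "i < n" for i
    using that by (simp only: mmul_apply) (intro sum.neutral, auto)
  then show ?thesis by (simp add: mtrace_def)
qed

definition cycle_conj :: "nat \<Rightarrow> rmat \<Rightarrow> rmat" where
  "cycle_conj n M = mmul n M (mmul n (cycle_mat n) (mtrans n M))"

lemma measurable_cycle_conj: "cycle_conj n \<in> measurable (mat_space n) (mat_space n)"
  unfolding cycle_conj_def using orth_group_space[OF cycle_mat_orth]
  by (intro measurable_mmul measurable_mtrans measurable_const measurable_ident_sets) auto

lemma mtrace_conj:
  assumes "M \<in> orth_group n" "B \<in> space (mat_space n)"
  shows "mtrace n (mmul n M (mmul n B (mtrans n M))) = mtrace n B"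
proof -
  interpret mat_dim n .
  have "mtrace n (mmul n M (mmul n B (mtrans n M))) = mtrace n (mmul n (mmul n B (mtrans n M)) M)"
    unfolding mtrace_mmul by (rule tr_commute)
  also have "\<dots> = mtrace n B"
    using assms by (simp add: mmul_assoc orth_group_mtrans_mult mmul_mid_right)
  finally show ?thesis .
qed

lemma cycle_conj_square:
  assumes "M \<in> orth_group n"
  shows "mmul n (cycle_conj n M) (cycle_conj n M) = mmul n M (mmul n (mmul n (cycle_mat n) (cycle_mat n)) (mtrans n M))"
proof -
  have "mmul n (cycle_conj n M) (cycle_conj n M) =
    mmul n M (mmul n (cycle_mat n) (mmul n (mmul n (mtrans n M) M) (mmul n (cycle_mat n) (mtrans n M))))"
    by (simp add: cycle_conj_def mmul_assoc)
  then show ?thesis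
    using assms by (simp add: orth_group_mtrans_mult mmul_mid_left mmul_assoc)
qed

definition cycle_law :: "nat \<Rightarrow> rmat measure" where
  "cycle_law n = distr (haar_O n) (mat_space n) (cycle_conj n)"

lemma
  shows prob_space_haar_O: "prob_space (haar_O n)"
    and sets_haar_O: "sets (haar_O n) = sets (mat_space n)"
    and AE_haar_O: "AE M in haar_O n. M \<in> orth_group n"
    and haar_O_left: "Q \<in> orth_group n \<Longrightarrow> distr (haar_O n) (mat_space n) (\<lambda>M. mmul n Q M) = haar_O n"
  using is_haar_haar_O[of n] AE_orth_iff[of "haar_O n" n] by (auto simp: is_haar_def)

text \<open>Conjugating \<open>M C M^T\<close> by \<open>Q\<close> amounts to replacing
  \<open>M\<close> by \<open>Q M\<close>, so left invariance of Haar measure suffices. The traces of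
  \<open>D\<close> and \<open>D^2\<close> are those of \<open>C\<close> and \<open>C^2\<close>,
  which vanish for \<open>n\<close> at least 3.\<close>

lemma conj_inv_cycle_law:
  assumes n: "3 \<le> n"
  shows "conj_inv n (cycle_law n)"
    and "AE D in cycle_law n. mtrace n (mmul n D D) = 0"
proof -
  interpret mat_dim n .
  interpret H: prob_space "haar_O n" by (rule prob_space_haar_O)
  have m: "cycle_conj n \<in> measurable (haar_O n) (mat_space n)"
    using measurable_cycle_conj by (simp add: measurable_cong_sets[OF sets_haar_O refl])
  interpret D: prob_space "cycle_law n"
    unfolding cycle_law_def by (rule H.prob_space_distr[OF m])
  have trm: "mtrace n \<in> borel_measurable (mat_space n)"
    using nice_tr[OF mnice_id] by (simp add: nice_def)
  show "conj_inv n (cycle_law n)"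
  proof
    show "sets (cycle_law n) = sets (mat_space n)" by (simp add: cycle_law_def)
    have "{x \<in> space (mat_space n). x \<in> orth_group n} = orth_group n" by (auto simp: orth_group_def)
    then show "AE D in cycle_law n. D \<in> orth_group n"
      unfolding cycle_law_def using AE_haar_O[of n] sets_orth_group[of n]
      by (subst AE_distr_iff[OF m])
         (auto elim!: eventually_mono intro!: orth_group_mmul orth_group_mtrans cycle_mat_orth simp: cycle_conj_def)
    have "{x \<in> space (mat_space n). mtrace n x = 0} \<in> sets (mat_space n)"
      using trm by (intro borel_measurable_eq) auto
    moreover have "AE M in haar_O n. mtrace n (cycle_conj n M) = 0"
      using AE_haar_O
    proof eventually_elim
      case (elim M)
      then show ?case
        using n by (simp add: cycle_conj_def mtrace_conj orth_group_space[OF cycle_mat_orth] mtrace_cycle_mat)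
    qed
    ultimately show "AE D in cycle_law n. mtrace n D = 0"
      unfolding cycle_law_def by (subst AE_distr_iff[OF m]) auto
    fix Q assume Q: "Q \<in> orth_group n"
    have mQ: "(\<lambda>D. mmul n Q (mmul n D (mtrans n Q))) \<in> measurable (mat_space n) (mat_space n)"
      using Q by (intro measurable_mmul measurable_mtrans measurable_const measurable_ident_sets) (auto intro: orth_group_space)
    have mL: "(\<lambda>M. mmul n Q M) \<in> measurable (haar_O n) (mat_space n)"
      using Q by (intro measurable_mmul measurable_const measurable_ident_sets sets_haar_O) (auto intro: orth_group_space)
    have eq: "mmul n Q (mmul n (cycle_conj n M) (mtrans n Q)) = cycle_conj n (mmul n Q M)" for M
      by (simp add: cycle_conj_def mmul_assoc mtrans_mmul)
    have "distr (cycle_law n) (mat_space n) (\<lambda>D. mmul n Q (mmul n D (mtrans n Q))) =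
      distr (distr (haar_O n) (mat_space n) (\<lambda>M. mmul n Q M)) (mat_space n) (cycle_conj n)"
      unfolding cycle_law_def
      by (simp add: distr_distr[OF mQ m] distr_distr[OF measurable_cycle_conj mL] comp_def eq)
    then show "distr (cycle_law n) (mat_space n) (\<lambda>D. mmul n Q (mmul n D (mtrans n Q))) = cycle_law n"
      by (simp add: haar_O_left[OF Q] cycle_law_def)
  qed
  have "(\<lambda>D. mtrace n (mmul n D D)) \<in> borel_measurable (mat_space n)"
    by (intro measurable_compose[OF _ trm] measurable_mmul measurable_ident_sets) auto
  then have "{x \<in> space (mat_space n). mtrace n (mmul n x x) = 0} \<in> sets (mat_space n)"
    by (intro borel_measurable_eq) auto
  moreover have "AE M in haar_O n. mtrace n (mmul n (cycle_conj n M) (cycle_conj n M)) = 0"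
    using AE_haar_O
  proof eventually_elim
    case (elim M)
    then show ?case
      using n by (simp add: cycle_conj_square mtrace_conj mtrace_cycle_mat_square)
  qed
  ultimately show "AE D in cycle_law n. mtrace n (mmul n D D) = 0"
    unfolding cycle_law_def by (subst AE_distr_iff[OF m]) auto
qed

text \<open>For positive \<open>n\<close> this is, on indices below \<open>n\<close>, the
  Frobenius-orthogonal projection of \<open>A\<close> onto the matrices of trace zero.\<close>

definition traceless :: "nat \<Rightarrow> rmat \<Rightarrow> rmat" where
  "traceless n A = (\<lambda>i j. A i j - mtrace n A / real n * of_bool (i = j))"

lemma (in mat_dim) tr_traceless: "0 < n \<Longrightarrow> tr (traceless n A) = 0"
  unfolding mtrace_def[of n "traceless n A"]
  by (simp add: traceless_def sum_subtractf) (simp add: mtrace_def)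

lemma (in mat_dim) tr_mm_traceless: "tr (D \<odot> traceless n A) = tr (D \<odot> A) - mtrace n A / real n * tr D"
proof -
  have "(\<Sum>k<n. D i k * (mtrace n A / real n * of_bool (k = i))) = mtrace n A / real n * D i i" if "i < n" for i
  proof -
    have "(\<Sum>k<n. D i k * (mtrace n A / real n * of_bool (k = i))) = (\<Sum>k<n. if k = i then mtrace n A / real n * D i k else 0)"
      by (intro sum.cong refl) auto
    then show ?thesis using that by simp
  qed
  then have "(\<Sum>i<n. \<Sum>k<n. D i k * (mtrace n A / real n * of_bool (k = i))) = mtrace n A / real n * tr D"
    by (simp add: mtrace_def[of n D] sum_distrib_left)
  moreover have "tr (D \<odot> traceless n A) = (\<Sum>i<n. (D \<odot> traceless n A) i i)"
    by (simp only: mtrace_def)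
  then have "tr (D \<odot> traceless n A) =
      (\<Sum>i<n. \<Sum>k<n. D i k * A k i) - (\<Sum>i<n. \<Sum>k<n. D i k * (mtrace n A / real n * of_bool (k = i)))"
    by (simp only: mm_def traceless_def right_diff_distrib sum_subtractf)
  moreover have "tr (D \<odot> A) = (\<Sum>i<n. \<Sum>k<n. D i k * A k i)"
    by (simp add: mtrace_def mm_def)
  ultimately show ?thesis by simp
qed

text \<open>Pythagoras: the removed multiple of the identity has squared norm
  \<open>n (tr A / n)^2\<close>.\<close>

lemma (in mat_dim) fro_traceless:
  assumes "0 < n"
  shows "(fro (traceless n A))\<^sup>2 = (fro A)\<^sup>2 - (tr A)\<^sup>2 / real n"
proof -
  define c where "c = mtrace n A / real n"
  have "(fro (traceless n A))\<^sup>2 = (\<Sum>i<n. \<Sum>j<n. (A i j)\<^sup>2 - 2 * c * (A i j * of_bool (i = j)) + c\<^sup>2 * of_bool (i = j))"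
    unfolding fro_sq traceless_def c_def[symmetric] by (intro sum.cong refl) (auto simp: power2_eq_square algebra_simps)
  also have "\<dots> = (\<Sum>i<n. (\<Sum>j<n. (A i j)\<^sup>2) - 2 * c * A i i + c\<^sup>2)"
    by (intro sum.cong refl) (simp add: sum.distrib sum_subtractf flip: sum_distrib_left)
  also have "\<dots> = (fro A)\<^sup>2 - 2 * c * tr A + real n * c\<^sup>2"
    unfolding fro_sq by (simp add: sum.distrib sum_subtractf mtrace_def[of n A, symmetric] flip: sum_distrib_left)
  also have "\<dots> = (fro A)\<^sup>2 - (tr A)\<^sup>2 / real n"
    using assms by (simp add: c_def field_simps power2_eq_square)
  finally show ?thesis .
qed

lemma (in mat_dim) measurable_mtrace_mmul:
  "(\<lambda>D. mtrace n (mmul n A D)) \<in> borel_measurable (mat_space n)"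
proof -
  have "nice (\<lambda>D. tr (A \<odot> D))" by (intro nice_tr mnice_mm mnice_id mnice_const)
  then show ?thesis by (simp add: nice_def mtrace_mmul)
qed

lemma (in conj_inv) integral_mtrace_traceless:
  fixes h :: "real \<Rightarrow> real"
  assumes h: "continuous_on UNIV h"
  shows "(\<integral>D. h (mtrace n (mmul n A D)) \<partial>\<rho>) = (\<integral>D. h (tr (D \<odot> traceless n A)) \<partial>\<rho>)"
proof (rule integral_cong_AE)
  have "nice (\<lambda>D. h (tr (A \<odot> D)))" "nice (\<lambda>D. h (tr (D \<odot> traceless n A)))"
    by (intro nice_compose[OF h] nice_tr mnice_mm mnice_id mnice_const)+
  then show "(\<lambda>D. h (mtrace n (mmul n A D))) \<in> borel_measurable \<rho>"
    "(\<lambda>D. h (tr (D \<odot> traceless n A))) \<in> borel_measurable \<rho>"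
    unfolding mtrace_mmul by (auto intro: nice_measurable)
  show "AE D in \<rho>. h (mtrace n (mmul n A D)) = h (tr (D \<odot> traceless n A))"
    using AE_trace
  proof eventually_elim
    case (elim D)
    then show ?case using tr_commute[of A D] by (simp add: mtrace_mmul tr_mm_traceless)
  qed
qed

section \<open>Characteristic functions of the laws involved\<close>

lemma char_distr_real:
  assumes "prob_space M" "f \<in> borel_measurable M"
  shows "char (distr M borel f) t = complex_of_real (\<integral>x. cos (t * f x) \<partial>M) + \<i> * complex_of_real (\<integral>x. sin (t * f x) \<partial>M)"
proof -
  interpret prob_space M by fact
  have ic: "integrable M (\<lambda>x. cos (t * f x))" "integrable M (\<lambda>x. sin (t * f x))"
    using assms(2) by (auto intro!: integrable_const_bound[where B = 1])
  have "char (distr M borel f) t = (\<integral>x. iexp (t * f x) \<partial>M)"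
    unfolding char_def using assms(2) by (subst integral_distr) auto
  also have "\<dots> = (\<integral>x. complex_of_real (cos (t * f x)) + \<i> * complex_of_real (sin (t * f x)) \<partial>M)"
    by (intro Bochner_Integration.integral_cong refl) (simp add: exp_eq_polar cis_conv_exp[symmetric] complex_eq_iff flip: cis_conv_exp)
  also have "\<dots> = (\<integral>x. complex_of_real (cos (t * f x)) \<partial>M) + (\<integral>x. \<i> * complex_of_real (sin (t * f x)) \<partial>M)"
    using ic by (intro Bochner_Integration.integral_add integrable_mult_right integrable_of_real)
  also have "\<dots> = complex_of_real (\<integral>x. cos (t * f x) \<partial>M) + \<i> * complex_of_real (\<integral>x. sin (t * f x) \<partial>M)"
    using ic by simp
  finally show ?thesis .
qed

text \<open>As a scaled standard normal law, the point mass at \<open>v = 0\<close> is included, and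
  the characteristic function follows without a case distinction.\<close>

lemma normal_measure_eq_distr:
  assumes "0 \<le> v"
  shows "normal_measure 0 v = distr std_normal_distribution borel (\<lambda>x. sqrt v * x)"
proof (cases "v = 0")
  case True
  interpret prob_space std_normal_distribution
    by (rule prob_space_normal_density) simp
  have "distr std_normal_distribution borel (\<lambda>x. 0 :: real) = return borel 0"
    by (rule measure_eqI) (auto simp: emeasure_distr emeasure_space_1[simplified] split: split_indicator)
  with True show ?thesis by (simp add: normal_measure_def)
next
  case False
  interpret prob_space std_normal_distribution
    by (rule prob_space_normal_density) simp
  have "distributed std_normal_distribution lborel (\<lambda>x. x) std_normal_density"
    by (auto simp: distributed_def intro!: distr_id2)
  from normal_density_affine[OF this, of "sqrt v" 0]
  have "distributed std_normal_distribution lborel (\<lambda>x. 0 + sqrt v * x) (normal_density 0 (sqrt v))"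
    using False assms by simp
  then have "distr std_normal_distribution lborel (\<lambda>x. sqrt v * x) = density lborel (normal_density 0 (sqrt v))"
    by (simp add: distributed_def)
  moreover have "distr std_normal_distribution lborel (\<lambda>x. sqrt v * x) = distr std_normal_distribution borel (\<lambda>x. sqrt v * x)"
    by (rule distr_cong) auto
  ultimately show ?thesis using False by (simp add: normal_measure_def)
qed

lemma normal_measure_char:
  assumes "0 \<le> v"
  shows "real_distribution (normal_measure 0 v)" and "char (normal_measure 0 v) t = exp (- v * t\<^sup>2 / 2)"
proof -
  interpret real_distribution std_normal_distribution by (rule real_dist_normal_dist)
  show "real_distribution (normal_measure 0 v)"
    unfolding normal_measure_eq_distr[OF assms] by (rule real_distribution_distr) auto
  have "char (normal_measure 0 v) t = char std_normal_distribution (t * sqrt v)"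
    unfolding normal_measure_eq_distr[OF assms] char_def
    by (subst integral_distr) (auto simp: mult.assoc)
  also have "\<dots> = exp (- v * t\<^sup>2 / 2)"
    using assms by (simp add: char_std_normal_distribution power_mult_distrib mult.commute)
  finally show "char (normal_measure 0 v) t = exp (- v * t\<^sup>2 / 2)" .
qed

theorem theorem3p2:
  fixes A :: "nat \<Rightarrow> nat \<Rightarrow> nat \<Rightarrow> real" and c :: real
  assumes "\<And>n. mtrace n (mmul n (mtrans n (A n)) (A n)) = real n"
    and "(\<lambda>n. (\<Sum>i<n. \<Sum>j<n. if i \<noteq> j then A n i i * A n j j else 0) / (real n)\<^sup>2)
           \<longlonglongrightarrow> c"
  shows "weak_conv_m
           (\<lambda>n. distr (haar_O n) borel
                  (\<lambda>M. mtrace n (mmul n (A n) (mmul n M (mmul n (cycle_mat n) (mtrans n M))))))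
           (normal_measure 0 (1 - c))"
proof -
  define W where "W n D = mtrace n (mat_dim.mm n D (traceless n (A n)))" for n D
  define s where "s n = (mat_dim.fro n (traceless n (A n)))\<^sup>2 / (real n - 1)" for n
  let ?\<mu> = "\<lambda>n. distr (haar_O n) borel (\<lambda>M. mtrace n (mmul n (A n) (mmul n M (mmul n (cycle_mat n) (mtrans n M)))))"
  have froA: "(mat_dim.fro n (A n))\<^sup>2 = real n" for n
  proof -
    interpret mat_dim n .
    have "real n = (\<Sum>i<n. \<Sum>k<n. A n k i * A n k i)"
      using assms(1)[of n] by (simp add: mtrace_def mmul_apply mtrans_apply)
    also have "\<dots> = (\<Sum>i<n. \<Sum>k<n. (A n k i)\<^sup>2)" by (simp add: power2_eq_square)
    also have "\<dots> = (fro (A n))\<^sup>2" unfolding fro_sq by (rule sum.swap)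
    finally show ?thesis ..
  qed
  have fro0: "(mat_dim.fro n (traceless n (A n)))\<^sup>2 = real n - (mtrace n (A n))\<^sup>2 / real n" if "0 < n" for n
    using mat_dim.fro_traceless[OF that, of "A n"] by (simp add: froA)
  have diag: "(mtrace n (A n))\<^sup>2 = (\<Sum>i<n. \<Sum>j<n. if i \<noteq> j then A n i i * A n j j else 0) + (\<Sum>i<n. (A n i i)\<^sup>2)" for n
  proof -
    have "(mtrace n (A n))\<^sup>2 = (\<Sum>i<n. \<Sum>j<n. (if i \<noteq> j then A n i i * A n j j else 0) + (if j = i then (A n i i)\<^sup>2 else 0))"
      unfolding mtrace_def power2_eq_square sum_product by (intro sum.cong refl) auto
    then show ?thesis by (simp add: sum.distrib)
  qed
  have diag_le: "(\<Sum>i<n. (A n i i)\<^sup>2) \<le> real n" for n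
  proof -
    have "(\<Sum>i<n. (A n i i)\<^sup>2) \<le> (\<Sum>i<n. \<Sum>j<n. (A n i j)\<^sup>2)"
      by (intro sum_mono member_le_sum[where f = "\<lambda>j. (A n _ j)\<^sup>2"]) auto
    then show ?thesis using froA[of n] by (simp add: mat_dim.fro_sq)
  qed
  \<comment> \<open>The assumption omits the diagonal terms of \<open>(tr A)^2\<close>. Their sum is
    at most \<open>|A|^2 = n\<close>, which disappears after division by \<open>n^2\<close>.\<close>
  have "(\<lambda>n. (\<Sum>i<n. (A n i i)\<^sup>2) / (real n)\<^sup>2) \<longlonglongrightarrow> 0"
  proof (rule tendsto_sandwich[OF _ _ tendsto_const])
    show "\<forall>\<^sub>F n in sequentially. 0 \<le> (\<Sum>i<n. (A n i i)\<^sup>2) / (real n)\<^sup>2"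
      by (simp add: sum_nonneg)
    show "\<forall>\<^sub>F n in sequentially. (\<Sum>i<n. (A n i i)\<^sup>2) / (real n)\<^sup>2 \<le> 1 / real n"
    \<comment> \<open>The bound holds even at \<open>n = 0\<close>, where all quotients are zero by
      convention.\<close>
    proof (rule always_eventually, rule allI)
      fix n
      have "(\<Sum>i<n. (A n i i)\<^sup>2) / (real n)\<^sup>2 \<le> real n / (real n)\<^sup>2"
        by (intro divide_right_mono diag_le) auto
      also have "\<dots> = 1 / real n" by (simp add: power2_eq_square)
      finally show "(\<Sum>i<n. (A n i i)\<^sup>2) / (real n)\<^sup>2 \<le> 1 / real n" .
    qed
    show "(\<lambda>n. 1 / real n) \<longlonglongrightarrow> 0" by (rule lim_1_over_n)
  qed
  from tendsto_add[OF assms(2) this] have trlim: "(\<lambda>n. (mtrace n (A n))\<^sup>2 / (real n)\<^sup>2) \<longlonglongrightarrow> c"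
    by (simp add: diag add_divide_distrib)
  have s_eq: "s n = (1 - (mtrace n (A n))\<^sup>2 / (real n)\<^sup>2) * (real n / (real n - 1))" if "2 \<le> n" for n
  proof -
    have "0 < n" using that by simp
    then show ?thesis
      unfolding s_def fro0[OF \<open>0 < n\<close>] using that by (simp add: field_simps power2_eq_square)
  qed
  have "(\<lambda>n. real n / (real n - 1)) \<longlonglongrightarrow> 1" by real_asymp
  from tendsto_mult[OF tendsto_diff[OF tendsto_const trlim] this, of 1]
  have "(\<lambda>n. (1 - (mtrace n (A n))\<^sup>2 / (real n)\<^sup>2) * (real n / (real n - 1))) \<longlonglongrightarrow> 1 - c" by simp
  then have slim: "s \<longlonglongrightarrow> 1 - c"
    by (rule Lim_transform_eventually) (use s_eq in \<open>auto simp: eventually_sequentially intro!: exI[of _ 2]\<close>)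
  have spos: "0 \<le> s n" if "2 \<le> n" for n using that by (simp add: s_def)
  \<comment> \<open>The bound \<open>c \<le> 1\<close> is derived: \<open>1 - c\<close> is a limit
    of normalised squared norms. In the boundary case \<open>c = 1\<close> the limit law is a point
    mass.\<close>
  have c: "0 \<le> 1 - c"
    by (rule tendsto_lowerbound[OF slim]) (use spos in \<open>auto simp: eventually_sequentially intro!: exI[of _ 2]\<close>)
  have meas: "(\<lambda>M. mtrace n (mmul n (A n) (mmul n M (mmul n (cycle_mat n) (mtrans n M))))) \<in> borel_measurable (haar_O n)" for n
    using measurable_compose[OF measurable_cycle_conj mat_dim.measurable_mtrace_mmul[of n "A n"]]
    by (simp add: cycle_conj_def measurable_cong_sets[OF sets_haar_O refl])
  have rd: "real_distribution (?\<mu> n)" for n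
    using meas by (intro prob_space.real_distribution_distr prob_space_haar_O)
  \<comment> \<open>Passage from Haar measure to the law of \<open>D\<close> and from
    \<open>A\<close> to its traceless part, stated for continuous \<open>h\<close> so that it serves
    cosine and sine alike.\<close>
  have eqs: "(\<integral>M. h (mtrace n (mmul n (A n) (mmul n M (mmul n (cycle_mat n) (mtrans n M))))) \<partial>haar_O n) =
     (\<integral>D. h (W n D) \<partial>cycle_law n)"
    if n: "3 \<le> n" and h: "continuous_on UNIV h" for n and h :: "real \<Rightarrow> real"
  proof -
    have m: "cycle_conj n \<in> measurable (haar_O n) (mat_space n)"
      using measurable_cycle_conj by (simp add: measurable_cong_sets[OF sets_haar_O refl])
    have hm: "(\<lambda>D. h (mtrace n (mmul n (A n) D))) \<in> borel_measurable (mat_space n)"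
      by (rule measurable_compose[OF mat_dim.measurable_mtrace_mmul borel_measurable_continuous_onI[OF h]])
    have "(\<integral>M. h (mtrace n (mmul n (A n) (mmul n M (mmul n (cycle_mat n) (mtrans n M))))) \<partial>haar_O n) =
      (\<integral>D. h (mtrace n (mmul n (A n) D)) \<partial>cycle_law n)"
      unfolding cycle_law_def integral_distr[OF m hm] by (simp add: cycle_conj_def)
    also have "\<dots> = (\<integral>D. h (W n D) \<partial>cycle_law n)"
      unfolding W_def by (rule conj_inv.integral_mtrace_traceless[OF conj_inv_cycle_law(1)[OF n] h])
    finally show ?thesis .
  qed
  have bounds: "\<bar>(\<integral>D. cos (t * W n D) \<partial>cycle_law n) - exp (- s n * t\<^sup>2 / 2)\<bar> \<le> \<bar>t\<bar> * ((60 * \<bar>t\<bar> * sqrt (real n) + 13) / (real n - 1))"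
    "\<bar>\<integral>D. sin (t * W n D) \<partial>cycle_law n\<bar> \<le> \<bar>t\<bar> * ((60 * \<bar>t\<bar> * sqrt (real n) + 13) / (real n - 1))"
    if n: "3 \<le> n" for n t
  proof -
    have 1: "AE D in cycle_law n. mtrace n (mat_dim.mm n D D) = 0"
      using conj_inv_cycle_law(2)[OF n] by (simp add: mat_dim.mtrace_mmul)
    have 2: "mtrace n (traceless n (A n)) = 0" using n by (intro mat_dim.tr_traceless) simp
    have 3: "(mat_dim.fro n (traceless n (A n)))\<^sup>2 \<le> real n" using n by (subst fro0) auto
    show "\<bar>(\<integral>D. cos (t * W n D) \<partial>cycle_law n) - exp (- s n * t\<^sup>2 / 2)\<bar> \<le> \<bar>t\<bar> * ((60 * \<bar>t\<bar> * sqrt (real n) + 13) / (real n - 1))"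
      "\<bar>\<integral>D. sin (t * W n D) \<partial>cycle_law n\<bar> \<le> \<bar>t\<bar> * ((60 * \<bar>t\<bar> * sqrt (real n) + 13) / (real n - 1))"
      unfolding W_def s_def by (rule conj_inv.cos_sin_bounds[OF conj_inv_cycle_law(1)[OF n] n 1 2 3])+
  qed
  have charlim: "(\<lambda>n. char (?\<mu> n) t) \<longlonglongrightarrow> char (normal_measure 0 (1 - c)) t" for t
  proof -
    have ev: "\<forall>\<^sub>F n in sequentially. 3 \<le> n" by (rule eventually_ge_at_top)
    \<comment> \<open>For fixed \<open>t\<close> the error is of order \<open>1 / sqrt n\<close>;
      the term with \<open>sqrt n\<close> comes from the fluctuation of the squared
      gradient.\<close>
    have err: "(\<lambda>n. \<bar>t\<bar> * ((60 * \<bar>t\<bar> * sqrt (real n) + 13) / (real n - 1))) \<longlonglongrightarrow> 0"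
    proof -
      have "(\<lambda>n. sqrt (real n) / (real n - 1)) \<longlonglongrightarrow> 0" "(\<lambda>n. 1 / (real n - 1)) \<longlonglongrightarrow> 0" by real_asymp+
      then have "(\<lambda>n. \<bar>t\<bar> * (60 * \<bar>t\<bar> * (sqrt (real n) / (real n - 1)) + 13 * (1 / (real n - 1)))) \<longlonglongrightarrow> \<bar>t\<bar> * (60 * \<bar>t\<bar> * 0 + 13 * 0)"
        by (intro tendsto_intros)
      then show ?thesis by (simp add: add_divide_distrib)
    qed
    have "(\<lambda>n. (\<integral>D. cos (t * W n D) \<partial>cycle_law n) - exp (- s n * t\<^sup>2 / 2)) \<longlonglongrightarrow> 0"
      by (rule Lim_null_comparison[OF _ err], rule eventually_mono[OF ev], unfold real_norm_def) (rule bounds(1))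
    moreover have "(\<lambda>n. exp (- s n * t\<^sup>2 / 2)) \<longlonglongrightarrow> exp (- (1 - c) * t\<^sup>2 / 2)"
      by (intro tendsto_intros slim) auto
    ultimately have coslim: "(\<lambda>n. \<integral>D. cos (t * W n D) \<partial>cycle_law n) \<longlonglongrightarrow> exp (- (1 - c) * t\<^sup>2 / 2)"
      using tendsto_add by force
    have sinlim: "(\<lambda>n. \<integral>D. sin (t * W n D) \<partial>cycle_law n) \<longlonglongrightarrow> 0"
      by (rule Lim_null_comparison[OF _ err], rule eventually_mono[OF ev], unfold real_norm_def) (rule bounds(2))
    have "(\<lambda>n. complex_of_real (\<integral>D. cos (t * W n D) \<partial>cycle_law n) + \<i> * complex_of_real (\<integral>D. sin (t * W n D) \<partial>cycle_law n))
      \<longlonglongrightarrow> complex_of_real (exp (- (1 - c) * t\<^sup>2 / 2)) + \<i> * complex_of_real 0"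
      by (intro tendsto_intros coslim sinlim)
    moreover have "\<forall>\<^sub>F n in sequentially. complex_of_real (\<integral>D. cos (t * W n D) \<partial>cycle_law n) + \<i> * complex_of_real (\<integral>D. sin (t * W n D) \<partial>cycle_law n) = char (?\<mu> n) t"
      using ev
    proof eventually_elim
      case (elim n)
      have "continuous_on UNIV (\<lambda>x. cos (t * x))" "continuous_on UNIV (\<lambda>x. sin (t * x))"
        by (intro continuous_intros)+
      from this[THEN eqs[OF elim]] show ?case
        unfolding char_distr_real[OF prob_space_haar_O meas] by simp
    qed
    ultimately have "(\<lambda>n. char (?\<mu> n) t) \<longlonglongrightarrow> complex_of_real (exp (- (1 - c) * t\<^sup>2 / 2)) + \<i> * complex_of_real 0"
      by (rule Lim_transform_eventually)
    then show ?thesis by (simp add: normal_measure_char(2)[OF c])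
  qed
  show ?thesis
    by (rule levy_continuity[OF rd normal_measure_char(1)[OF c] charlim])
qed

end
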